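(* Let $F$ be a perfect field. Then the automorphism group of the nonassociative simple Moufang loop $M^*(F)$ constructed over $F$ is isomorphic to the semidirect product $G_2(F)\rtimes\mathrm{Aut}(F)$. Every automorphism of $M^*(F)$ is induced by a semilinear automorphism of the split octonion algebra $\mathbb O(F)$.
   Context: A field $F$ of characteristic $p>0$ is perfect if $x\mapsto x^p$ is an automorphism of $F$ (fields of characteristic $0$ are perfect). For a field $F$, the split octonion algebra $\mathbb O(F)$ is the Zorn vector matrix algebra: its elements are $\left(\begin{array}{cc}a&\alpha\\ \beta&b\end{array}\right)$ with $a,b\in F$, $\alpha,\beta\in F^3$, added componentwise and multiplied by $$\left(\begin{array}{cc}a&\alpha\\ \beta&b\end{array}\right)\left(\begin{array}{cc}c&\gamma\\ \delta&d\end{array}\right)=\left(\begin{array}{cc}ac+\alpha\cdot\delta& a\gamma+d\alpha-\beta\times\delta\\ c\beta+b\delta+\alpha\times\gamma&\beta\cdot\gamma+bd\end{array}\right),$$ with the usual dot and cross products on $F^3$. The norm is $\det\left(\begin{array}{cc}a&\alpha\\ \beta&b\end{array}\right)=ab-\alpha\cdot\beta$; it is multiplicative. $M(F)$ is the Moufang loop of all elements of norm $1$, $Z$ is its center ($Z=\{e\}$ if $\mathrm{char}\,F=2$ and $Z=\{e,-e\}$ otherwise, $e$ being the identity element), and $M^*(F)=M(F)/Z$. A linear (resp. semilinear) automorphism of $\mathbb O(F)$ is a bijective $F$-linear (resp. $F$-semilinear) map $\alpha:\mathbb O(F)\to\mathbb O(F)$ with $(uv)\alpha=(u\alpha)(v\alpha)$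 for all $u,v$. $G_2(F)$ denotes the Chevalley group of type $G_2$ over $F$, which is isomorphic to the group of linear automorphisms of $\mathbb O(F)$; the group of semilinear automorphisms of $\mathbb O(F)$ is isomorphic to $G_2(F)\rtimes\mathrm{Aut}(F)$. *)

theory Defs
  imports "HOL-Analysis.Analysis" "HOL-Algebra.Bij" "HOL-Algebra.Generated_Groups"
begin

section \<open>Fields\<close>

definition field_automorphism :: "('a::field \<Rightarrow> 'a) \<Rightarrow> bool" where
  "field_automorphism \<sigma> \<longleftrightarrow>
     bij \<sigma> \<and> (\<forall>x y. \<sigma> (x + y) = \<sigma> x + \<sigma> y) \<and> (\<forall>x y. \<sigma> (x * y) = \<sigma> x * \<sigma> y)"

definition field_Aut :: "('a::field \<Rightarrow> 'a) monoid" where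
  "field_Aut = \<lparr>carrier = Collect field_automorphism, mult = (\<circ>), one = id\<rparr>"

definition perfect_field :: "'a::field itself \<Rightarrow> bool" where
  "perfect_field _ \<longleftrightarrow>
     (CHAR('a) > 0 \<longrightarrow> field_automorphism (\<lambda>x::'a. x ^ CHAR('a)))"


section \<open>Semidirect products\<close>

definition semidirect_product ::
    "('a, 'c) monoid_scheme \<Rightarrow> ('b, 'd) monoid_scheme \<Rightarrow> ('b \<Rightarrow> 'a \<Rightarrow> 'a) \<Rightarrow> ('a \<times> 'b) monoid" where
  "semidirect_product N H \<theta> =
     \<lparr>carrier = carrier N \<times> carrier H,
      mult = (\<lambda>(n, h) (n', h'). (n \<otimes>\<^bsub>N\<^esub> \<theta> h n', h \<otimes>\<^bsub>H\<^esub> h')),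
      one = (\<one>\<^bsub>N\<^esub>, \<one>\<^bsub>H\<^esub>)\<rparr>"


section \<open>Dot and cross product\<close>

text \<open>The library versions (\<open>inner\<close> and \<open>cross3\<close>) are restricted to the reals.\<close>

definition dot :: "'a::comm_ring_1 ^ 3 \<Rightarrow> 'a ^ 3 \<Rightarrow> 'a" where
  "dot u v = (\<Sum>i\<in>UNIV. u $ i * v $ i)"

definition cross :: "'a::comm_ring_1 ^ 3 \<Rightarrow> 'a ^ 3 \<Rightarrow> 'a ^ 3" where
  "cross u v = vector [u $ 2 * v $ 3 - u $ 3 * v $ 2,
                       u $ 3 * v $ 1 - u $ 1 * v $ 3,
                       u $ 1 * v $ 2 - u $ 2 * v $ 1]"


section \<open>Split octonions: the Zorn vector matrix algebra\<close>

text \<open>\<open>Zorn a \<alpha> \<beta> b\<close> is the vector matrix with first row \<open>a, \<alpha>\<close> and second row \<open>\<beta>, b\<close>.\<close>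

datatype 'a zorn = Zorn 'a "'a ^ 3" "'a ^ 3" 'a

instantiation zorn :: (comm_ring_1) "{one, uminus, plus, times}"
begin

definition one_zorn :: "'a zorn" where
  "one_zorn = Zorn 1 0 0 1"

fun uminus_zorn :: "'a zorn \<Rightarrow> 'a zorn" where
  "- Zorn a \<alpha> \<beta> b = Zorn (- a) (- \<alpha>) (- \<beta>) (- b)"

fun plus_zorn :: "'a zorn \<Rightarrow> 'a zorn \<Rightarrow> 'a zorn" where
  "Zorn a \<alpha> \<beta> b + Zorn c \<gamma> \<delta> d = Zorn (a + c) (\<alpha> + \<gamma>) (\<beta> + \<delta>) (b + d)"

fun times_zorn :: "'a zorn \<Rightarrow> 'a zorn \<Rightarrow> 'a zorn" where
  "Zorn a \<alpha> \<beta> b * Zorn c \<gamma> \<delta> d =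
     Zorn (a * c + dot \<alpha> \<delta>) (a *s \<gamma> + d *s \<alpha> - cross \<beta> \<delta>)
          (c *s \<beta> + b *s \<delta> + cross \<alpha> \<gamma>) (dot \<beta> \<gamma> + b * d)"

instance ..

end

fun zorn_scale :: "'a::comm_ring_1 \<Rightarrow> 'a zorn \<Rightarrow> 'a zorn" where
  "zorn_scale c (Zorn a \<alpha> \<beta> b) = Zorn (c * a) (c *s \<alpha>) (c *s \<beta>) (c * b)"

fun zorn_norm :: "'a::comm_ring_1 zorn \<Rightarrow> 'a" where
  "zorn_norm (Zorn a \<alpha> \<beta> b) = a * b - dot \<alpha> \<beta>"

definition semilinear_automorphism :: "('a::field zorn \<Rightarrow> 'a zorn) \<Rightarrow> bool" where
  "semilinear_automorphism f \<longleftrightarrow>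
     bij f \<and> (\<forall>u v. f (u + v) = f u + f v) \<and> (\<forall>u v. f (u * v) = f u * f v) \<and>
     (\<exists>\<sigma>. field_automorphism \<sigma> \<and> (\<forall>c u. f (zorn_scale c u) = zorn_scale (\<sigma> c) (f u)))"


section \<open>The Moufang loops \<open>M(F)\<close> and \<open>M*(F)\<close>\<close>

text \<open>
  The record type of the library's monoids serves as a bare magma with unit here; associativity
  is not part of it, and neither \<open>Mod\<close> nor \<open>AutoGroup\<close> presupposes it.
\<close>

definition loop_center :: "('a, 'b) monoid_scheme \<Rightarrow> 'a set" where
  "loop_center L =
     {z \<in> carrier L. (\<forall>x\<in>carrier L. z \<otimes>\<^bsub>L\<^esub> x = x \<otimes>\<^bsub>L\<^esub> z) \<and>
       (\<forall>x\<in>carrier L. \<forall>y\<in>carrier L.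
          (z \<otimes>\<^bsub>L\<^esub> x) \<otimes>\<^bsub>L\<^esub> y = z \<otimes>\<^bsub>L\<^esub> (x \<otimes>\<^bsub>L\<^esub> y) \<and>
          (x \<otimes>\<^bsub>L\<^esub> z) \<otimes>\<^bsub>L\<^esub> y = x \<otimes>\<^bsub>L\<^esub> (z \<otimes>\<^bsub>L\<^esub> y) \<and>
          (x \<otimes>\<^bsub>L\<^esub> y) \<otimes>\<^bsub>L\<^esub> z = x \<otimes>\<^bsub>L\<^esub> (y \<otimes>\<^bsub>L\<^esub> z))}"

definition moufang_M :: "'a::field zorn monoid" where
  "moufang_M = \<lparr>carrier = {u. zorn_norm u = 1}, mult = (*), one = 1\<rparr>"

lemma loop_center_moufang_M: "loop_center (moufang_M :: 'a::field zorn monoid) = {1, - 1}"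
proof
  have norm_1: "zorn_norm (1 :: 'a zorn) = 1" "zorn_norm (- 1 :: 'a zorn) = 1"
    by (simp_all add: one_zorn_def dot_def)
  have c1: "1 * u = u" "u * 1 = u" "(- 1) * u = - u" "u * (- 1) = - u" for u :: "'a zorn"
    by (cases u; simp add: one_zorn_def dot_def cross_def vec_eq_iff forall_3 sum_3)+
  have c2: "(- u) * v = - (u * v)" "u * (- v) = - (u * v)" for u v :: "'a zorn"
    by (cases u; cases v; simp add: dot_def cross_def vec_eq_iff forall_3 sum_3 algebra_simps)+
  show "{1, - 1} \<subseteq> loop_center (moufang_M :: 'a zorn monoid)"
    using norm_1 by (auto simp: loop_center_def moufang_M_def c1 c2)
  show "loop_center (moufang_M :: 'a zorn monoid) \<subseteq> {1, - 1}"
  proof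
    fix z :: "'a zorn" assume "z \<in> loop_center moufang_M"
    then have nz: "zorn_norm z = 1" and comm: "\<And>x. zorn_norm x = 1 \<Longrightarrow> z * x = x * z"
      by (auto simp: loop_center_def moufang_M_def)
    obtain a \<alpha> \<beta> b where z: "z = Zorn a \<alpha> \<beta> b" by (cases z)
    have c: "Zorn a \<alpha> \<beta> b * Zorn 0 u v 0 = Zorn 0 u v 0 * Zorn a \<alpha> \<beta> b" if "dot u v = - 1" for u v
      using comm[of "Zorn 0 u v 0"] that z by simp
    have d: "dot \<alpha> v = dot u \<beta>" if "dot u v = - 1" for u v
      using c[OF that] by simp
    have e: "\<alpha> $ 1 * p + \<alpha> $ 2 * q + \<alpha> $ 3 * r = \<beta> $ 1 * k + \<beta> $ 2 * l + \<beta> $ 3 * m"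
      if "k * p + l * q + m * r = - 1" for p q r k l m
      using d[of "vector [k, l, m]" "vector [p, q, r]"] that by (simp add: dot_def sum_3 algebra_simps)
    have "\<alpha> $ 2 = 0" "\<alpha> $ 3 = 0" "\<beta> $ 2 = 0" "\<beta> $ 3 = 0"
      using e[of 1 "-1" 0 0 0 0] e[of 1 "-1" 0 1 0 0] e[of 1 "-1" 0 0 0 1]
        e[of 1 "-1" 1 0 0 0] e[of 1 "-1" 0 0 1 0] by simp_all
    moreover from this have "\<alpha> $ 1 = 0" "\<beta> $ 1 = 0"
      using e[of 0 1 1 "-1" 0 0] e[of 1 "-1" 0 0 0 0] by simp_all
    ultimately have zero: "\<alpha> = 0" "\<beta> = 0" by (simp_all add: vec_eq_iff forall_3)
    have "a *s u - cross \<beta> v = b *s u - cross v \<beta>" if "dot u v = - 1" for u v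
      using c[OF that] by simp
    from arg_cong[OF this[of "vector [1,0,0]" "vector [-1,0,0]"], of "\<lambda>x. x $ 1"]
    have ab: "a = b" unfolding zero by (simp add: dot_def cross_def sum_3)
    have "a * a = 1" using nz unfolding z zero ab by (simp add: dot_def)
    then have "a = 1 \<or> a = - 1" by (simp add: square_eq_1_iff)
    then show "z \<in> {1, - 1}" unfolding z zero ab by (auto simp: one_zorn_def)
  qed
qed

definition moufang_Mstar :: "'a::field zorn set monoid" where
  "moufang_Mstar = moufang_M Mod loop_center moufang_M"

definition induces_on_Mstar :: "('a::field zorn \<Rightarrow> 'a zorn) \<Rightarrow> ('a zorn set \<Rightarrow> 'a zorn set) \<Rightarrow> bool" where
  "induces_on_Mstar f \<phi> \<longleftrightarrow>
     (\<forall>u\<in>carrier moufang_M. f u \<in> carrier moufang_M \<and>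
        \<phi> (loop_center moufang_M #>\<^bsub>moufang_M\<^esub> u) = loop_center moufang_M #>\<^bsub>moufang_M\<^esub> f u)"


section \<open>The Chevalley group of type \<open>G\<^sub>2\<close>\<close>

text \<open>
  The Lie algebra of type \<open>G\<^sub>2\<close> in its \<open>A\<^sub>2\<close>-graded form \<open>sl\<^sub>3 \<oplus> V \<oplus> V*\<close> with \<open>V\<close> the natural
  module: a triple \<open>(A, v, w)\<close> consists of a trace zero matrix, a column vector and a covector.
  If \<open>\<epsilon>\<^sub>1 + \<epsilon>\<^sub>2 + \<epsilon>\<^sub>3 = 0\<close> are the weights of \<open>V\<close>, the long roots are the \<open>\<epsilon>\<^sub>i - \<epsilon>\<^sub>j\<close>, and the short
  roots are the \<open>\<plusminus>\<epsilon>\<^sub>i\<close>; for instance, \<open>\<epsilon>\<^sub>2\<close> and \<open>\<epsilon>\<^sub>1 - \<epsilon>\<^sub>2\<close> are simple roots.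
\<close>

type_synonym 'r g2_lie = "('r ^ 3 ^ 3) \<times> ('r ^ 3) \<times> ('r ^ 3)"

fun g2_bracket :: "'r::comm_ring_1 g2_lie \<Rightarrow> 'r g2_lie \<Rightarrow> 'r g2_lie" where
  "g2_bracket (A, v, w) (B, x, y) =
     (A ** B - B ** A
        + (\<chi> i j. 3 * (v $ i * y $ j - x $ i * w $ j) - (if i = j then dot v y - dot x w else 0)),
      A *v x - B *v v - 2 *s cross w y,
      w v* B - y v* A + 2 *s cross v x)"

text \<open>
  Indices in the type \<open>3\<close> are taken modulo 3. \<open>Up i\<close>, \<open>Down i\<close>, \<open>Vec i\<close> and \<open>Cov i\<close> stand for the
  roots \<open>\<epsilon>\<^sub>i - \<epsilon>\<^sub>i\<^sub>+\<^sub>1\<close>, \<open>\<epsilon>\<^sub>i\<^sub>+\<^sub>1 - \<epsilon>\<^sub>i\<close>, \<open>\<epsilon>\<^sub>i\<close> and \<open>- \<epsilon>\<^sub>i\<close>.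
\<close>

datatype g2_root = Up 3 | Down 3 | Vec 3 | Cov 3

datatype g2_index = H1 | H2 | E g2_root

instance g2_root :: finite
proof
  have "r \<in> range Up \<union> range Down \<union> range Vec \<union> range Cov" for r
    by (cases r) simp_all
  then have eq: "UNIV = range Up \<union> range Down \<union> range Vec \<union> range Cov" by blast
  show "finite (UNIV :: g2_root set)" unfolding eq by simp
qed

instance g2_index :: finite
proof
  have "i \<in> {H1, H2} \<union> range E" for i
    by (cases i) simp_all
  then have eq: "UNIV = {H1, H2} \<union> range E" by blast
  show "finite (UNIV :: g2_index set)" unfolding eq by simp
qed

definition matrix_unit :: "3 \<Rightarrow> 3 \<Rightarrow> int ^ 3 ^ 3" where
  "matrix_unit k l = (\<chi> i j. if i = k \<and> j = l then 1 else 0)"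

text \<open>
  A Chevalley basis of the integral form (\<open>[e\<^sub>r, e\<^sub>-\<^sub>r]\<close> is the coroot of \<open>r\<close>, and
  \<open>e\<^sub>r \<mapsto> - e\<^sub>-\<^sub>r\<close> extends to an automorphism): root vectors together with the coroots
  \<open>diag(1, -1, 0)\<close> and \<open>diag(0, 1, -1)\<close>, which span all coroots over the integers.
\<close>

fun g2_basis :: "g2_index \<Rightarrow> int g2_lie" where
  "g2_basis H1 = (matrix_unit 1 1 - matrix_unit 2 2, 0, 0)"
| "g2_basis H2 = (matrix_unit 2 2 - matrix_unit 3 3, 0, 0)"
| "g2_basis (E (Up i)) = (matrix_unit i (i + 1), 0, 0)"
| "g2_basis (E (Down i)) = (matrix_unit (i + 1) i, 0, 0)"
| "g2_basis (E (Vec i)) = (0, axis i 1, 0)"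
| "g2_basis (E (Cov i)) = (0, 0, axis i 1)"

text \<open>Coordinates with respect to this basis, for triples whose matrix has trace zero.\<close>

fun g2_coord :: "int g2_lie \<Rightarrow> g2_index \<Rightarrow> int" where
  "g2_coord (A, v, w) H1 = A $ 1 $ 1"
| "g2_coord (A, v, w) H2 = - (A $ 3 $ 3)"
| "g2_coord (A, v, w) (E (Up i)) = A $ i $ (i + 1)"
| "g2_coord (A, v, w) (E (Down i)) = A $ (i + 1) $ i"
| "g2_coord (A, v, w) (E (Vec i)) = v $ i"
| "g2_coord (A, v, w) (E (Cov i)) = w $ i"

definition g2_ad :: "g2_root \<Rightarrow> int ^ g2_index ^ g2_index" where
  "g2_ad r = (\<chi> i j. g2_coord (g2_bracket (g2_basis (E r)) (g2_basis j)) i)"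

text \<open>
  \<open>x\<^sub>r(t) = exp (t ad e\<^sub>r)\<close>, acting on the Chevalley basis with scalars extended to the field.
  The series stops after the third power since \<open>(ad e\<^sub>r)\<^sup>4 = 0\<close>. The matrices \<open>(ad e\<^sub>r)\<^sup>k / k!\<close>
  have integer entries, so the integer division is exact.
\<close>

definition g2_x :: "g2_root \<Rightarrow> 'a::field \<Rightarrow> 'a ^ g2_index ^ g2_index" where
  "g2_x r t = (\<chi> i j. \<Sum>k\<le>3. of_int ((((**) (g2_ad r) ^^ k) (mat 1) $ i $ j) div fact k) * t ^ k)"

definition GL :: "('a::field ^ 'n ^ 'n) monoid" where
  "GL = \<lparr>carrier = {A. invertible A}, mult = (**), one = mat 1\<rparr>"

definition G2 :: "('a::field ^ g2_index ^ g2_index) monoid" where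
  "G2 = GL \<lparr>carrier := generate GL {g2_x r t | r t. True}\<rparr>"

text \<open>
  \<open>Aut(F)\<close> acts on \<open>G\<^sub>2(F)\<close> by field automorphisms, that is, by applying them to the matrix
  entries; thus \<open>\<sigma>\<close> sends \<open>x\<^sub>r(t)\<close> to \<open>x\<^sub>r(\<sigma>(t))\<close>.
\<close>

definition G2_semidirect_Aut :: "(('a::field ^ g2_index ^ g2_index) \<times> ('a \<Rightarrow> 'a)) monoid" where
  "G2_semidirect_Aut = semidirect_product G2 field_Aut map_matrix"

end

theory Submission
  imports Defs
begin

text \<open>
  Write \<open>e\<^sub>i\<close> and \<open>f\<^sub>i\<close> for the upper and lower unit vectors of the Zorn algebra \<open>O\<close>, and \<open>M\<close> for
  the loop of elements of norm 1. The proof recovers \<open>O\<close> from the unipotent elements \<open>1 + n\<close>,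
  \<open>n * n = 0\<close>, of \<open>M\<close> and treats \<open>G\<^sub>2\<close> through its action on \<open>O\<close>.

  Lifting. An automorphism of \<open>M\<close> modulo sign is a map \<open>g\<close> on \<open>M\<close> that is multiplicative up to sign.
  Three properties can be read off from products up to sign.
  First, being unipotent: an element of norm 1 satisfies \<open>u * u = t u - 1\<close> with \<open>t\<close> its trace, and
  \<open>t = 2\<close> or \<open>t = -2\<close> can be expressed by \<open>u\<^sup>p = 1\<close> in characteristic 2, 3, 5, and otherwise by
  \<open>u\<close> being conjugate to \<open>u\<^sup>4\<close> but not of order 3 or 5 (lemma \<open>unip_g\<close>).
  So \<open>g\<close> sends \<open>1 + n\<close> to \<open>1 + \<nu> n\<close> up to sign, for a bijection \<open>\<nu>\<close> of the elements of square zero.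
  Second, the value -1 of the trace form: for \<open>n \<noteq> m\<close>, the braid relation between \<open>1 + n\<close> and
  \<open>1 + m\<close> means \<open>tr (n * m) = -1\<close> (lemma \<open>braid_iff\<close>).
  Third, proportionality: for distinct nonzero \<open>n\<close> and \<open>k\<close> of square zero, \<open>k\<close> is a multiple of
  \<open>n\<close> if and only if no \<open>m\<close> of square zero has \<open>tr (n * m) = tr (k * m) = -1\<close>
  (lemma \<open>proportional_iff\<close>). Hence \<open>\<nu>\<close> preserves lines and orthogonality.

  As \<open>(1 + n) * (1 + m) = 1 + (n + m + n * m)\<close> is unipotent for orthogonal \<open>n\<close> and \<open>m\<close>, the map \<open>\<nu>\<close> also
  preserves the relation \<open>tr ((n * m) * k) = -1\<close> between mutually orthogonal \<open>n, m, k\<close>. So it sends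
  \<open>e\<^sub>1, e\<^sub>2, e\<^sub>3\<close> to a frame: a mutually orthogonal triple of square zero with triple product of trace 1.
  Linear automorphisms of \<open>O\<close> are transitive on frames (\<open>frame_moved_to_standard\<close>), so \<open>\<nu>\<close> may
  be assumed to fix each \<open>e\<^sub>i\<close>. The triple relation applied to multiples of the \<open>e\<^sub>i\<close> then says that
  the three scalings are one field automorphism. When this is divided out, \<open>g\<close> fixes all
  \<open>1 + t e\<^sub>i\<close>; the trace form forces it to fix all \<open>1 + t f\<^sub>i\<close>, and these elements generate \<open>M\<close>. So \<open>g\<close> is
  induced by a linear automorphism composed with a field automorphism acting on coordinates.

  The group. Frames are moved to the standard one by explicit root automorphisms, and an
  automorphism fixing \<open>e\<^sub>1, e\<^sub>2, e\<^sub>3\<close> is the identity, so root automorphisms generate the linear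
  automorphism group. The Lie algebra in the definition of \<open>G\<^sub>2\<close> acts on \<open>O\<close> by derivations, and
  conjugation by a root automorphism acts on it through the matrix \<open>x\<^sub>r(t)\<close>
  (lemma \<open>root_aut_g2_der\<close>). This representation is faithful, so its image \<open>G\<^sub>2(F)\<close> is
  isomorphic to the linear automorphism group, compatibly with field automorphisms; the
  semidirect product formula is the composition law of the maps \<open>h \<circ> \<sigma>\<close>.
\<close>

section \<open>Arithmetic of the split octonions\<close>

text \<open>
  Zorn matrices in eight scalar coordinates: identities between them become polynomial identities
  that the simplifier can normalise, without sums over an index type.
\<close>

definition oct :: "'a \<Rightarrow> 'a \<Rightarrow> 'a \<Rightarrow> 'a \<Rightarrow> 'a \<Rightarrow> 'a \<Rightarrow> 'a \<Rightarrow> 'a \<Rightarrow> 'a::zero zorn" where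
  "oct a x1 x2 x3 y1 y2 y3 b = Zorn a (vector [x1, x2, x3]) (vector [y1, y2, y3]) b"

lemma vector_3_eta: "vector [x $ 1, x $ 2, x $ 3] = (x :: 'a::zero ^ 3)"
  by (simp add: vec_eq_iff forall_3)

lemma Zorn_eq_oct: "Zorn a x y b = oct a (x $ 1) (x $ 2) (x $ 3) (y $ 1) (y $ 2) (y $ 3) b"
  by (simp add: oct_def vector_3_eta)

lemma oct_cases [cases type: zorn]:
  obtains a x1 x2 x3 y1 y2 y3 b where "u = oct a x1 x2 x3 y1 y2 y3 b"
  by (cases u) (auto simp: Zorn_eq_oct)

instantiation zorn :: (comm_ring_1) "{zero, minus}"
begin

definition zero_zorn :: "'a zorn" where
  "0 = Zorn 0 0 0 0"

definition minus_zorn :: "'a zorn \<Rightarrow> 'a zorn \<Rightarrow> 'a zorn" where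
  "u - v = u + - v" for u v :: "'a zorn"

instance ..

end

fun zorn_trace :: "'a::comm_ring_1 zorn \<Rightarrow> 'a" where
  "zorn_trace (Zorn a \<alpha> \<beta> b) = a + b"

fun zorn_conj :: "'a::comm_ring_1 zorn \<Rightarrow> 'a zorn" where
  "zorn_conj (Zorn a \<alpha> \<beta> b) = Zorn b (- \<alpha>) (- \<beta>) a"

lemma oct_inject [simp]:
  "oct a x1 x2 x3 y1 y2 y3 b = oct a' x1' x2' x3' y1' y2' y3' b' \<longleftrightarrow>
    a = a' \<and> x1 = x1' \<and> x2 = x2' \<and> x3 = x3' \<and> y1 = y1' \<and> y2 = y2' \<and> y3 = y3' \<and> b = b'"
  by (auto simp: oct_def vec_eq_iff forall_3)

lemma oct_simps [simp]:
  "0 = oct 0 0 0 0 0 0 0 (0 :: 'a::comm_ring_1)"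
  "1 = oct 1 0 0 0 0 0 0 (1 :: 'a)"
  "oct a x1 x2 x3 y1 y2 y3 b + oct a' x1' x2' x3' y1' y2' y3' b' =
    oct (a + a') (x1 + x1') (x2 + x2') (x3 + x3') (y1 + y1') (y2 + y2') (y3 + y3') (b + b' :: 'a)"
  "- oct a x1 x2 x3 y1 y2 y3 b = oct (- a) (- x1) (- x2) (- x3) (- y1) (- y2) (- y3) (- b :: 'a)"
  "oct a x1 x2 x3 y1 y2 y3 b * oct a' x1' x2' x3' y1' y2' y3' b' =
    oct (a * a' + (x1 * y1' + x2 * y2' + x3 * y3'))
      (a * x1' + b' * x1 - (y2 * y3' - y3 * y2'))
      (a * x2' + b' * x2 - (y3 * y1' - y1 * y3'))
      (a * x3' + b' * x3 - (y1 * y2' - y2 * y1'))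
      (a' * y1 + b * y1' + (x2 * x3' - x3 * x2'))
      (a' * y2 + b * y2' + (x3 * x1' - x1 * x3'))
      (a' * y3 + b * y3' + (x1 * x2' - x2 * x1'))
      (y1 * x1' + y2 * x2' + y3 * x3' + b * b' :: 'a)"
  "zorn_scale c (oct a x1 x2 x3 y1 y2 y3 b) =
    oct (c * a) (c * x1) (c * x2) (c * x3) (c * y1) (c * y2) (c * y3) (c * b :: 'a)"
  "zorn_norm (oct a x1 x2 x3 y1 y2 y3 b) = a * b - (x1 * y1 + x2 * y2 + x3 * y3 :: 'a)"
  "zorn_trace (oct a x1 x2 x3 y1 y2 y3 b) = (a + b :: 'a)"
  "zorn_conj (oct a x1 x2 x3 y1 y2 y3 b) = oct b (- x1) (- x2) (- x3) (- y1) (- y2) (- y3) (a :: 'a)"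
  by (simp_all add: oct_def zero_zorn_def one_zorn_def vec_eq_iff forall_3 dot_def cross_def sum_3
      add.assoc)

lemma zorn_minus_oct [simp]:
  "oct a x1 x2 x3 y1 y2 y3 b - oct a' x1' x2' x3' y1' y2' y3' b' =
    oct (a - a') (x1 - x1') (x2 - x2') (x3 - x3') (y1 - y1') (y2 - y2') (y3 - y3') (b - b' :: 'a::comm_ring_1)"
  by (simp add: minus_zorn_def)

lemmas zero_one_oct = oct_simps(1,2)
declare oct_simps(1,2) [simp del]

instance zorn :: (comm_ring_1) ab_group_add
proof
  fix u v w :: "'a zorn"
  show "u + v + w = u + (v + w)"
    by (cases u; cases v; cases w) (simp add: add.assoc)
  show "u + v = v + u"
    by (cases u; cases v) (simp add: add.commute)
  show "0 + u = u" "- u + u = 0"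
    by (cases u; simp add: zero_one_oct)+
  show "u - v = u + - v"
    by (simp add: minus_zorn_def)
qed

lemma zorn_distrib:
  fixes u v w :: "'a::comm_ring_1 zorn"
  shows "u * (v + w) = u * v + u * w" "(u + v) * w = u * w + v * w"
  by (cases u; cases v; cases w; simp add: algebra_simps)+

lemma zorn_mult_minus [simp]:
  fixes u v :: "'a::comm_ring_1 zorn"
  shows "(- u) * v = - (u * v)" "u * (- v) = - (u * v)"
  by (cases u; cases v; simp)+

lemma zorn_mult_one_zero [simp]:
  fixes u :: "'a::comm_ring_1 zorn"
  shows "1 * u = u" "u * 1 = u" "0 * u = 0" "u * 0 = 0"
  by (cases u; simp add: zero_one_oct)+

lemma zorn_scale_simps [simp]:
  fixes u v :: "'a::comm_ring_1 zorn"
  shows "zorn_scale c u * v = zorn_scale c (u * v)" "u * zorn_scale c v = zorn_scale c (u * v)"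
    "zorn_scale c (zorn_scale d u) = zorn_scale (c * d) u" "zorn_scale 1 u = u" "zorn_scale 0 u = 0"
    "zorn_scale c 0 = 0" "zorn_scale (- c) u = - zorn_scale c u" "zorn_scale c (- u) = - zorn_scale c u"
  by (cases u; cases v; simp add: zero_one_oct algebra_simps)+

lemma zorn_scale_distrib:
  fixes u v :: "'a::comm_ring_1 zorn"
  shows "zorn_scale c (u + v) = zorn_scale c u + zorn_scale c v"
    "zorn_scale (c + d) u = zorn_scale c u + zorn_scale d u"
  by (cases u; cases v; simp add: algebra_simps)+

lemma zorn_trace_simps [simp]:
  fixes u v :: "'a::comm_ring_1 zorn"
  shows "zorn_trace (u + v) = zorn_trace u + zorn_trace v" "zorn_trace (- u) = - zorn_trace u"
    "zorn_trace (zorn_scale c u) = c * zorn_trace u" "zorn_trace (1 :: 'a zorn) = 2"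
    "zorn_trace (0 :: 'a zorn) = 0"
  by (cases u; cases v; simp add: zero_one_oct algebra_simps)+

lemma zorn_trace_diff [simp]: "zorn_trace (u - v) = zorn_trace u - zorn_trace (v :: 'a::comm_ring_1 zorn)"
  by (cases u; cases v) simp

lemma zorn_norm_simps [simp]:
  fixes u :: "'a::comm_ring_1 zorn"
  shows "zorn_norm (1 :: 'a zorn) = 1" "zorn_norm (- u) = zorn_norm u"
    "zorn_norm (zorn_scale c u) = c\<^sup>2 * zorn_norm u"
  by (cases u; simp add: zero_one_oct algebra_simps power2_eq_square)+

lemma zorn_norm_mult: "zorn_norm (u * v) = zorn_norm u * zorn_norm (v :: 'a::comm_ring_1 zorn)"
  by (cases u; cases v) (simp add: algebra_simps)

lemma zorn_square: "u * u = zorn_scale (zorn_trace u) u - zorn_scale (zorn_norm u) (1 :: 'a::comm_ring_1 zorn)"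
  by (cases u) (simp add: zero_one_oct algebra_simps)

text \<open>
  The linearisation of \<open>zorn_square\<close>. For elements of trace zero, it shows that the trace form is
  visible in the anticommutator.
\<close>

lemma zorn_anticommutator:
  "u * v + v * u = zorn_scale (zorn_trace u) v + zorn_scale (zorn_trace v) u
    + zorn_scale (zorn_trace (u * v) - zorn_trace u * zorn_trace v) (1 :: 'a::comm_ring_1 zorn)"
  by (cases u; cases v) (simp add: zero_one_oct algebra_simps)

text \<open>
  One of the quadratic identities of an alternative algebra with norm: \<open>u v u\<close> is a combination of
  \<open>u\<close> and the conjugate of \<open>v\<close>.
\<close>

lemma zorn_sandwich:
  "(u * v) * u = zorn_scale (zorn_trace (u * v)) u - zorn_scale (zorn_norm u) (zorn_conj (v :: 'a::comm_ring_1 zorn))"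
  by (cases u; cases v) (simp add: algebra_simps)

text \<open>
  Nonassociative substitute for inverses: the conjugate of an element of norm 1 undoes
  multiplication by it, on either side.
\<close>

lemma zorn_conj_cancel:
  fixes u v :: "'a::comm_ring_1 zorn"
  shows "zorn_conj u * (u * v) = zorn_scale (zorn_norm u) v"
    "(v * u) * zorn_conj u = zorn_scale (zorn_norm u) v"
  by (cases u; cases v; simp add: algebra_simps)+

lemma zorn_trace_conj_mult:
  "zorn_trace (zorn_conj u * (v * u)) = zorn_norm u * zorn_trace (v :: 'a::comm_ring_1 zorn)"
  by (cases u; cases v) (simp add: algebra_simps)

lemma zorn_trace_commute: "zorn_trace (u * v) = zorn_trace (v * u :: 'a::comm_ring_1 zorn)"
  by (cases u; cases v) (simp add: algebra_simps)

lemma zorn_norm_add: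
  "zorn_norm (u + v) = zorn_norm u + zorn_norm v + zorn_trace u * zorn_trace v
    - zorn_trace (u * v :: 'a::comm_ring_1 zorn)"
  by (cases u; cases v) (simp add: algebra_simps)

lemma zorn_norm_one_add: "zorn_norm (1 + u) = 1 + zorn_trace u + zorn_norm (u :: 'a::comm_ring_1 zorn)"
  by (simp add: zorn_norm_add)

lemma zorn_scale_eq_0_iff: "zorn_scale c u = 0 \<longleftrightarrow> c = 0 \<or> u = (0 :: 'a::field zorn)"
  by (cases u) (auto simp: zero_one_oct)

lemma zorn_scale_inject: "zorn_scale c u = zorn_scale d u \<longleftrightarrow> c = d \<or> u = (0 :: 'a::field zorn)"
  by (cases u) (auto simp: zero_one_oct)

section \<open>Root automorphisms\<close>

text \<open>
  The root automorphism of \<open>r\<close> is \<open>exp (t D)\<close> for the derivation \<open>D\<close> of the octonions that the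
  root vector of \<open>r\<close> defines. Long roots act as elementary matrices on the upper vectors and contragrediently on
  the lower ones. For short roots \<open>D\<^sup>3 = 0\<close> and \<open>D\<^sup>2\<close> is divisible by 2, so that the formulas below make
  sense in every characteristic.
\<close>

fun root_aut :: "g2_root \<Rightarrow> 'a::field \<Rightarrow> 'a zorn \<Rightarrow> 'a zorn" where
  "root_aut (Up i) t (Zorn a \<alpha> \<beta> b) =
     Zorn a (\<alpha> + axis i (t * \<alpha> $ (i + 1))) (\<beta> - axis (i + 1) (t * \<beta> $ i)) b"
| "root_aut (Down i) t (Zorn a \<alpha> \<beta> b) =
     Zorn a (\<alpha> + axis (i + 1) (t * \<alpha> $ i)) (\<beta> - axis i (t * \<beta> $ (i + 1))) b"
| "root_aut (Vec i) t (Zorn a \<alpha> \<beta> b) =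
     Zorn (a + t * \<beta> $ i) (\<alpha> - axis i (t * (a - b) + t\<^sup>2 * \<beta> $ i))
       (\<beta> - cross (axis i t) \<alpha>) (b - t * \<beta> $ i)"
| "root_aut (Cov i) t (Zorn a \<alpha> \<beta> b) =
     Zorn (a - t * \<alpha> $ i) (\<alpha> + cross (axis i t) \<beta>)
       (\<beta> + axis i (t * (a - b) - t\<^sup>2 * \<alpha> $ i)) (b + t * \<alpha> $ i)"

text \<open>
  Addition of numerals at type \<open>3\<close> is done on the numerals, which leaves \<open>3 + 1 = 4\<close> unreduced.
\<close>

lemma four_eq_one_3 [simp]: "(4::3) = 1"
  by simp

lemma g2_root_cases [cases type: g2_root]:
  obtains "r = Up 1" | "r = Up 2" | "r = Up 3" | "r = Down 1" | "r = Down 2" | "r = Down 3"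
    | "r = Vec 1" | "r = Vec 2" | "r = Vec 3" | "r = Cov 1" | "r = Cov 2" | "r = Cov 3"
  by (cases r) (metis exhaust_3)+

lemma root_aut_oct [simp]:
  fixes t :: "'a::field"
  shows
  "root_aut (Up 1) t (oct a x1 x2 x3 y1 y2 y3 b) = oct a (x1 + t * x2) x2 x3 y1 (y2 - t * y1) y3 b"
  "root_aut (Up 2) t (oct a x1 x2 x3 y1 y2 y3 b) = oct a x1 (x2 + t * x3) x3 y1 y2 (y3 - t * y2) b"
  "root_aut (Up 3) t (oct a x1 x2 x3 y1 y2 y3 b) = oct a x1 x2 (x3 + t * x1) (y1 - t * y3) y2 y3 b"
  "root_aut (Down 1) t (oct a x1 x2 x3 y1 y2 y3 b) = oct a x1 (x2 + t * x1) x3 (y1 - t * y2) y2 y3 b"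
  "root_aut (Down 2) t (oct a x1 x2 x3 y1 y2 y3 b) = oct a x1 x2 (x3 + t * x2) y1 (y2 - t * y3) y3 b"
  "root_aut (Down 3) t (oct a x1 x2 x3 y1 y2 y3 b) = oct a (x1 + t * x3) x2 x3 y1 y2 (y3 - t * y1) b"
  "root_aut (Vec 1) t (oct a x1 x2 x3 y1 y2 y3 b) =
     oct (a + t * y1) (x1 - (t * (a - b) + t\<^sup>2 * y1)) x2 x3 y1 (y2 + t * x3) (y3 - t * x2) (b - t * y1)"
  "root_aut (Vec 2) t (oct a x1 x2 x3 y1 y2 y3 b) =
     oct (a + t * y2) x1 (x2 - (t * (a - b) + t\<^sup>2 * y2)) x3 (y1 - t * x3) y2 (y3 + t * x1) (b - t * y2)"
  "root_aut (Vec 3) t (oct a x1 x2 x3 y1 y2 y3 b) =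
     oct (a + t * y3) x1 x2 (x3 - (t * (a - b) + t\<^sup>2 * y3)) (y1 + t * x2) (y2 - t * x1) y3 (b - t * y3)"
  "root_aut (Cov 1) t (oct a x1 x2 x3 y1 y2 y3 b) =
     oct (a - t * x1) x1 (x2 - t * y3) (x3 + t * y2) (y1 + (t * (a - b) - t\<^sup>2 * x1)) y2 y3 (b + t * x1)"
  "root_aut (Cov 2) t (oct a x1 x2 x3 y1 y2 y3 b) =
     oct (a - t * x2) (x1 + t * y3) x2 (x3 - t * y1) y1 (y2 + (t * (a - b) - t\<^sup>2 * x2)) y3 (b + t * x2)"
  "root_aut (Cov 3) t (oct a x1 x2 x3 y1 y2 y3 b) =
     oct (a - t * x3) (x1 - t * y2) (x2 + t * y1) x3 y1 y2 (y3 + (t * (a - b) - t\<^sup>2 * x3)) (b + t * x3)"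
  by (simp_all add: oct_def vec_eq_iff forall_3 axis_def cross_def)

lemma root_aut_add: "root_aut r t (u + v) = root_aut r t u + root_aut r t v"
  by (cases u; cases v; cases r) (simp_all add: algebra_simps)

lemma root_aut_mult: "root_aut r t (u * v) = root_aut r t u * root_aut r t v"
  by (cases u; cases v; cases r) (simp_all add: algebra_simps power2_eq_square)

lemma root_aut_scale: "root_aut r t (zorn_scale c u) = zorn_scale c (root_aut r t u)"
  by (cases u; cases r) (simp_all add: algebra_simps)

lemma root_aut_minus_cancel: "root_aut r (- t) (root_aut r t u) = u"
  by (cases u; cases r) (simp_all add: algebra_simps power2_eq_square)

definition linear_automorphism :: "('a::field zorn \<Rightarrow> 'a zorn) \<Rightarrow> bool" where
  "linear_automorphism f \<longleftrightarrow> bij f \<and> (\<forall>u v. f (u + v) = f u + f v) \<and> (\<forall>u v. f (u * v) = f u * f v) \<and>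
     (\<forall>c u. f (zorn_scale c u) = zorn_scale c (f u))"

lemma linear_automorphism_root_aut: "linear_automorphism (root_aut r t)"
proof -
  have "bij (root_aut r t)"
    using root_aut_minus_cancel[of r t] root_aut_minus_cancel[of r "- t"]
    by (intro o_bij[of "root_aut r (- t)"]) (simp_all add: fun_eq_iff)
  then show ?thesis
    by (simp add: linear_automorphism_def root_aut_add root_aut_mult root_aut_scale)
qed

lemma linear_automorphism_id: "linear_automorphism id"
  by (simp add: linear_automorphism_def)

lemma linear_automorphism_comp:
  "linear_automorphism f \<Longrightarrow> linear_automorphism g \<Longrightarrow> linear_automorphism (f \<circ> g)"
  by (auto simp: linear_automorphism_def intro: bij_comp)

lemma linear_automorphism_inv:
  assumes "linear_automorphism f"
  shows "linear_automorphism (inv_into UNIV f)"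
proof -
  have f: "f (u + v) = f u + f v" "f (u * v) = f u * f v" "f (zorn_scale c u) = zorn_scale c (f u)" and b: "bij f"
    for u v c using assms by (auto simp: linear_automorphism_def)
  have eq: "inv_into UNIV f x = y" if "x = f y" for x y
    using that b by (simp add: bij_is_inj inv_f_f)
  have f_inv: "f (inv_into UNIV f x) = x" for x
    using b by (simp add: bij_is_surj surj_f_inv_f)
  show ?thesis
    unfolding linear_automorphism_def using b
    by (intro conjI allI bij_imp_bij_inv eq) (simp_all add: f f_inv)
qed

inductive_set root_group :: "('a::field zorn \<Rightarrow> 'a zorn) set" where
  id: "id \<in> root_group"
| root: "h \<in> root_group \<Longrightarrow> h \<circ> root_aut r t \<in> root_group"

lemma root_group_comp: "h \<in> root_group \<Longrightarrow> k \<in> root_group \<Longrightarrow> k \<circ> h \<in> root_group"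
  by (induction rule: root_group.induct) (auto simp flip: comp_assoc intro: root_group.root)

lemma linear_automorphism_root_group: "h \<in> root_group \<Longrightarrow> linear_automorphism h"
  by (induction rule: root_group.induct)
    (intro linear_automorphism_id linear_automorphism_comp linear_automorphism_root_aut; assumption)+

section \<open>Transitivity on frames\<close>

text \<open>
  Orbits under the stabiliser of \<open>S\<close> pointwise in the group generated by root automorphisms. The three
  vectors of a frame are moved to standard position one after the other, with \<open>S\<close> collecting those that
  are done.
\<close>

definition moved :: "'a::field zorn set \<Rightarrow> 'a zorn \<Rightarrow> 'a zorn \<Rightarrow> bool" where
  "moved S x y \<longleftrightarrow> (\<exists>h\<in>root_group. (\<forall>s\<in>S. h s = s) \<and> h x = y)"

lemma moved_refl: "moved S x x"
  unfolding moved_def by (intro bexI[of _ id]) (auto intro: root_group.id)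

lemma moved_root:
  assumes "moved S (root_aut r t x) y" "\<And>s. s \<in> S \<Longrightarrow> root_aut r t s = s"
  shows "moved S x y"
proof -
  from assms(1) obtain h where "h \<in> root_group" "\<forall>s\<in>S. h s = s" "h (root_aut r t x) = y"
    by (auto simp: moved_def)
  with assms(2) show ?thesis
    unfolding moved_def by (intro bexI[of _ "h \<circ> root_aut r t"]) (auto intro: root_group.root)
qed

text \<open>
  Zero is excluded, so these are exactly the elements in the orbit of \<open>e\<^sub>1\<close> (lemma \<open>moved_e1\<close>).
\<close>

definition nilp :: "'a::field zorn \<Rightarrow> bool" where
  "nilp n \<longleftrightarrow> n \<noteq> 0 \<and> n * n = 0"

text \<open>
  If \<open>n * n = 0\<close> then the norm vanishes by multiplicativity, and then \<open>n * n = tr n * n\<close>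
  forces the trace to vanish.
\<close>

lemma nilp_iff: "nilp n \<longleftrightarrow> n \<noteq> 0 \<and> zorn_trace n = 0 \<and> zorn_norm n = 0"
proof
  assume n: "nilp n"
  have "zorn_norm n * zorn_norm n = zorn_norm (0 :: 'a zorn)"
    using n zorn_norm_mult[of n n] by (simp add: nilp_def)
  then have N: "zorn_norm n = 0" by (simp add: zero_one_oct)
  have "zorn_scale (zorn_trace n) n = 0"
    using n zorn_square[of n] N by (simp add: nilp_def)
  then have "zorn_trace n = 0"
    using n by (cases n) (auto simp: nilp_def zero_one_oct)
  with n N show "n \<noteq> 0 \<and> zorn_trace n = 0 \<and> zorn_norm n = 0" by (simp add: nilp_def)
next
  assume "n \<noteq> 0 \<and> zorn_trace n = 0 \<and> zorn_norm n = 0"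
  then show "nilp n" using zorn_square[of n] by (simp add: nilp_def)
qed

lemma nilp_oct:
  "nilp (oct a x1 x2 x3 y1 y2 y3 b) \<longleftrightarrow> b = - a \<and> a * a + x1 * y1 + x2 * y2 + x3 * y3 = 0 \<and>
     (x1 \<noteq> 0 \<or> x2 \<noteq> 0 \<or> x3 \<noteq> 0 \<or> y1 \<noteq> 0 \<or> y2 \<noteq> 0 \<or> y3 \<noteq> 0)"
proof -
  have "a + b = 0 \<longleftrightarrow> b = - a" by (metis add_eq_0_iff)
  moreover have "a * - a - (x1 * y1 + x2 * y2 + x3 * y3) = 0 \<longleftrightarrow> a * a + x1 * y1 + x2 * y2 + x3 * y3 = 0"
  proof -
    have "a * - a - (x1 * y1 + x2 * y2 + x3 * y3) = - (a * a + x1 * y1 + x2 * y2 + x3 * y3)"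
      by (simp add: algebra_simps)
    then show ?thesis by (metis neg_equal_0_iff_equal)
  qed
  ultimately show ?thesis
    by (auto simp: nilp_iff zero_one_oct)
qed

lemma linear_automorphism_zero: "linear_automorphism h \<Longrightarrow> h 0 = 0"
  by (metis linear_automorphism_def zorn_scale_simps(5))

lemma linear_automorphism_eq_zero_iff: "linear_automorphism h \<Longrightarrow> h n = 0 \<longleftrightarrow> n = 0"
  by (metis linear_automorphism_zero linear_automorphism_def bij_is_inj injD)

lemma nilp_image: "linear_automorphism h \<Longrightarrow> nilp (h n) \<longleftrightarrow> nilp n"
  by (metis nilp_def linear_automorphism_eq_zero_iff linear_automorphism_def)

abbreviation "e1 \<equiv> oct 0 1 0 0 0 0 0 0"
abbreviation "e2 \<equiv> oct 0 0 1 0 0 0 0 0"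
abbreviation "e3 \<equiv> oct 0 0 0 1 0 0 0 0"

text \<open>
  Elementary operations from the first upper coordinate clear the other two. The first lower
  coordinate absorbs the change of basis because the dot product of both vectors is invariant.
\<close>

lemma clear_upper_after_e1:
  assumes "moved {} (oct c 1 0 0 (y1 + x2 * y2 + x3 * y3) y2 y3 b) e1"
  shows "moved {} (oct c 1 x2 x3 y1 y2 y3 b) e1"
  using assms
  by - (rule moved_root[where r = "Down 1" and t = "- x2"], simp,
      rule moved_root[where r = "Up 3" and t = "- x3"], simp_all)

lemma moved_e1_one_lower: "moved {} (oct 0 1 0 0 0 y2 0 0) e1"
  by - (rule moved_root[where r = "Vec 3" and t = y2], simp_all add: moved_refl)

lemma moved_e1_zero_diagonal: "moved {} (oct 0 1 0 0 0 y2 y3 0) e1"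
proof (cases "y2 = 0")
  case True
  show ?thesis
    by - (rule moved_root[where r = "Vec 2" and t = "- y3"], simp_all add: True moved_refl)
next
  case False
  then show ?thesis
    by - (rule moved_root[where r = "Up 2" and t = "y3 / y2"], simp_all add: moved_e1_one_lower)
qed

text \<open>
  The short root \<open>- \<epsilon>\<^sub>1\<close> makes the diagonal zero; the upper coordinates it disturbs are cleared again.
\<close>

lemma moved_e1_if_coord_1:
  assumes "nilp (oct c 1 x2 x3 y1 y2 y3 b)"
  shows "moved {} (oct c 1 x2 x3 y1 y2 y3 b) e1"
proof -
  have b: "b = - c" and y1: "y1 + x2 * y2 + x3 * y3 = - c * c"
    using assms by (simp_all add: nilp_oct eq_neg_iff_add_eq_0 algebra_simps)
  have eq: "root_aut (Cov 1) c (oct c 1 0 0 (- c * c) y2 y3 (- c)) = oct 0 1 (- (c * y3)) (c * y2) 0 y2 y3 0"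
    by (simp add: algebra_simps power2_eq_square)
  have mv: "moved {} (oct 0 1 (- (c * y3)) (c * y2) 0 y2 y3 0) e1"
    by (rule clear_upper_after_e1) (simp add: moved_e1_zero_diagonal)
  have "moved {} (oct c 1 0 0 (- c * c) y2 y3 (- c)) e1"
    by (rule moved_root[where r = "Cov 1" and t = c], simp only: eq mv) auto
  then show ?thesis
    unfolding b by - (rule clear_upper_after_e1, simp add: y1)
qed

lemma moved_e1_if_coord_2:
  assumes "nilp (oct c x1 x2 x3 y1 y2 y3 b)" "x2 \<noteq> 0"
  shows "moved {} (oct c x1 x2 x3 y1 y2 y3 b) e1"
proof -
  let ?r = "root_aut (Up 1) ((1 - x1) / x2)"
  from assms have "nilp (?r (oct c x1 x2 x3 y1 y2 y3 b))"
    by (subst nilp_image) (rule linear_automorphism_root_aut)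
  with assms(2) show ?thesis
    by - (rule moved_root[where r = "Up 1" and t = "(1 - x1) / x2"], auto intro: moved_e1_if_coord_1)
qed

lemma nilp_root_aut: "nilp (root_aut r t n) \<longleftrightarrow> nilp n"
  by (intro nilp_image linear_automorphism_root_aut)

lemma moved_e1_if_upper:
  assumes "nilp (oct c x1 x2 x3 y1 y2 y3 b)" "x1 \<noteq> 0 \<or> x2 \<noteq> 0 \<or> x3 \<noteq> 0"
  shows "moved {} (oct c x1 x2 x3 y1 y2 y3 b) e1"
proof -
  let ?x = "oct c x1 x2 x3 y1 y2 y3 b"
  consider "x2 \<noteq> 0" | "x2 = 0" "x1 \<noteq> 0" | "x2 = 0" "x3 \<noteq> 0" using assms(2) by blast
  then show ?thesis
  proof cases
    case 1
    then show ?thesis using assms moved_e1_if_coord_2 by blast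
  next
    case 2
    show ?thesis
      using 2 assms nilp_root_aut[of "Down 1" 1 ?x]
      by - (rule moved_root[where r = "Down 1" and t = 1], auto intro: moved_e1_if_coord_2)
  next
    case 3
    show ?thesis
      using 3 assms nilp_root_aut[of "Up 2" 1 ?x]
      by - (rule moved_root[where r = "Up 2" and t = 1], auto intro: moved_e1_if_coord_2)
  qed
qed

text \<open>
  If the upper vector is zero, a short root automorphism makes it nonzero; otherwise elementary
  operations turn its first coordinate into 1.
\<close>

lemma moved_e1:
  assumes "nilp n"
  shows "moved {} n e1"
proof -
  obtain c x1 x2 x3 y1 y2 y3 b where n: "n = oct c x1 x2 x3 y1 y2 y3 b" by (cases n)
  show ?thesis
  proof (cases "x1 \<noteq> 0 \<or> x2 \<noteq> 0 \<or> x3 \<noteq> 0")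
    case True
    then show ?thesis using assms n moved_e1_if_upper by blast
  next
    case False
    with assms n have "c = 0" "b = 0" "y1 \<noteq> 0 \<or> y2 \<noteq> 0 \<or> y3 \<noteq> 0" by (auto simp: nilp_oct)
    then consider "y1 \<noteq> 0" | "y2 \<noteq> 0" | "y3 \<noteq> 0" by blast
    then show ?thesis
    proof cases
      case 1
      show ?thesis
        unfolding n using 1 assms False nilp_root_aut[of "Vec 1" 1 n]
        by - (rule moved_root[where r = "Vec 1" and t = 1], auto intro!: moved_e1_if_upper simp: n \<open>c = 0\<close> \<open>b = 0\<close>)
    next
      case 2
      show ?thesis
        unfolding n using 2 assms False nilp_root_aut[of "Vec 2" 1 n]
        by - (rule moved_root[where r = "Vec 2" and t = 1], auto intro!: moved_e1_if_upper simp: n \<open>c = 0\<close> \<open>b = 0\<close>)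
    next
      case 3
      show ?thesis
        unfolding n using 3 assms False nilp_root_aut[of "Vec 3" 1 n]
        by - (rule moved_root[where r = "Vec 3" and t = 1], auto intro!: moved_e1_if_upper simp: n \<open>c = 0\<close> \<open>b = 0\<close>)
    qed
  qed
qed

text \<open>
  From here on every operation fixes \<open>e\<^sub>1\<close>. The steps repeat those for \<open>e\<^sub>1\<close> with indices shifted.
\<close>

lemma clear_upper_after_e2:
  assumes "moved {e1} (oct c 0 1 0 y1 (y2 + x1 * y1 + x3 * y3) y3 b) e2"
  shows "moved {e1} (oct c x1 1 x3 y1 y2 y3 b) e2"
  using assms
  by - (rule moved_root[where r = "Up 1" and t = "- x1"], simp,
      rule moved_root[where r = "Down 2" and t = "- x3"], simp_all add: algebra_simps)

lemma moved_e2_one_lower: "moved {e1} (oct 0 0 1 0 0 0 y3 0) e2"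
  by (rule moved_root[where r = "Vec 1" and t = y3]) (simp_all add: moved_refl)

lemma moved_e2_if_coord_2:
  assumes "nilp (oct c x1 1 x3 0 y2 y3 b)"
  shows "moved {e1} (oct c x1 1 x3 0 y2 y3 b) e2"
proof -
  have b: "b = - c" and y2: "y2 + x3 * y3 = - c * c"
    using assms by (simp_all add: nilp_oct eq_neg_iff_add_eq_0 algebra_simps)
  have eq: "root_aut (Cov 2) c (oct c 0 1 0 0 (- c * c) y3 (- c)) = oct 0 (c * y3) 1 0 0 0 y3 0"
    by (simp add: algebra_simps power2_eq_square)
  have mv: "moved {e1} (oct 0 (c * y3) 1 0 0 0 y3 0) e2"
    by (rule clear_upper_after_e2) (simp add: moved_e2_one_lower)
  have "moved {e1} (oct c 0 1 0 0 (- c * c) y3 (- c)) e2"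
    by (rule moved_root[where r = "Cov 2" and t = c], simp only: eq mv) auto
  then show ?thesis
    unfolding b by - (rule clear_upper_after_e2, simp add: y2)
qed

lemma moved_e2_if_coord_3:
  assumes "nilp (oct c x1 x2 x3 0 y2 y3 b)" "x3 \<noteq> 0"
  shows "moved {e1} (oct c x1 x2 x3 0 y2 y3 b) e2"
  using assms nilp_root_aut[of "Up 2" "(1 - x2) / x3" "oct c x1 x2 x3 0 y2 y3 b"]
  by - (rule moved_root[where r = "Up 2" and t = "(1 - x2) / x3"], auto intro: moved_e2_if_coord_2)

text \<open>
  The first lower coordinate is the trace form with \<open>e\<^sub>1\<close>, so it vanishes for the second vector of a
  frame that starts with \<open>e\<^sub>1\<close>; and \<open>x2 = x3 = 0\<close> would make the trace of the triple product of that frame vanish.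
\<close>

lemma moved_e2:
  assumes "nilp (oct c x1 x2 x3 0 y2 y3 b)" "x2 \<noteq> 0 \<or> x3 \<noteq> 0"
  shows "moved {e1} (oct c x1 x2 x3 0 y2 y3 b) e2"
proof (cases "x3 = 0")
  case True
  then show ?thesis
    using assms nilp_root_aut[of "Down 2" 1 "oct c x1 x2 x3 0 y2 y3 b"]
    by - (rule moved_root[where r = "Down 2" and t = 1], auto intro: moved_e2_if_coord_3)
qed (use assms moved_e2_if_coord_3 in blast)

text \<open>
  Zero lower coordinates express orthogonality to \<open>e\<^sub>1\<close> and \<open>e\<^sub>2\<close>, and the third upper coordinate is
  the trace of the triple product with them.
\<close>

lemma moved_e3:
  assumes "nilp (oct c x1 x2 1 0 0 y3 b)"
  shows "moved {e1, e2} (oct c x1 x2 1 0 0 y3 b) e3"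
proof -
  have clean: "moved {e1, e2} (oct 0 x1 x2 1 0 0 0 0) e3"
    by (rule moved_root[where r = "Down 3" and t = "- x1"], simp,
        rule moved_root[where r = "Up 2" and t = "- x2"]) (auto simp: moved_refl)
  have b: "b = - c" and y3: "y3 = - c * c"
    using assms by (simp_all add: nilp_oct eq_neg_iff_add_eq_0 algebra_simps)
  show ?thesis
    unfolding b y3
    by (rule moved_root[where r = "Cov 3" and t = c]) (auto simp: algebra_simps power2_eq_square clean)
qed

lemma linear_automorphism_one:
  assumes "linear_automorphism h"
  shows "h 1 = 1"
proof -
  obtain u where u: "h u = 1" using assms by (metis linear_automorphism_def bij_pointE)
  have "h (1 * u) = h 1 * h u" using assms unfolding linear_automorphism_def by blast
  then show ?thesis by (simp add: u)
qed

text \<open>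
  The anticommutator of two nilpotents is the trace of their product times 1, so any linear
  automorphism preserves that trace.
\<close>

lemma trace_mult_image:
  assumes h: "linear_automorphism h" and "nilp x" "nilp y"
  shows "zorn_trace (h x * h y) = zorn_trace (x * y)"
proof -
  have *: "u * v + v * u = zorn_scale (zorn_trace (u * v)) 1" if "nilp u" "nilp v" for u v :: "'a zorn"
    using that zorn_anticommutator[of u v] by (simp add: nilp_iff)
  have "zorn_scale (zorn_trace (h x * h y)) 1 = h (x * y + y * x)"
    using * [of "h x" "h y"] assms nilp_image[OF h] by (simp add: linear_automorphism_def)
  also have "\<dots> = zorn_scale (zorn_trace (x * y)) 1"
    using *[OF assms(2,3)] h linear_automorphism_one[OF h] by (simp add: linear_automorphism_def)
  finally show ?thesis
    by (simp add: zero_one_oct)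
qed

definition frame :: "'a::field zorn \<Rightarrow> 'a zorn \<Rightarrow> 'a zorn \<Rightarrow> bool" where
  "frame x y z \<longleftrightarrow> nilp x \<and> nilp y \<and> nilp z \<and> zorn_trace (x * y) = 0 \<and> zorn_trace (x * z) = 0 \<and>
     zorn_trace (y * z) = 0 \<and> zorn_trace ((x * y) * z) = 1"

lemma nilp_mult:
  assumes "nilp x" "nilp y" "zorn_trace (x * y) = 0" "x * y \<noteq> 0"
  shows "nilp (x * y)"
  using assms by (simp add: nilp_iff zorn_norm_mult)

lemma frame_image:
  assumes h: "linear_automorphism h"
  shows "frame (h x) (h y) (h z) \<longleftrightarrow> frame x y z"
proof (cases "nilp x \<and> nilp y \<and> nilp z \<and> zorn_trace (x * y) = 0")
  case True
  have m: "h x * h y = h (x * y)" using h by (simp add: linear_automorphism_def)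
  have "zorn_trace ((h x * h y) * h z) = 1 \<longleftrightarrow> zorn_trace ((x * y) * z) = 1"
  proof (cases "x * y = 0")
    case False
    then have "nilp (x * y)" using True nilp_mult by blast
    then show ?thesis unfolding m using True trace_mult_image[OF h] by metis
  qed (simp add: m linear_automorphism_zero[OF h])
  then show ?thesis
    using True trace_mult_image[OF h] nilp_image[OF h] by (auto simp: frame_def)
qed (use trace_mult_image[OF h] nilp_image[OF h] in \<open>auto simp: frame_def\<close>)

theorem frame_moved_to_standard:
  assumes "frame x y z"
  shows "\<exists>h\<in>root_group. h x = e1 \<and> h y = e2 \<and> h z = e3"
proof -
  note lin = linear_automorphism_root_group
  obtain h1 where h1: "h1 \<in> root_group" "h1 x = e1"
    using assms moved_e1[of x] by (auto simp: frame_def moved_def)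
  have f1: "frame e1 (h1 y) (h1 z)"
    using assms frame_image[OF lin[OF h1(1)], of x y z] h1(2) by simp
  obtain c x1 x2 x3 y1 y2 y3 b where y: "h1 y = oct c x1 x2 x3 y1 y2 y3 b" by (cases "h1 y")
  have "y1 = 0" using f1 y by (simp add: frame_def)
  moreover have "x2 \<noteq> 0 \<or> x3 \<noteq> 0"
  proof (rule ccontr)
    assume "\<not> (x2 \<noteq> 0 \<or> x3 \<noteq> 0)"
    then have "e1 * h1 y = zorn_scale b e1" using y \<open>y1 = 0\<close> by simp
    moreover obtain c' x1' x2' x3' y1' y2' y3' b' where "h1 z = oct c' x1' x2' x3' y1' y2' y3' b'" by (cases "h1 z")
    ultimately show False using f1 by (auto simp: frame_def)
  qed
  moreover have "nilp (h1 y)" using f1 by (simp add: frame_def)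
  ultimately obtain h2 where h2: "h2 \<in> root_group" "h2 e1 = e1" "h2 (h1 y) = e2"
    using moved_e2[of c x1 x2 x3 y2 y3 b] y by (auto simp: moved_def)
  have f2: "frame e1 e2 (h2 (h1 z))"
    using f1 frame_image[OF lin[OF h2(1)], of e1 "h1 y" "h1 z"] h2 by simp
  obtain c x1 x2 x3 y1 y2 y3 b where z: "h2 (h1 z) = oct c x1 x2 x3 y1 y2 y3 b" by (cases "h2 (h1 z)")
  have "y1 = 0" "y2 = 0" "x3 = 1" "nilp (h2 (h1 z))" using f2 z by (auto simp: frame_def)
  then obtain h3 where h3: "h3 \<in> root_group" "h3 e1 = e1" "h3 e2 = e2" "h3 (h2 (h1 z)) = e3"
    using moved_e3[of c x1 x2 y3 b] z by (auto simp: moved_def)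
  show ?thesis
    using h1 h2 h3 by (intro bexI[of _ "h3 \<circ> (h2 \<circ> h1)"]) (auto intro: root_group_comp)
qed

text \<open>
  The vectors \<open>e\<^sub>1, e\<^sub>2, e\<^sub>3\<close> generate the algebra: \<open>e\<^sub>1 * e\<^sub>2 = f\<^sub>3\<close> and its cyclic shifts give the lower
  vectors, and \<open>e\<^sub>1 * f\<^sub>1\<close> and \<open>f\<^sub>1 * e\<^sub>1\<close> are the diagonal idempotents.
\<close>

lemma linear_automorphism_eq_id:
  assumes h: "linear_automorphism h" and "h e1 = e1" "h e2 = e2" "h e3 = e3"
  shows "h = id"
proof
  fix u :: "'a zorn"
  have add: "h (u + v) = h u + h v" and mult: "h (u * v) = h u * h v"
    and scale: "h (zorn_scale c u) = zorn_scale c (h u)" for u v c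
    using h by (auto simp: linear_automorphism_def)
  have f: "oct 0 0 0 0 0 0 1 0 = e1 * (e2 :: 'a zorn)" "oct 0 0 0 0 1 0 0 0 = e2 * (e3 :: 'a zorn)"
    "oct 0 0 0 0 0 1 0 0 = e3 * (e1 :: 'a zorn)" "oct 1 0 0 0 0 0 0 0 = e1 * (e2 * (e3 :: 'a zorn))"
    "oct 0 0 0 0 0 0 0 1 = (e2 * e3) * (e1 :: 'a zorn)"
    by simp_all
  have basis: "h (oct 0 0 0 0 0 0 1 0) = oct 0 0 0 0 0 0 1 0" "h (oct 0 0 0 0 0 1 0 0) = oct 0 0 0 0 0 1 0 0"
    "h (oct 0 0 0 0 1 0 0 0) = oct 0 0 0 0 1 0 0 0" "h (oct 1 0 0 0 0 0 0 0) = oct 1 0 0 0 0 0 0 0"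
    "h (oct 0 0 0 0 0 0 0 1) = oct 0 0 0 0 0 0 0 1"
    unfolding f mult assms by (rule refl)+
  obtain a x1 x2 x3 y1 y2 y3 b where u: "u = oct a x1 x2 x3 y1 y2 y3 b" by (cases u)
  have "u = zorn_scale a (oct 1 0 0 0 0 0 0 0) + zorn_scale x1 e1 + zorn_scale x2 e2 + zorn_scale x3 e3
     + zorn_scale y1 (oct 0 0 0 0 1 0 0 0) + zorn_scale y2 (oct 0 0 0 0 0 1 0 0)
     + zorn_scale y3 (oct 0 0 0 0 0 0 1 0) + zorn_scale b (oct 0 0 0 0 0 0 0 1)"
    using u by simp
  then show "h u = id u"
    by (simp only: add scale basis assms) simp
qed

lemma frame_standard: "frame e1 e2 e3"
  by (simp add: frame_def nilp_oct)

text \<open>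
  A linear automorphism maps the standard frame to a frame; bringing that back with root
  automorphisms leaves an automorphism that fixes \<open>e\<^sub>1, e\<^sub>2, e\<^sub>3\<close>, which is the identity.
\<close>

theorem root_group_eq: "root_group = Collect linear_automorphism"
proof (intro equalityI subsetI)
  fix f :: "'a zorn \<Rightarrow> 'a zorn" assume f: "f \<in> Collect linear_automorphism"
  then have "frame (f e1) (f e2) (f e3)" by (simp add: frame_image frame_standard)
  then obtain h where h: "h \<in> root_group" "h (f e1) = e1" "h (f e2) = e2" "h (f e3) = e3"
    using frame_moved_to_standard by blast
  have inv_closed: "k \<in> root_group \<Longrightarrow> \<exists>k'\<in>root_group. k' \<circ> k = id" for k :: "'a zorn \<Rightarrow> 'a zorn"
  proof (induction rule: root_group.induct)
    case id
    show ?case by (intro bexI[of _ id] root_group.id) simp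
  next
    case (root k r t)
    then obtain k' where "k' \<in> root_group" "k' \<circ> k = id" by blast
    moreover have "root_aut r (- t) \<in> root_group" using root_group.root[OF root_group.id] by simp
    ultimately show ?case
      by (intro bexI[of _ "root_aut r (- t) \<circ> k'"])
        (auto simp: fun_eq_iff root_aut_minus_cancel intro: root_group_comp)
  qed
  have "h \<circ> f = id"
    using f h linear_automorphism_comp[OF linear_automorphism_root_group[OF h(1)], of f]
    by (intro linear_automorphism_eq_id) simp_all
  moreover obtain h' where h': "h' \<in> root_group" "h' \<circ> h = id" using inv_closed[OF h(1)] by blast
  ultimately have "f = h'" by (metis comp_assoc comp_id id_comp)
  then show "f \<in> root_group" using h' by simp
qed (simp add: linear_automorphism_root_group)

section \<open>Lie algebra coordinates\<close>

definition g2v :: "'a \<Rightarrow> 'a \<Rightarrow> 'a \<Rightarrow> 'a \<Rightarrow> 'a \<Rightarrow> 'a \<Rightarrow> 'a \<Rightarrow> 'a \<Rightarrow> 'a \<Rightarrow> 'a \<Rightarrow> 'a \<Rightarrow> 'a \<Rightarrow> 'a \<Rightarrow> 'a \<Rightarrow> 'a::zero ^ g2_index" where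
  "g2v h1 h2 u1 u2 u3 d1 d2 d3 v1 v2 v3 w1 w2 w3 = (\<chi> j. case j of H1 \<Rightarrow> h1 | H2 \<Rightarrow> h2
     | E (Up i) \<Rightarrow> vector [u1, u2, u3] $ i | E (Down i) \<Rightarrow> vector [d1, d2, d3] $ i
     | E (Vec i) \<Rightarrow> vector [v1, v2, v3] $ i | E (Cov i) \<Rightarrow> vector [w1, w2, w3] $ i)"

lemma forall_g2_index:
  "(\<forall>j. P j) \<longleftrightarrow> P H1 \<and> P H2 \<and> (\<forall>i. P (E (Up i))) \<and> (\<forall>i. P (E (Down i))) \<and>
     (\<forall>i. P (E (Vec i))) \<and> (\<forall>i. P (E (Cov i)))"
  by (metis g2_index.exhaust g2_root.exhaust)

lemma sum_g2_index:
  fixes f :: "g2_index \<Rightarrow> 'a::comm_monoid_add"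
  shows "sum f UNIV = f H1 + f H2 + f (E (Up 1)) + f (E (Up 2)) + f (E (Up 3)) + f (E (Down 1)) +
     f (E (Down 2)) + f (E (Down 3)) + f (E (Vec 1)) + f (E (Vec 2)) + f (E (Vec 3)) +
     f (E (Cov 1)) + f (E (Cov 2)) + f (E (Cov 3))"
proof -
  have eq: "UNIV = {H1, H2, E (Up 1), E (Up 2), E (Up 3), E (Down 1), E (Down 2), E (Down 3), E (Vec 1),
     E (Vec 2), E (Vec 3), E (Cov 1), E (Cov 2), E (Cov 3)}"
    using forall_g2_index[of "\<lambda>j. j \<in> {H1, H2, E (Up 1), E (Up 2), E (Up 3), E (Down 1), E (Down 2), E (Down 3), E (Vec 1),
     E (Vec 2), E (Vec 3), E (Cov 1), E (Cov 2), E (Cov 3)}"]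
    by (simp add: forall_3 set_eq_iff)
  show ?thesis
    unfolding eq by (simp add: add.assoc)
qed

lemma g2v_nth [simp]:
  "g2v h1 h2 u1 u2 u3 d1 d2 d3 v1 v2 v3 w1 w2 w3 $ H1 = h1"
  "g2v h1 h2 u1 u2 u3 d1 d2 d3 v1 v2 v3 w1 w2 w3 $ H2 = h2"
  "g2v h1 h2 u1 u2 u3 d1 d2 d3 v1 v2 v3 w1 w2 w3 $ (E (Up 1)) = u1"
  "g2v h1 h2 u1 u2 u3 d1 d2 d3 v1 v2 v3 w1 w2 w3 $ (E (Up 2)) = u2"
  "g2v h1 h2 u1 u2 u3 d1 d2 d3 v1 v2 v3 w1 w2 w3 $ (E (Up 3)) = u3"
  "g2v h1 h2 u1 u2 u3 d1 d2 d3 v1 v2 v3 w1 w2 w3 $ (E (Down 1)) = d1"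
  "g2v h1 h2 u1 u2 u3 d1 d2 d3 v1 v2 v3 w1 w2 w3 $ (E (Down 2)) = d2"
  "g2v h1 h2 u1 u2 u3 d1 d2 d3 v1 v2 v3 w1 w2 w3 $ (E (Down 3)) = d3"
  "g2v h1 h2 u1 u2 u3 d1 d2 d3 v1 v2 v3 w1 w2 w3 $ (E (Vec 1)) = v1"
  "g2v h1 h2 u1 u2 u3 d1 d2 d3 v1 v2 v3 w1 w2 w3 $ (E (Vec 2)) = v2"
  "g2v h1 h2 u1 u2 u3 d1 d2 d3 v1 v2 v3 w1 w2 w3 $ (E (Vec 3)) = v3"
  "g2v h1 h2 u1 u2 u3 d1 d2 d3 v1 v2 v3 w1 w2 w3 $ (E (Cov 1)) = w1"
  "g2v h1 h2 u1 u2 u3 d1 d2 d3 v1 v2 v3 w1 w2 w3 $ (E (Cov 2)) = w2"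
  "g2v h1 h2 u1 u2 u3 d1 d2 d3 v1 v2 v3 w1 w2 w3 $ (E (Cov 3)) = w3"
  by (simp_all add: g2v_def)

lemma g2v_eq_iff: "c = d \<longleftrightarrow> c $ H1 = d $ H1 \<and> c $ H2 = d $ H2 \<and> c $ (E (Up 1)) = d $ (E (Up 1)) \<and>
     c $ (E (Up 2)) = d $ (E (Up 2)) \<and> c $ (E (Up 3)) = d $ (E (Up 3)) \<and>
     c $ (E (Down 1)) = d $ (E (Down 1)) \<and>
     c $ (E (Down 2)) = d $ (E (Down 2)) \<and>
     c $ (E (Down 3)) = d $ (E (Down 3)) \<and> c $ (E (Vec 1)) = d $ (E (Vec 1)) \<and>
     c $ (E (Vec 2)) = d $ (E (Vec 2)) \<and> c $ (E (Vec 3)) = d $ (E (Vec 3)) \<and>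
     c $ (E (Cov 1)) = d $ (E (Cov 1)) \<and> c $ (E (Cov 2)) = d $ (E (Cov 2)) \<and>
     c $ (E (Cov 3)) = d $ (E (Cov 3))" for c d :: "'a ^ g2_index"
  by (simp add: vec_eq_iff forall_g2_index forall_3 conj_assoc)

lemma g2v_cases:
  fixes c :: "'a::zero ^ g2_index"
  obtains h1 h2 u1 u2 u3 d1 d2 d3 v1 v2 v3 w1 w2 w3 where "c = g2v h1 h2 u1 u2 u3 d1 d2 d3 v1 v2 v3 w1 w2 w3"
proof
  show "c = g2v (c $ H1) (c $ H2) (c $ (E (Up 1))) (c $ (E (Up 2))) (c $ (E (Up 3)))
     (c $ (E (Down 1))) (c $ (E (Down 2))) (c $ (E (Down 3))) (c $ (E (Vec 1)))
     (c $ (E (Vec 2))) (c $ (E (Vec 3))) (c $ (E (Cov 1))) (c $ (E (Cov 2)))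
     (c $ (E (Cov 3)))"
    by (simp add: g2v_eq_iff)
qed

lemma axis_g2v:
  "axis H1 1 = g2v 1 0 0 0 0 0 0 0 0 0 0 0 0 0"
  "axis H2 1 = g2v 0 1 0 0 0 0 0 0 0 0 0 0 0 0"
  "axis (E (Up 1)) 1 = g2v 0 0 1 0 0 0 0 0 0 0 0 0 0 0"
  "axis (E (Up 2)) 1 = g2v 0 0 0 1 0 0 0 0 0 0 0 0 0 0"
  "axis (E (Up 3)) 1 = g2v 0 0 0 0 1 0 0 0 0 0 0 0 0 0"
  "axis (E (Down 1)) 1 = g2v 0 0 0 0 0 1 0 0 0 0 0 0 0 0"
  "axis (E (Down 2)) 1 = g2v 0 0 0 0 0 0 1 0 0 0 0 0 0 0"
  "axis (E (Down 3)) 1 = g2v 0 0 0 0 0 0 0 1 0 0 0 0 0 0"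
  "axis (E (Vec 1)) 1 = g2v 0 0 0 0 0 0 0 0 1 0 0 0 0 0"
  "axis (E (Vec 2)) 1 = g2v 0 0 0 0 0 0 0 0 0 1 0 0 0 0"
  "axis (E (Vec 3)) 1 = g2v 0 0 0 0 0 0 0 0 0 0 1 0 0 0"
  "axis (E (Cov 1)) 1 = g2v 0 0 0 0 0 0 0 0 0 0 0 1 0 0"
  "axis (E (Cov 2)) 1 = g2v 0 0 0 0 0 0 0 0 0 0 0 0 1 0"
  "axis (E (Cov 3)) 1 = g2v 0 0 0 0 0 0 0 0 0 0 0 0 0 1"
  by (simp_all add: g2v_eq_iff axis_def)

lemma g2_ad_mult:
  "g2_ad (Up 1) *v g2v h1 h2 u1 u2 u3 d1 d2 d3 v1 v2 v3 w1 w2 w3 = g2v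
    d1 0 (h2 - 2 * h1) 0 0 0 (- (u3)) u2 v2 0 0 0 (- (w1)) 0"
  "g2_ad (Up 2) *v g2v h1 h2 u1 u2 u3 d1 d2 d3 v1 v2 v3 w1 w2 w3 = g2v
    0 d2 0 (h1 - 2 * h2) 0 u3 0 (- (u1)) 0 v3 0 0 0 (- (w2))"
  "g2_ad (Up 3) *v g2v h1 h2 u1 u2 u3 d1 d2 d3 v1 v2 v3 w1 w2 w3 = g2v
    (- (d3)) (- (d3)) 0 0 (h1 + h2) (- (u2)) u1 0 0 0 v1 (- (w3)) 0 0"
  "g2_ad (Down 1) *v g2v h1 h2 u1 u2 u3 d1 d2 d3 v1 v2 v3 w1 w2 w3 = g2v
    (- (u1)) 0 0 d3 (- (d2)) (2 * h1 - h2) 0 0 0 v1 0 (- (w2)) 0 0"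
  "g2_ad (Down 2) *v g2v h1 h2 u1 u2 u3 d1 d2 d3 v1 v2 v3 w1 w2 w3 = g2v
    0 (- (u2)) (- (d3)) 0 d1 0 (2 * h2 - h1) 0 0 0 v2 0 (- (w3)) 0"
  "g2_ad (Down 3) *v g2v h1 h2 u1 u2 u3 d1 d2 d3 v1 v2 v3 w1 w2 w3 = g2v
    u3 u3 d2 (- (d1)) 0 0 0 (- (h1) - h2) v3 0 0 0 0 (- (w1))"
  "g2_ad (Vec 1) *v g2v h1 h2 u1 u2 u3 d1 d2 d3 v1 v2 v3 w1 w2 w3 = g2v
    (2 * w1) w1 (3 * w2) 0 0 0 0 (3 * w3) (- (h1)) (- (d1)) (- (u3)) 0 (- (2 * v3)) (2 * v2)"
  "g2_ad (Vec 2) *v g2v h1 h2 u1 u2 u3 d1 d2 d3 v1 v2 v3 w1 w2 w3 = g2v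
    (- (w2)) w2 0 (3 * w3) 0 (3 * w1) 0 0 (- (u1)) (h1 - h2) (- (d2)) (2 * v3) 0 (- (2 * v1))"
  "g2_ad (Vec 3) *v g2v h1 h2 u1 u2 u3 d1 d2 d3 v1 v2 v3 w1 w2 w3 = g2v
    (- (w3)) (- (2 * w3)) 0 0 (3 * w1) 0 (3 * w2) 0 (- (d3)) (- (u2)) h2 (- (2 * v2)) (2 * v1) 0"
  "g2_ad (Cov 1) *v g2v h1 h2 u1 u2 u3 d1 d2 d3 v1 v2 v3 w1 w2 w3 = g2v
    (- (2 * v1)) (- (v1)) 0 0 (- (3 * v3)) (- (3 * v2)) 0 0 0 (2 * w3) (- (2 * w2)) h1 u1 d3"
  "g2_ad (Cov 2) *v g2v h1 h2 u1 u2 u3 d1 d2 d3 v1 v2 v3 w1 w2 w3 = g2v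
    v2 (- (v2)) (- (3 * v1)) 0 0 0 (- (3 * v3)) 0 (- (2 * w3)) 0 (2 * w1) d1 (h2 - h1) u2"
  "g2_ad (Cov 3) *v g2v h1 h2 u1 u2 u3 d1 d2 d3 v1 v2 v3 w1 w2 w3 = g2v
    v3 (2 * v3) 0 (- (3 * v2)) 0 0 0 (- (3 * v1)) (2 * w2) (- (2 * w1)) 0 u3 d2 (- (h2))"
  by (simp_all add: g2v_eq_iff matrix_vector_mult_def sum_g2_index g2_ad_def matrix_unit_def
     matrix_matrix_mult_def vector_matrix_mult_def axis_def dot_def cross_def sum_3)

text \<open>
  Columns of a matrix power are iterated images of basis vectors. So the matrices \<open>x\<^sub>r(t)\<close> can be
  computed from the linear forms of \<open>g2_ad_mult\<close> without multiplying 14 by 14 matrices.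
\<close>

lemma matrix_power_nth:
  "((**) M ^^ k) (mat 1) $ i $ j = ((*v) M ^^ k) (axis j 1) $ i" for M :: "'a::comm_ring_1 ^ 'n ^ 'n"
proof -
  have "((**) M ^^ k) (mat 1) *v x = ((*v) M ^^ k) x" for x
    by (induction k) (simp_all flip: matrix_vector_mul_assoc)
  from this[of "axis j 1"] show ?thesis
    by (simp add: vec_eq_iff matrix_vector_mult_def axis_def if_distrib cong: if_cong)
qed

text \<open>
  An entry of the truncated exponential, from the entries \<open>p, q, r, s\<close> of the powers 0 to 3; the divisors are
  factorials.
\<close>

definition exp_entry :: "'a::field \<Rightarrow> int \<Rightarrow> int \<Rightarrow> int \<Rightarrow> int \<Rightarrow> 'a" where
  "exp_entry t p q r s = of_int p + of_int q * t + of_int (r div 2) * t\<^sup>2 + of_int (s div 6) * t ^ 3"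

lemma g2_x_nth:
  "g2_x r t $ i $ j = exp_entry t (axis j 1 $ i) ((g2_ad r *v axis j 1) $ i)
     ((g2_ad r *v (g2_ad r *v axis j 1)) $ i) ((g2_ad r *v (g2_ad r *v (g2_ad r *v axis j 1))) $ i)"
  by (simp add: g2_x_def matrix_power_nth exp_entry_def numeral_3_eq_3 numeral_2_eq_2 fact_numeral
      del: One_nat_def) 

text \<open>
  Here the divided powers become explicit polynomials over any field. Short roots
  reach degree 3, on the long root vectors.
\<close>

lemma g2_x_mult:
  fixes t :: "'a::field"
  shows
  "g2_x (Up 1) t *v g2v h1 h2 u1 u2 u3 d1 d2 d3 v1 v2 v3 w1 w2 w3 = g2v
    (h1 + t * d1) h2 (u1 + t * h2 - 2 * t * h1 - t\<^sup>2 * d1) u2 u3 d1 (d2 - t * u3)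
    (d3 + t * u2) (v1 + t * v2) v2 v3 w1 (w2 - t * w1) w3"
  "g2_x (Up 2) t *v g2v h1 h2 u1 u2 u3 d1 d2 d3 v1 v2 v3 w1 w2 w3 = g2v
    h1 (h2 + t * d2) u1 (u2 + t * h1 - 2 * t * h2 - t\<^sup>2 * d2) u3 (d1 + t * u3) d2
    (d3 - t * u1) v1 (v2 + t * v3) v3 w1 w2 (w3 - t * w2)"
  "g2_x (Up 3) t *v g2v h1 h2 u1 u2 u3 d1 d2 d3 v1 v2 v3 w1 w2 w3 = g2v
    (h1 - t * d3) (h2 - t * d3) u1 u2 (u3 + t * h1 + t * h2 - t\<^sup>2 * d3) (d1 - t * u2)
    (d2 + t * u1) d3 v1 v2 (v3 + t * v1) (w1 - t * w3) w2 w3"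
  "g2_x (Down 1) t *v g2v h1 h2 u1 u2 u3 d1 d2 d3 v1 v2 v3 w1 w2 w3 = g2v
    (h1 - t * u1) h2 u1 (u2 + t * d3) (u3 - t * d2) (d1 + 2 * t * h1 - t * h2 - t\<^sup>2 * u1)
    d2 d3 v1 (v2 + t * v1) v3 (w1 - t * w2) w2 w3"
  "g2_x (Down 2) t *v g2v h1 h2 u1 u2 u3 d1 d2 d3 v1 v2 v3 w1 w2 w3 = g2v
    h1 (h2 - t * u2) (u1 - t * d3) u2 (u3 + t * d1) d1
    (d2 + 2 * t * h2 - t * h1 - t\<^sup>2 * u2) d3 v1 v2 (v3 + t * v2) w1 (w2 - t * w3) w3"
  "g2_x (Down 3) t *v g2v h1 h2 u1 u2 u3 d1 d2 d3 v1 v2 v3 w1 w2 w3 = g2v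
    (h1 + t * u3) (h2 + t * u3) (u1 + t * d2) (u2 - t * d1) u3 d1 d2
    (d3 - t * h1 - t * h2 - t\<^sup>2 * u3) (v1 + t * v3) v2 v3 w1 w2 (w3 - t * w1)"
  "g2_x (Vec 1) t *v g2v h1 h2 u1 u2 u3 d1 d2 d3 v1 v2 v3 w1 w2 w3 = g2v
    (h1 + 2 * t * w1) (h2 + t * w1) (u1 + 3 * t * w2 - 3 * t\<^sup>2 * v3 + t ^ 3 * u3) u2 u3 d1
    d2 (d3 + 3 * t * w3 + 3 * t\<^sup>2 * v2 - t ^ 3 * d1) (v1 - t * h1 - t\<^sup>2 * w1)
    (v2 - t * d1) (v3 - t * u3) w1 (w2 - 2 * t * v3 + t\<^sup>2 * u3)
    (w3 + 2 * t * v2 - t\<^sup>2 * d1)"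
  "g2_x (Vec 2) t *v g2v h1 h2 u1 u2 u3 d1 d2 d3 v1 v2 v3 w1 w2 w3 = g2v
    (h1 - t * w2) (h2 + t * w2) u1 (u2 + 3 * t * w3 - 3 * t\<^sup>2 * v1 + t ^ 3 * u1) u3
    (d1 + 3 * t * w1 + 3 * t\<^sup>2 * v3 - t ^ 3 * d2) d2 d3 (v1 - t * u1)
    (v2 + t * h1 - t * h2 - t\<^sup>2 * w2) (v3 - t * d2) (w1 + 2 * t * v3 - t\<^sup>2 * d2) w2
    (w3 - 2 * t * v1 + t\<^sup>2 * u1)"
  "g2_x (Vec 3) t *v g2v h1 h2 u1 u2 u3 d1 d2 d3 v1 v2 v3 w1 w2 w3 = g2v
    (h1 - t * w3) (h2 - 2 * t * w3) u1 u2 (u3 + 3 * t * w1 - 3 * t\<^sup>2 * v2 + t ^ 3 * u2) d1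
    (d2 + 3 * t * w2 + 3 * t\<^sup>2 * v1 - t ^ 3 * d3) d3 (v1 - t * d3) (v2 - t * u2)
    (v3 + t * h2 - t\<^sup>2 * w3) (w1 - 2 * t * v2 + t\<^sup>2 * u2)
    (w2 + 2 * t * v1 - t\<^sup>2 * d3) w3"
  "g2_x (Cov 1) t *v g2v h1 h2 u1 u2 u3 d1 d2 d3 v1 v2 v3 w1 w2 w3 = g2v
    (h1 - 2 * t * v1) (h2 - t * v1) u1 u2 (u3 - 3 * t * v3 + 3 * t\<^sup>2 * w2 + t ^ 3 * u1)
    (d1 - 3 * t * v2 - 3 * t\<^sup>2 * w3 - t ^ 3 * d3) d2 d3 v1
    (v2 + 2 * t * w3 + t\<^sup>2 * d3) (v3 - 2 * t * w2 - t\<^sup>2 * u1)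
    (w1 + t * h1 - t\<^sup>2 * v1) (w2 + t * u1) (w3 + t * d3)"
  "g2_x (Cov 2) t *v g2v h1 h2 u1 u2 u3 d1 d2 d3 v1 v2 v3 w1 w2 w3 = g2v
    (h1 + t * v2) (h2 - t * v2) (u1 - 3 * t * v1 + 3 * t\<^sup>2 * w3 + t ^ 3 * u2) u2 u3 d1
    (d2 - 3 * t * v3 - 3 * t\<^sup>2 * w1 - t ^ 3 * d1) d3 (v1 - 2 * t * w3 - t\<^sup>2 * u2) v2
    (v3 + 2 * t * w1 + t\<^sup>2 * d1) (w1 + t * d1) (w2 + t * h2 - t * h1 - t\<^sup>2 * v2)
    (w3 + t * u2)"
  "g2_x (Cov 3) t *v g2v h1 h2 u1 u2 u3 d1 d2 d3 v1 v2 v3 w1 w2 w3 = g2v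
    (h1 + t * v3) (h2 + 2 * t * v3) u1 (u2 - 3 * t * v2 + 3 * t\<^sup>2 * w1 + t ^ 3 * u3) u3 d1
    d2 (d3 - 3 * t * v1 - 3 * t\<^sup>2 * w2 - t ^ 3 * d2) (v1 + 2 * t * w2 + t\<^sup>2 * d2)
    (v2 - 2 * t * w1 - t\<^sup>2 * u3) v3 (w1 + t * u3) (w2 + t * d2)
    (w3 - t * h2 - t\<^sup>2 * v3)"
  by (simp_all add: g2v_eq_iff matrix_vector_mult_def[of "g2_x _ _"] sum_g2_index g2_x_nth axis_g2v g2_ad_mult
     exp_entry_def algebra_simps)

section \<open>Derivations\<close>

definition g2_lie_of :: "'a::comm_ring_1 ^ g2_index \<Rightarrow> 'a g2_lie" where
  "g2_lie_of c =
     (vector [vector [c $ H1, c $ E (Up 1), c $ E (Down 3)],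
              vector [c $ E (Down 1), c $ H2 - c $ H1, c $ E (Up 2)],
              vector [c $ E (Up 3), c $ E (Down 2), - c $ H2]],
      \<chi> i. c $ E (Vec i), \<chi> i. c $ E (Cov i))"

text \<open>
  The representation on the octonions for which \<open>g2_bracket\<close> is the commutator. Its signs are determined by this
  and by the derivation rule: \<open>v\<close> sends the first diagonal idempotent to \<open>- v\<close>, and \<open>w\<close> sends it to \<open>w\<close>.
\<close>

fun g2_act :: "'a::comm_ring_1 g2_lie \<Rightarrow> 'a zorn \<Rightarrow> 'a zorn" where
  "g2_act (A, v, w) (Zorn a \<alpha> \<beta> b) =
     Zorn (dot v \<beta> - dot w \<alpha>) (A *v \<alpha> - (a - b) *s v + cross w \<beta>)
       ((a - b) *s w - \<beta> v* A - cross v \<alpha>) (dot w \<alpha> - dot v \<beta>)"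

definition g2_der :: "'a::comm_ring_1 ^ g2_index \<Rightarrow> 'a zorn \<Rightarrow> 'a zorn" where
  "g2_der c = g2_act (g2_lie_of c)"

lemma g2_der_oct [simp]:
  "g2_der (g2v h1 h2 u1 u2 u3 d1 d2 d3 v1 v2 v3 w1 w2 w3) (oct a x1 x2 x3 y1 y2 y3 b) =
    oct (v1 * y1 + v2 * y2 + v3 * y3 - (w1 * x1 + w2 * x2 + w3 * x3))
      (h1 * x1 + u1 * x2 + d3 * x3 - (a - b) * v1 + (w2 * y3 - w3 * y2))
      (d1 * x1 + (h2 - h1) * x2 + u2 * x3 - (a - b) * v2 + (w3 * y1 - w1 * y3))
      (u3 * x1 + d2 * x2 - h2 * x3 - (a - b) * v3 + (w1 * y2 - w2 * y1))
      ((a - b) * w1 - (y1 * h1 + y2 * d1 + y3 * u3) - (v2 * x3 - v3 * x2))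
      ((a - b) * w2 - (y1 * u1 + y2 * (h2 - h1) + y3 * d2) - (v3 * x1 - v1 * x3))
      ((a - b) * w3 - (y1 * d3 + y2 * u2 - y3 * h2) - (v1 * x2 - v2 * x1))
      (w1 * x1 + w2 * x2 + w3 * x3 - (v1 * y1 + v2 * y2 + v3 * y3) :: 'a::comm_ring_1)"
  by (simp add: g2_der_def g2_lie_of_def oct_def vec_eq_iff forall_3 dot_def cross_def sum_3
      matrix_vector_mult_def vector_matrix_mult_def algebra_simps)

text \<open>
  Conjugation by the root automorphism acts on derivations by \<open>exp (t ad e\<^sub>r)\<close>, as it does for any
  exponential of a derivation. Both sides are polynomial in all coordinates, and comparing them avoids
  dividing by factorials that may vanish in the field.
\<close>

lemma root_aut_g2_der:
  "root_aut r t (g2_der c x) = g2_der (g2_x r t *v c) (root_aut r t x)"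
  by (cases c rule: g2v_cases; cases x; cases r)
    (simp_all add: g2_x_mult algebra_simps power2_eq_square power3_eq_cube)

section \<open>Matrices and linear automorphisms\<close>

text \<open>
  Conjugation by \<open>h\<close> maps the derivation with coordinates \<open>c\<close> to the one with coordinates \<open>A c\<close>. Stated as
  a relation, so that it can be composed before the matrix is known to exist or to be unique.
\<close>

definition acts_on_g2 :: "('a::field zorn \<Rightarrow> 'a zorn) \<Rightarrow> 'a ^ g2_index ^ g2_index \<Rightarrow> bool" where
  "acts_on_g2 h A \<longleftrightarrow> (\<forall>c x. h (g2_der c x) = g2_der (A *v c) (h x))"

lemma acts_on_g2_id: "acts_on_g2 id (mat 1)"
  by (simp add: acts_on_g2_def)

lemma acts_on_g2_comp: "acts_on_g2 h A \<Longrightarrow> acts_on_g2 k B \<Longrightarrow> acts_on_g2 (h \<circ> k) (A ** B)"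
  by (simp add: acts_on_g2_def flip: matrix_vector_mul_assoc)

lemma acts_on_g2_root: "acts_on_g2 (root_aut r t) (g2_x r t)"
  by (simp add: acts_on_g2_def root_aut_g2_der)

lemma g2_der_inject:
  fixes c d :: "'a::field ^ g2_index"
  assumes "\<And>x. g2_der c x = g2_der d x"
  shows "c = d"
  using assms[of "oct 1 0 0 0 0 0 0 0"] assms[of e1] assms[of e2] assms[of e3]
  by (cases c rule: g2v_cases; cases d rule: g2v_cases) simp

lemma acts_on_g2_unique:
  assumes h: "linear_automorphism h" and "acts_on_g2 h A" "acts_on_g2 h B"
  shows "A = B"
proof -
  have "A *v c = B *v c" for c
  proof (rule g2_der_inject)
    fix y
    obtain x where "y = h x" using h by (metis linear_automorphism_def bij_pointE)
    then show "g2_der (A *v c) y = g2_der (B *v c) y" using assms(2,3) by (simp add: acts_on_g2_def)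
  qed
  then show ?thesis by (simp add: matrix_eq)
qed

text \<open>
  The centre of \<open>G\<^sub>2\<close> is trivial. Commuting with the long root derivations makes \<open>f\<close> scalar on the
  upper vectors, since the images of two of them meet in a line; the scalar is a cube root of unity
  because the idempotent \<open>e\<^sub>1 * (e\<^sub>2 * e\<^sub>3)\<close> goes to an idempotent, and a short root derivation, which takes that
  idempotent to a multiple of \<open>e\<^sub>1\<close>, makes it 1.
\<close>

lemma linear_automorphism_commuting_with_g2_der:
  assumes f: "linear_automorphism f" and comm: "\<And>c x. f (g2_der c x) = g2_der c (f x)"
  shows "f = id"
proof -
  have mult: "f (x * y) = f x * f y" for x y using f by (simp only: linear_automorphism_def)
  obtain a x1 x2 x3 y1 y2 y3 b where f2: "f e2 = oct a x1 x2 x3 y1 y2 y3 b" by (cases "f e2")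
  obtain a' x1' x2' x3' y1' y2' y3' b' where f3: "f e3 = oct a' x1' x2' x3' y1' y2' y3' b'" by (cases "f e3")
  have "f e1 = oct 0 x2 0 0 0 (- y1) 0 0"
    using comm[of "axis (E (Up 1)) 1" e2] by (simp add: axis_g2v f2)
  moreover have "f e1 = oct 0 x3' 0 0 0 0 (- y1') 0"
    using comm[of "axis (E (Down 3)) 1" e3] by (simp add: axis_g2v f3)
  ultimately have f1: "f e1 = oct 0 x2 0 0 0 0 0 0" by simp
  have f2: "f e2 = oct 0 0 x2 0 0 0 0 0"
    using comm[of "axis (E (Down 1)) 1" e1] by (simp add: axis_g2v f1)
  have f3: "f e3 = oct 0 0 0 x2 0 0 0 0"
    using comm[of "axis (E (Up 3)) 1" e1] by (simp add: axis_g2v f1)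
  have f0: "f (oct 1 0 0 0 0 0 0 0) = oct (x2 * (x2 * x2)) 0 0 0 0 0 0 0"
    using mult[of e1 "e2 * e3"] unfolding mult[of e2 e3] f1 f2 f3 by simp
  have "f e1 \<noteq> 0" using linear_automorphism_eq_zero_iff[OF f, of e1] by (simp add: zero_one_oct)
  then have "x2 \<noteq> 0" by (simp add: f1 zero_one_oct)
  moreover have "x2 * (x2 * x2) = (x2 * (x2 * x2)) * (x2 * (x2 * x2))"
    using mult[of "oct 1 0 0 0 0 0 0 0" "oct 1 0 0 0 0 0 0 0"] unfolding f0 by (simp add: f0)
  ultimately have "x2 * (x2 * x2) = 1" by simp
  moreover have mult_neg: "f (- e1) = - f e1"
    using f zorn_scale_simps(4,7) by (metis linear_automorphism_def)
  moreover have "x2 = x2 * (x2 * x2)"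
    using comm[of "axis (E (Vec 1)) 1" "oct 1 0 0 0 0 0 0 0"] mult_neg unfolding f0
    by (simp add: axis_g2v f1)
  ultimately have "x2 = 1" by simp
  then show "f = id" using f f1 f2 f3 by (intro linear_automorphism_eq_id) simp_all
qed

lemma acts_on_g2_faithful:
  assumes h: "linear_automorphism h" and k: "linear_automorphism k"
    and A: "acts_on_g2 h A" "acts_on_g2 k A"
  shows "h = k"
proof -
  let ?f = "inv_into UNIV k \<circ> h"
  have kf: "k (?f x) = h x" for x
    using k by (simp add: linear_automorphism_def bij_is_surj surj_f_inv_f)
  have f: "linear_automorphism ?f" by (intro linear_automorphism_comp linear_automorphism_inv h k)
  have inj: "x = y" if "k x = k y" for x y using that k by (simp add: linear_automorphism_def bij_is_inj inj_eq)
  have comm: "?f (g2_der c x) = g2_der c (?f x)" for c x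
  proof (rule inj)
    have "k (g2_der c (?f x)) = g2_der (A *v c) (k (?f x))" using A(2) by (simp only: acts_on_g2_def)
    also have "\<dots> = h (g2_der c x)" using A(1) unfolding kf by (simp only: acts_on_g2_def)
    finally show "k (?f (g2_der c x)) = k (g2_der c (?f x))" by (simp only: kf)
  qed
  have "?f = id" by (rule linear_automorphism_commuting_with_g2_der[OF f comm])
  then show ?thesis using kf by (metis ext id_apply)
qed

lemma g2_x_inverse: "g2_x r t ** g2_x r (- t) = mat 1"
proof (rule acts_on_g2_unique[OF linear_automorphism_id _ acts_on_g2_id])
  have "root_aut r t \<circ> root_aut r (- t) = id"
    using root_aut_minus_cancel[of r "- t"] by (simp add: fun_eq_iff)
  then show "acts_on_g2 id (g2_x r t ** g2_x r (- t))"
    using acts_on_g2_comp[OF acts_on_g2_root acts_on_g2_root] by metis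
qed

lemma inv_GL:
  assumes "A ** B = mat 1" "B ** A = mat 1"
  shows "inv\<^bsub>GL\<^esub> A = B"
  unfolding m_inv_def
proof (rule the_equality)
  show "B \<in> carrier GL \<and> A \<otimes>\<^bsub>GL\<^esub> B = \<one>\<^bsub>GL\<^esub> \<and> B \<otimes>\<^bsub>GL\<^esub> A = \<one>\<^bsub>GL\<^esub>"
    using assms by (auto simp: GL_def invertible_def)
  fix C assume "C \<in> carrier GL \<and> A \<otimes>\<^bsub>GL\<^esub> C = \<one>\<^bsub>GL\<^esub> \<and> C \<otimes>\<^bsub>GL\<^esub> A = \<one>\<^bsub>GL\<^esub>"
  then show "C = B" using assms by (simp add: GL_def) (metis matrix_mul_assoc matrix_mul_lid matrix_mul_rid)
qed

lemma acts_on_g2_exists: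
  assumes "linear_automorphism h"
  shows "\<exists>A\<in>carrier G2. acts_on_g2 h A"
proof -
  have "h \<in> root_group" using assms by (simp add: root_group_eq)
  then show ?thesis
  proof (induction rule: root_group.induct)
    case id
    have "mat 1 \<in> carrier G2"
      using generate.one[of GL "{g2_x r t | r t. True}"] by (simp add: G2_def GL_def)
    with acts_on_g2_id show ?case by (rule bexI)
  next
    case (root k r t)
    then obtain B where B: "B \<in> carrier G2" "acts_on_g2 k B" by blast
    then have "B \<otimes>\<^bsub>GL\<^esub> g2_x r t \<in> carrier G2"
      by (auto simp: G2_def intro!: generate.eng intro: generate.incl)
    then have "B ** g2_x r t \<in> carrier G2" by (simp add: GL_def)
    with acts_on_g2_comp[OF B(2) acts_on_g2_root] show ?case by (rule bexI)
  qed
qed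

text \<open>
  The root automorphisms generate all linear automorphisms and the matrices \<open>x\<^sub>r(t)\<close> generate \<open>G\<^sub>2(F)\<close>, so
  following words in the generators gives both inclusions.
\<close>

theorem carrier_G2: "carrier G2 = {A. \<exists>h. linear_automorphism h \<and> acts_on_g2 h A}"
proof (intro equalityI subsetI CollectI)
  fix A :: "'a ^ g2_index ^ g2_index"
  assume "A \<in> carrier G2"
  then have "A \<in> generate GL {g2_x r t | r t. True}" by (simp add: G2_def)
  then show "\<exists>h. linear_automorphism h \<and> acts_on_g2 h A"
  proof (induction rule: generate.induct)
    case one
    then show ?case using linear_automorphism_id acts_on_g2_id by (auto simp: GL_def)
  next
    case (incl A)
    then show ?case using linear_automorphism_root_aut acts_on_g2_root by blast
  next
    case (inv A)
    then obtain r t where A: "A = g2_x r t" by blast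
    have "inv\<^bsub>GL\<^esub> A = g2_x r (- t)"
      using g2_x_inverse[of r t] g2_x_inverse[of r "- t"] by (simp add: inv_GL A)
    then show ?case using linear_automorphism_root_aut acts_on_g2_root by metis
  next
    case (eng A B)
    then show ?case
      using linear_automorphism_comp acts_on_g2_comp by (simp add: GL_def) blast
  qed
next
  fix A :: "'a ^ g2_index ^ g2_index"
  assume "A \<in> {A. \<exists>h. linear_automorphism h \<and> acts_on_g2 h A}"
  then show "A \<in> carrier G2"
    using acts_on_g2_exists acts_on_g2_unique by blast
qed

section \<open>Field automorphisms\<close>

lemma field_automorphism_simps:
  assumes "field_automorphism \<sigma>"
  shows "\<sigma> (x + y) = \<sigma> x + \<sigma> y" "\<sigma> (x * y) = \<sigma> x * \<sigma> y" "\<sigma> 0 = 0" "\<sigma> 1 = 1"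
    "\<sigma> (- x) = - \<sigma> x" "\<sigma> (x - y) = \<sigma> x - \<sigma> y" "\<sigma> x = 0 \<longleftrightarrow> x = 0" "\<sigma> x = \<sigma> y \<longleftrightarrow> x = y"
proof -
  show add: "\<sigma> (x + y) = \<sigma> x + \<sigma> y" and mult: "\<sigma> (x * y) = \<sigma> x * \<sigma> y" for x y
    using assms by (auto simp: field_automorphism_def)
  show inj: "\<sigma> x = \<sigma> y \<longleftrightarrow> x = y" for x y
    using assms by (simp add: field_automorphism_def bij_is_inj inj_eq)
  show 0: "\<sigma> 0 = 0" using add[of 0 0] by (metis add.right_neutral add_left_cancel)
  show eq0: "\<sigma> x = 0 \<longleftrightarrow> x = 0" for x using inj[of x 0] 0 by simp
  show "\<sigma> 1 = 1" using mult[of 1 1] eq0[of 1] by simp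
  show neg: "\<sigma> (- x) = - \<sigma> x" for x using add[of "- x" x] 0 by (simp add: eq_neg_iff_add_eq_0)
  show "\<sigma> (x - y) = \<sigma> x - \<sigma> y" using add[of x "- y"] neg by simp
qed

lemma field_automorphism_comp:
  "field_automorphism \<sigma> \<Longrightarrow> field_automorphism \<tau> \<Longrightarrow> field_automorphism (\<sigma> \<circ> \<tau>)"
  by (auto simp: field_automorphism_def intro: bij_comp)

lemma field_automorphism_inv:
  assumes "field_automorphism \<sigma>"
  shows "field_automorphism (inv_into UNIV \<sigma>)"
proof -
  have b: "bij \<sigma>" using assms by (simp add: field_automorphism_def)
  then have s: "\<sigma> (inv_into UNIV \<sigma> x) = x" for x by (simp add: bij_is_surj surj_f_inv_f)
  have eq: "inv_into UNIV \<sigma> x = y" if "x = \<sigma> y" for x y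
    using that b by (simp add: bij_is_inj inv_f_f)
  show ?thesis
    unfolding field_automorphism_def using b
    by (intro conjI allI bij_imp_bij_inv eq) (simp_all add: field_automorphism_simps[OF assms] s)
qed

fun zorn_map :: "('a::field \<Rightarrow> 'a) \<Rightarrow> 'a zorn \<Rightarrow> 'a zorn" where
  "zorn_map \<sigma> (Zorn a \<alpha> \<beta> b) = Zorn (\<sigma> a) (\<chi> i. \<sigma> (\<alpha> $ i)) (\<chi> i. \<sigma> (\<beta> $ i)) (\<sigma> b)"

lemma zorn_map_oct [simp]:
  "zorn_map \<sigma> (oct a x1 x2 x3 y1 y2 y3 b) =
    oct (\<sigma> a) (\<sigma> x1) (\<sigma> x2) (\<sigma> x3) (\<sigma> y1) (\<sigma> y2) (\<sigma> y3) (\<sigma> b)"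
  by (simp add: oct_def vec_eq_iff forall_3)

lemma zorn_map_comp: "zorn_map \<sigma> (zorn_map \<tau> u) = zorn_map (\<sigma> \<circ> \<tau>) u"
  by (cases u) simp

lemma zorn_map_id [simp]: "zorn_map id u = u"
  by (cases u) simp

lemma zorn_map_inv:
  assumes "field_automorphism \<sigma>"
  shows "zorn_map \<sigma> (zorn_map (inv_into UNIV \<sigma>) u) = u" "zorn_map (inv_into UNIV \<sigma>) (zorn_map \<sigma> u) = u"
proof -
  have "bij \<sigma>" using assms by (simp add: field_automorphism_def)
  then have "\<sigma> \<circ> inv_into UNIV \<sigma> = id" "inv_into UNIV \<sigma> \<circ> \<sigma> = id"
    by (simp_all add: fun_eq_iff bij_is_inj bij_is_surj inv_f_f surj_f_inv_f)
  then show "zorn_map \<sigma> (zorn_map (inv_into UNIV \<sigma>) u) = u" "zorn_map (inv_into UNIV \<sigma>) (zorn_map \<sigma> u) = u"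
    by (simp_all only: zorn_map_comp zorn_map_id)
qed

lemma zorn_map_simps:
  assumes "field_automorphism \<sigma>"
  shows "zorn_map \<sigma> (u + v) = zorn_map \<sigma> u + zorn_map \<sigma> v" "zorn_map \<sigma> (u * v) = zorn_map \<sigma> u * zorn_map \<sigma> v"
    "zorn_map \<sigma> (- u) = - zorn_map \<sigma> u" "zorn_map \<sigma> (zorn_scale c u) = zorn_scale (\<sigma> c) (zorn_map \<sigma> u)"
    "zorn_norm (zorn_map \<sigma> u) = \<sigma> (zorn_norm u)" "zorn_map \<sigma> 1 = 1"
  by (cases u; cases v; simp add: field_automorphism_simps[OF assms] zero_one_oct)+

text \<open>
  The derivations of the integral basis have integer coefficients, hence commute with field
  automorphisms; so conjugation by a field automorphism applies it to the matrix entries.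
\<close>

lemma acts_on_g2_zorn_map:
  assumes \<sigma>: "field_automorphism \<sigma>" and h: "acts_on_g2 h A"
  shows "acts_on_g2 (zorn_map \<sigma> \<circ> h \<circ> zorn_map (inv_into UNIV \<sigma>)) (map_matrix \<sigma> A)"
proof -
  define vmap where "vmap \<tau> c = (\<chi> i. \<tau> (c $ i))" for \<tau> :: "'a \<Rightarrow> 'a" and c :: "'a ^ g2_index"
  have vmap_g2v: "vmap \<tau> (g2v h1 h2 u1 u2 u3 d1 d2 d3 v1 v2 v3 w1 w2 w3) =
      g2v (\<tau> h1) (\<tau> h2) (\<tau> u1) (\<tau> u2) (\<tau> u3) (\<tau> d1) (\<tau> d2) (\<tau> d3)
        (\<tau> v1) (\<tau> v2) (\<tau> v3) (\<tau> w1) (\<tau> w2) (\<tau> w3)"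
    for \<tau> h1 h2 u1 u2 u3 d1 d2 d3 v1 v2 v3 w1 w2 w3
    by (simp add: g2v_eq_iff vmap_def)
  note \<tau> = field_automorphism_inv[OF \<sigma>]
  have der: "zorn_map \<tau> (g2_der c x) = g2_der (vmap \<tau> c) (zorn_map \<tau> x)" if "field_automorphism \<tau>" for \<tau> c x
    by (cases c rule: g2v_cases; cases x) (simp add: vmap_g2v field_automorphism_simps[OF that])
  have sum: "\<sigma> (\<Sum>j\<in>S. f j) = (\<Sum>j\<in>S. \<sigma> (f j))" for S and f :: "g2_index \<Rightarrow> 'a"
    by (induction S rule: infinite_finite_induct) (simp_all add: field_automorphism_simps[OF \<sigma>])
  have "vmap \<sigma> (A *v vmap (inv_into UNIV \<sigma>) c) = map_matrix \<sigma> A *v c" for c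
    using \<sigma> by (simp add: vec_eq_iff vmap_def matrix_vector_mult_def sum field_automorphism_simps[OF \<sigma>]
      field_automorphism_def bij_is_surj surj_f_inv_f)
  then show ?thesis
    using h by (simp add: acts_on_g2_def der[OF \<sigma>] der[OF \<tau>] zorn_map_inv[OF \<sigma>])
qed

lemma linear_automorphism_zorn_map:
  assumes \<sigma>: "field_automorphism \<sigma>" and h: "linear_automorphism h"
  shows "linear_automorphism (zorn_map \<sigma> \<circ> h \<circ> zorn_map (inv_into UNIV \<sigma>))"
proof -
  have b: "bij (zorn_map \<sigma>)" "bij (zorn_map (inv_into UNIV \<sigma>))"
    by (rule o_bij[of "zorn_map (inv_into UNIV \<sigma>)"]; simp add: fun_eq_iff zorn_map_inv[OF \<sigma>])
       (rule o_bij[of "zorn_map \<sigma>"]; simp add: fun_eq_iff zorn_map_inv[OF \<sigma>])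
  have \<sigma>_inv: "\<sigma> (inv_into UNIV \<sigma> x) = x" for x
    using \<sigma> by (simp add: field_automorphism_def bij_is_surj surj_f_inv_f)
  from h show ?thesis
    by (auto simp: linear_automorphism_def zorn_map_simps[OF \<sigma>] zorn_map_simps[OF field_automorphism_inv[OF \<sigma>]] \<sigma>_inv
      intro!: bij_comp b)
qed

section \<open>Equality up to sign\<close>

text \<open>
  The centre of the loop is \<open>{1, -1}\<close>, so this is equality in the quotient loop.
\<close>

definition eq_sign :: "'a::comm_ring_1 zorn \<Rightarrow> 'a zorn \<Rightarrow> bool" (infix \<open>\<doteq>\<close> 50) where
  "u \<doteq> v \<longleftrightarrow> u = v \<or> u = - v"

lemma eq_sign_refl [simp]: "u \<doteq> u"
  by (simp add: eq_sign_def)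

lemma eq_sign_sym: "u \<doteq> v \<Longrightarrow> v \<doteq> u"
  by (auto simp: eq_sign_def)

lemma eq_sign_trans [trans]: "u \<doteq> v \<Longrightarrow> v \<doteq> w \<Longrightarrow> u \<doteq> w"
  by (auto simp: eq_sign_def)

lemma eq_sign_uminus [simp]: "- u \<doteq> v \<longleftrightarrow> u \<doteq> v" "u \<doteq> - v \<longleftrightarrow> u \<doteq> v"
  by (auto simp: eq_sign_def minus_equation_iff)

lemma eq_sign_mult: "u \<doteq> u' \<Longrightarrow> v \<doteq> v' \<Longrightarrow> u * v \<doteq> u' * v'"
  by (auto simp: eq_sign_def)

lemma eq_sign_square: "u \<doteq> v \<Longrightarrow> u * u = v * v"
  by (auto simp: eq_sign_def)

lemma eq_sign_cancel:
  assumes "zorn_norm x = 1"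
  shows "x * u \<doteq> x * v \<longleftrightarrow> u \<doteq> v" "u * x \<doteq> v * x \<longleftrightarrow> u \<doteq> v"
proof -
  have l: "x * u = x * v \<longleftrightarrow> u = v" for u v
    using zorn_conj_cancel(1)[of x u] zorn_conj_cancel(1)[of x v] assms by (metis zorn_scale_simps(4))
  have r: "u * x = v * x \<longleftrightarrow> u = v" for u v
    using zorn_conj_cancel(2)[of u x] zorn_conj_cancel(2)[of v x] assms by (metis zorn_scale_simps(4))
  show "x * u \<doteq> x * v \<longleftrightarrow> u \<doteq> v"
    unfolding eq_sign_def zorn_mult_minus(2)[symmetric] l ..
  show "u * x \<doteq> v * x \<longleftrightarrow> u \<doteq> v"
    unfolding eq_sign_def zorn_mult_minus(1)[symmetric] r ..
qed

section \<open>Elements of square zero\<close>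

lemma square_zero_cases: "n * n = 0 \<longleftrightarrow> n = 0 \<or> nilp n"
  by (auto simp: nilp_def)

lemma square_zero:
  fixes n :: "'a::field zorn"
  assumes "n * n = 0"
  shows "zorn_trace n = 0" "zorn_norm n = 0"
proof -
  have "zorn_norm (0 :: 'a zorn) = 0" by (simp add: zero_one_oct)
  then show "zorn_trace n = 0" "zorn_norm n = 0"
    using assms by (auto simp: square_zero_cases nilp_iff)
qed

lemma zorn_norm_one_plus [simp]: "n * n = 0 \<Longrightarrow> zorn_norm (1 + n) = 1" for n :: "'a::field zorn"
  by (simp add: zorn_norm_one_add square_zero)

lemma uminus_eq_self_char_2:
  assumes "(2 :: 'a::field) = 0"
  shows "- u = (u :: 'a zorn)"
proof -
  have "- x = x" for x :: 'a
    using assms by (metis add_eq_0_iff mult_2 mult_zero_left)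
  then show ?thesis by (cases u) simp
qed

lemma four_eq_0_iff: "(4 :: 'a::field) = 0 \<longleftrightarrow> (2 :: 'a) = 0"
  using mult_eq_0_iff[of "2 :: 'a" 2] by simp

text \<open>
  A class modulo sign contains only one element of the form \<open>1 + n\<close>: comparing traces in
  \<open>1 + n = - (1 + m)\<close> gives \<open>4 = 0\<close>, hence characteristic 2, where signs do not matter.
\<close>

lemma one_plus_eq_sign:
  fixes n m :: "'a::field zorn"
  assumes n: "n * n = 0" and m: "m * m = 0" and eq: "1 + n \<doteq> 1 + m"
  shows "n = m"
proof (cases "1 + n = 1 + m")
  case False
  with eq have neg: "1 + n = - (1 + m)" by (simp add: eq_sign_def)
  then have "zorn_trace (1 + n) = zorn_trace (- (1 + m))" by simp
  then have "(2 :: 'a) = - 2" using square_zero[OF n] square_zero[OF m] by simp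
  then have "(2 :: 'a) + 2 = 0" by (simp only: eq_neg_iff_add_eq_0)
  then have "(2 :: 'a) = 0" by (simp add: four_eq_0_iff)
  with neg show ?thesis using uminus_eq_self_char_2 by (metis add_left_cancel)
qed simp

lemma one_plus_scale_mult:
  fixes n :: "'a::field zorn"
  assumes "n * n = 0"
  shows "(1 + zorn_scale c n) * (1 + zorn_scale d n) = 1 + zorn_scale (c + d) n"
  using assms by (simp add: zorn_distrib zorn_scale_distrib)

text \<open>
  The unipotent elements \<open>1 + n\<close> and \<open>1 + m\<close> have a product of the same kind when \<open>n\<close> and \<open>m\<close> are orthogonal,
  because a norm 1 element of trace 2 is unipotent.
\<close>

lemma square_zero_product:
  fixes n m :: "'a::field zorn"
  assumes n: "n * n = 0" and m: "m * m = 0" and t: "zorn_trace (n * m) = 0"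
  shows "(n + m + n * m) * (n + m + n * m) = 0"
    and "(1 + n) * (1 + m) = 1 + (n + m + n * m)"
proof -
  show prod: "(1 + n) * (1 + m) = 1 + (n + m + n * m)"
    by (simp add: zorn_distrib)
  let ?p = "n + m + n * m"
  have tr: "zorn_trace ?p = 0" using square_zero[OF n] square_zero[OF m] t by simp
  have "zorn_norm (1 + ?p) = 1"
    unfolding prod[symmetric] using n m by (simp add: zorn_norm_mult)
  then have "zorn_norm ?p = 0" unfolding zorn_norm_one_add tr by simp
  with tr show "?p * ?p = 0" using zorn_square[of ?p] by simp
qed

lemma square_zero_pair_product:
  fixes n m :: "'a::field zorn"
  assumes n: "n * n = 0" and m: "m * m = 0"
  shows "n * m + m * n = zorn_scale (zorn_trace (n * m)) 1" "(n * m) * n = zorn_scale (zorn_trace (n * m)) n"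
    "n * (n * m) = 0"
proof -
  have conj: "zorn_conj n = - n"
    using square_zero(1)[OF n] by (cases n) (auto simp: add_eq_0_iff)
  show "n * m + m * n = zorn_scale (zorn_trace (n * m)) 1"
    using zorn_anticommutator[of n m] square_zero[OF n] square_zero[OF m] by simp
  show "(n * m) * n = zorn_scale (zorn_trace (n * m)) n"
    using zorn_sandwich[of n m] square_zero[OF n] by simp
  show "n * (n * m) = 0"
    using zorn_conj_cancel(1)[of n m] square_zero[OF n] by (simp add: conj)
qed

lemma one_plus_braid_product:
  fixes n m :: "'a::field zorn"
  assumes n: "n * n = 0" and m: "m * m = 0"
  defines "t \<equiv> zorn_trace (n * m)"
  shows "((1 + n) * (1 + m)) * (1 + n) = zorn_scale (1 + t) 1 + zorn_scale (2 + t) n + m"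
proof -
  have "((1 + n) * (1 + m)) * (1 + n) = 1 + n + n + m + (n * m + m * n) + (n * m) * n"
    by (simp add: zorn_distrib n algebra_simps)
  also have "\<dots> = 1 + n + n + m + zorn_scale t 1 + zorn_scale t n"
    by (simp add: square_zero_pair_product[OF n m] t_def)
  also have "\<dots> = zorn_scale (1 + t) 1 + zorn_scale (2 + t) n + m"
    by (cases n; cases m) (simp add: zero_one_oct algebra_simps)
  finally show ?thesis .
qed

text \<open>
  With \<open>t = tr (n * m)\<close>, the two sides of the braid relation differ by \<open>(1 + t) (n - m)\<close>. If they agree only up
  to a minus sign, then traces give \<open>4 (1 + t) = 0\<close>, so again \<open>t = -1\<close> unless signs do not matter.
\<close>

lemma braid_iff:
  fixes n m :: "'a::field zorn"
  assumes n: "n * n = 0" and m: "m * m = 0"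
  shows "zorn_trace (n * m) = - 1 \<longleftrightarrow>
    n \<noteq> m \<and> ((1 + n) * (1 + m)) * (1 + n) \<doteq> ((1 + m) * (1 + n)) * (1 + m)"
proof -
  define t where "t = zorn_trace (n * m)"
  have t': "zorn_trace (m * n) = t" by (simp add: t_def zorn_trace_commute)
  note prod = one_plus_braid_product[OF n m, folded t_def] one_plus_braid_product[OF m n, unfolded t']
  have "t = - 1" if ne: "n \<noteq> m" and eq: "((1 + n) * (1 + m)) * (1 + n) \<doteq> ((1 + m) * (1 + n)) * (1 + m)"
  proof -
    have pos: "t = - 1" if "zorn_scale (1 + t) 1 + zorn_scale (2 + t) n + m
        = zorn_scale (1 + t) 1 + zorn_scale (2 + t) m + n"
    proof -
      have "zorn_scale (1 + t) n = zorn_scale (1 + t) m"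
        using that by (cases n; cases m) (simp add: zero_one_oct algebra_simps)
      with ne have "1 + t = 0" by (cases n; cases m) (auto simp: zero_one_oct)
      then show ?thesis by (simp add: add_eq_0_iff)
    qed
    show ?thesis
    proof (cases "(2 :: 'a) = 0")
      case True
      then show ?thesis using eq uminus_eq_self_char_2[OF True] pos unfolding eq_sign_def prod by metis
    next
      case False
      show ?thesis
      proof (rule ccontr)
        assume "t \<noteq> - 1"
        with eq pos have "zorn_scale (1 + t) 1 + zorn_scale (2 + t) n + m
            = - (zorn_scale (1 + t) 1 + zorn_scale (2 + t) m + n)"
          unfolding eq_sign_def prod by blast
        then have "zorn_trace (zorn_scale (1 + t) 1 + zorn_scale (2 + t) n + m)
            = zorn_trace (- (zorn_scale (1 + t) 1 + zorn_scale (2 + t) m + n))" by simp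
        then have "(1 + t) * 2 = - ((1 + t) * 2)"
          using square_zero[OF n] square_zero[OF m] by simp
        then have "4 * (1 + t) = 0" by (simp add: eq_neg_iff_add_eq_0 algebra_simps)
        then have "1 + t = 0" using False by (simp only: mult_eq_0_iff four_eq_0_iff) simp
        with \<open>t \<noteq> - 1\<close> show False by (simp add: add_eq_0_iff)
      qed
    qed
  qed
  moreover have "n \<noteq> m \<and> ((1 + n) * (1 + m)) * (1 + n) \<doteq> ((1 + m) * (1 + n)) * (1 + m)" if "t = - 1"
    using that n unfolding prod by (auto simp: t_def add.commute)
  ultimately show ?thesis unfolding t_def by blast
qed

section \<open>Unipotent elements\<close>

definition unip :: "'a::field zorn \<Rightarrow> bool" where
  "unip u \<longleftrightarrow> (\<exists>n. nilp n \<and> u \<doteq> 1 + n)"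

lemma unip_iff:
  assumes "zorn_norm u = 1"
  shows "unip u \<longleftrightarrow> (zorn_trace u = 2 \<or> zorn_trace u = - 2) \<and> \<not> u \<doteq> 1"
proof
  assume "unip u"
  then obtain n where n: "nilp n" "u \<doteq> 1 + n" by (auto simp: unip_def)
  moreover have "\<not> 1 + n \<doteq> 1 + 0"
    using one_plus_eq_sign[of n 0] n(1) by (auto simp: nilp_def)
  moreover have "\<not> u \<doteq> 1" using calculation eq_sign_sym eq_sign_trans by fastforce
  ultimately show "(zorn_trace u = 2 \<or> zorn_trace u = - 2) \<and> \<not> u \<doteq> 1"
    by (auto simp: nilp_iff eq_sign_def[of u "1 + n"])
next
  assume u: "(zorn_trace u = 2 \<or> zorn_trace u = - 2) \<and> \<not> u \<doteq> 1"
  have *: "unip v" if v: "zorn_norm v = 1" "zorn_trace v = 2" "\<not> v \<doteq> 1" for v :: "'a zorn"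
  proof -
    have "zorn_norm (v + - 1) = 0" using v zorn_norm_add[of v "- 1"] by simp
    moreover have "v + - 1 \<noteq> 0" using v(3) by auto
    ultimately have "nilp (v + - 1)" using v by (simp add: nilp_iff)
    then show ?thesis unfolding unip_def by (intro exI[of _ "v + - 1"]) simp
  qed
  from u show "unip u"
  proof (elim conjE disjE)
    assume "zorn_trace u = - 2" "\<not> u \<doteq> 1"
    then have "unip (- u)" using assms by (intro *) auto
    then show ?thesis by (simp add: unip_def)
  qed (use * assms in blast)
qed

text \<open>
  Powers of an element of norm 1 and trace \<open>t\<close>, from \<open>u * u = t u - 1\<close>; their traces are the Dickson
  polynomials in \<open>t\<close>.
\<close>

lemma powers_by_trace:
  fixes u :: "'a::field zorn"
  assumes u: "zorn_norm u = 1"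
  defines "t \<equiv> zorn_trace u"
  shows "u * u = zorn_scale t u + zorn_scale (- 1) 1"
    "(u * u) * u = zorn_scale (t ^ 2 - 1) u + zorn_scale (- t) 1"
    "(u * u) * (u * u) = zorn_scale (t ^ 3 - 2 * t) u + zorn_scale (1 - t ^ 2) 1"
    "((u * u) * (u * u)) * u = zorn_scale (t ^ 4 - 3 * t ^ 2 + 1) u + zorn_scale (2 * t - t ^ 3) 1"
proof -
  show 2: "u * u = zorn_scale t u + zorn_scale (- 1) 1"
    unfolding t_def using zorn_square[of u] u by simp
  have mult: "(zorn_scale a u + zorn_scale b 1) * (zorn_scale c u + zorn_scale d 1)
      = zorn_scale (a * c * t + a * d + b * c) u + zorn_scale (b * d - a * c) 1" for a b c d
  proof -
    have "(zorn_scale a u + zorn_scale b 1) * (zorn_scale c u + zorn_scale d 1)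
      = zorn_scale (a * c) (u * u) + zorn_scale (a * d + b * c) u + zorn_scale (b * d) 1"
      by (simp add: zorn_distrib zorn_scale_distrib algebra_simps)
    also have "\<dots> = zorn_scale (a * c * t + a * d + b * c) u + zorn_scale (b * d - a * c) 1"
      unfolding 2 by (cases u) (simp add: zero_one_oct algebra_simps)
    finally show ?thesis .
  qed
  have u1: "u = zorn_scale 1 u + zorn_scale 0 1" by simp
  have 3: "(u * u) * u = (zorn_scale t u + zorn_scale (- 1) 1) * (zorn_scale 1 u + zorn_scale 0 1)"
    unfolding 2 by simp
  show "(u * u) * u = zorn_scale (t ^ 2 - 1) u + zorn_scale (- t) 1"
    unfolding 3 mult by (simp add: power2_eq_square)
  show 4: "(u * u) * (u * u) = zorn_scale (t ^ 3 - 2 * t) u + zorn_scale (1 - t ^ 2) 1"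
    unfolding 2 mult by (simp add: power2_eq_square power3_eq_cube algebra_simps)
  have 5: "((u * u) * (u * u)) * u
      = (zorn_scale (t ^ 3 - 2 * t) u + zorn_scale (1 - t ^ 2) 1) * (zorn_scale 1 u + zorn_scale 0 1)"
    unfolding 4 by simp
  show "((u * u) * (u * u)) * u = zorn_scale (t ^ 4 - 3 * t ^ 2 + 1) u + zorn_scale (2 * t - t ^ 3) 1"
    unfolding 5 mult by (simp add: power2_eq_square power3_eq_cube power4_eq_xxxx algebra_simps)
qed

section \<open>Unipotence from products up to sign\<close>

text \<open>
  In characteristic \<open>p\<close>, the trace of \<open>u\<^sup>p\<close> is the \<open>p\<close>-th power of the trace of \<open>u\<close>. So \<open>u\<^sup>p = 1\<close> up to sign
  forces trace 2 or -2. Only \<open>p = 2, 3, 5\<close> need this: the conjugacy criterion below has exceptions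
  of order 3 and 5, and fails for \<open>p = 2\<close>.
\<close>

lemma unip_iff_char_2:
  fixes u :: "'a::field zorn"
  assumes "(2 :: 'a) = 0" and u: "zorn_norm u = 1"
  shows "unip u \<longleftrightarrow> u * u \<doteq> 1 \<and> \<not> u \<doteq> 1"
proof -
  have "u * u \<doteq> 1 \<longleftrightarrow> zorn_scale (zorn_trace u) u = 0"
    using powers_by_trace(1)[OF u] uminus_eq_self_char_2[OF assms(1)] unfolding eq_sign_def
    by (simp add: uminus_eq_self_char_2[OF assms(1)])
  also have "\<dots> \<longleftrightarrow> zorn_trace u = 0"
    using u by (cases u) (auto simp: zero_one_oct)
  finally show ?thesis using unip_iff[OF u] assms(1) by simp
qed

lemma unip_iff_char_3:
  fixes u :: "'a::field zorn"
  assumes 3: "(3 :: 'a) = 0" and u: "zorn_norm u = 1"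
  shows "unip u \<longleftrightarrow> (u * u) * u \<doteq> 1 \<and> \<not> u \<doteq> 1"
proof -
  define t where "t = zorn_trace u"
  note pow = powers_by_trace(2)[OF u, folded t_def]
  have "(u * u) * u \<doteq> 1" if "t = 2 \<or> t = - 2"
  proof -
    have "(4 :: 'a) - 1 = 0" "(2 :: 'a) = - 1" using 3 by (simp_all add: eq_neg_iff_add_eq_0)
    moreover from this have "zorn_scale 2 1 = - (1 :: 'a zorn)" by (simp only: zorn_scale_simps)
    ultimately show ?thesis using that unfolding pow eq_sign_def by (auto simp: power2_eq_square)
  qed
  moreover have "t = 2 \<or> t = - 2" if "(u * u) * u \<doteq> 1"
  proof -
    have "zorn_trace ((u * u) * u) = 2 \<or> zorn_trace ((u * u) * u) = - 2"
      using that by (auto simp: eq_sign_def)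
    then have "t ^ 3 - 3 * t = 2 \<or> t ^ 3 - 3 * t = - 2"
      unfolding pow by (simp add: t_def[symmetric] algebra_simps power2_eq_square power3_eq_cube)
    moreover have "(t - 2) ^ 3 = t ^ 3 - 3 * t - 2 + 3 * (5 * t - 2 * t ^ 2 - 2)"
      "(t + 2) ^ 3 = t ^ 3 - 3 * t + 2 + 3 * (5 * t + 2 * t ^ 2 + 2)"
      by (simp_all add: algebra_simps power2_eq_square power3_eq_cube)
    ultimately have "(t - 2) ^ 3 = 0 \<or> (t + 2) ^ 3 = 0" using 3 by auto
    then show ?thesis by (simp add: eq_neg_iff_add_eq_0)
  qed
  ultimately show ?thesis using unip_iff[OF u, folded t_def] by blast
qed

lemma unip_iff_char_5:
  fixes u :: "'a::field zorn"
  assumes 5: "(5 :: 'a) = 0" and u: "zorn_norm u = 1"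
  shows "unip u \<longleftrightarrow> ((u * u) * (u * u)) * u \<doteq> 1 \<and> \<not> u \<doteq> 1"
proof -
  define t where "t = zorn_trace u"
  note pow = powers_by_trace(4)[OF u, folded t_def]
  have "((u * u) * (u * u)) * u \<doteq> 1" if "t = 2 \<or> t = - 2"
  proof -
    have "(2 :: 'a) ^ 4 - 3 * 2 ^ 2 + 1 = 0" "(4 :: 'a) = - 1" using 5
      by (simp_all add: eq_neg_iff_add_eq_0 diff_eq_eq)
    moreover from this have "zorn_scale 4 1 = - (1 :: 'a zorn)" by (simp only: zorn_scale_simps)
    ultimately show ?thesis using that unfolding pow eq_sign_def by auto
  qed
  moreover have "t = 2 \<or> t = - 2" if "((u * u) * (u * u)) * u \<doteq> 1"
  proof -
    have "zorn_trace (((u * u) * (u * u)) * u) = 2 \<or> zorn_trace (((u * u) * (u * u)) * u) = - 2"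
      using that by (auto simp: eq_sign_def)
    then have "t ^ 5 - 5 * t ^ 3 + 5 * t = 2 \<or> t ^ 5 - 5 * t ^ 3 + 5 * t = - 2"
      unfolding pow by (simp add: t_def[symmetric] algebra_simps numeral_eq_Suc)
    moreover have "(t - 2) ^ 5 = t ^ 5 - 5 * t ^ 3 + 5 * t - 2 + 5 * (- 2 * t ^ 4 + 9 * t ^ 3 - 16 * t ^ 2 + 15 * t - 6)"
      "(t + 2) ^ 5 = t ^ 5 - 5 * t ^ 3 + 5 * t + 2 + 5 * (2 * t ^ 4 + 9 * t ^ 3 + 16 * t ^ 2 + 15 * t + 6)"
      by (simp_all add: algebra_simps power2_eq_square power3_eq_cube power_numeral_odd power_numeral_even)
    ultimately have "(t - 2) ^ 5 = 0 \<or> (t + 2) ^ 5 = 0" using 5 by auto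
    then show ?thesis by (simp add: eq_neg_iff_add_eq_0)
  qed
  ultimately show ?thesis using unip_iff[OF u, folded t_def] by blast
qed

text \<open>
  By transitivity it suffices to treat \<open>e\<^sub>1\<close>, which has the partner \<open>f\<^sub>1\<close>.
\<close>

lemma nilp_partner:
  assumes "nilp n"
  obtains m where "nilp m" "zorn_trace (n * m) = 1"
proof -
  obtain h where h: "h \<in> root_group" "h n = e1" using moved_e1[OF assms] by (auto simp: moved_def)
  note lin = linear_automorphism_root_group[OF h(1)]
  obtain m where m: "h m = oct 0 0 0 0 1 0 0 0" using lin by (metis linear_automorphism_def bij_pointE)
  have "nilp m" using nilp_image[OF lin, of m] m by (simp add: nilp_oct)
  then show ?thesis using trace_mult_image[OF lin assms, of m] h m by (intro that[of m]) simp_all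
qed

text \<open>
  In the copy of \<open>SL\<^sub>2\<close> spanned by \<open>n\<close> and a partner \<open>m\<close>, the element \<open>x\<close> is diagonal with entries 2 and 1/2, and
  conjugation by it multiplies \<open>n\<close> by 4.
\<close>

lemma unip_conj_power4:
  fixes u :: "'a::field zorn"
  assumes "unip u" and 2: "(2 :: 'a) \<noteq> 0"
  obtains x where "zorn_norm x = 1" "x * u \<doteq> ((u * u) * (u * u)) * x"
proof -
  obtain n where n: "nilp n" "u \<doteq> 1 + n" using assms(1) by (auto simp: unip_def)
  obtain m where m: "nilp m" "zorn_trace (n * m) = 1" using nilp_partner[OF n(1)] .
  have nn: "n * n = 0" and mm: "m * m = 0" using n m by (auto simp: nilp_def)
  note prod = square_zero_pair_product[OF nn mm, unfolded m(2), simplified]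
  define x where "x = zorn_scale (1 / 2) (1 + zorn_scale 3 (n * m))"
  have "zorn_norm (1 + zorn_scale 3 (n * m)) = 4"
    using m(2) square_zero[OF nn] by (simp add: zorn_norm_add zorn_norm_mult)
  moreover have "(4 :: 'a) \<noteq> 0" using 2 by (simp add: four_eq_0_iff)
  ultimately have "zorn_norm x = 1" unfolding x_def by (simp add: power2_eq_square)
  moreover have "x * u \<doteq> ((u * u) * (u * u)) * x"
  proof -
    have uu: "u * u = 1 + zorn_scale 2 n"
      using eq_sign_square[OF n(2)] one_plus_scale_mult[OF nn, of 1 1] by simp
    have u4: "(u * u) * (u * u) = 1 + zorn_scale 4 n"
      unfolding uu one_plus_scale_mult[OF nn] by simp
    have "zorn_scale (1 / 2) n + zorn_scale (3 / 2) n = zorn_scale (4 / 2) n"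
      by (simp flip: zorn_scale_distrib(2) add_divide_distrib)
    then have "x * (1 + n) = (1 + zorn_scale 4 n) * x"
      by (simp add: x_def zorn_distrib zorn_scale_distrib prod algebra_simps)
    then show ?thesis
      unfolding u4 using eq_sign_mult[OF eq_sign_refl n(2), of x] by simp
  qed
  ultimately show ?thesis using that by blast
qed

text \<open>
  Conjugate elements have equal traces, so \<open>t = t\<^sup>4 - 4 t\<^sup>2 + 2\<close>. This factors as
  \<open>(t - 2) (t + 1) (t\<^sup>2 + t - 1) = 0\<close>, and the last two factors belong to elements of order 3 and 5.
\<close>

lemma conj_power4_trace:
  fixes u :: "'a::field zorn"
  assumes x: "zorn_norm x = 1" and u: "zorn_norm u = 1" and eq: "x * u = ((u * u) * (u * u)) * x"
    and 3: "\<not> (u * u) * u \<doteq> 1" and 5: "\<not> ((u * u) * (u * u)) * u \<doteq> 1"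
  shows "zorn_trace u = 2"
proof -
  define t where "t = zorn_trace u"
  note pow = powers_by_trace[OF u, folded t_def]
  have "t = zorn_trace (zorn_conj x * (x * u))"
    unfolding zorn_conj_cancel(1) by (simp add: x t_def)
  also have "\<dots> = zorn_trace ((u * u) * (u * u))"
    unfolding eq zorn_trace_conj_mult by (simp add: x)
  also have "\<dots> = t ^ 4 - 4 * t ^ 2 + 2"
    unfolding pow(3) by (simp add: t_def[symmetric] algebra_simps power2_eq_square power3_eq_cube power4_eq_xxxx)
  finally have "(t - 2) * ((t + 1) * (t ^ 2 + t - 1)) = 0"
    by (simp add: algebra_simps power2_eq_square power4_eq_xxxx)
  moreover have "t + 1 \<noteq> 0"
  proof
    assume "t + 1 = 0"
    then have "t = - 1" by (simp add: eq_neg_iff_add_eq_0)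
    then show False using 3 unfolding pow(2) by simp
  qed
  moreover have "t ^ 2 + t - 1 \<noteq> 0"
  proof
    assume "t ^ 2 + t - 1 = 0"
    then have t2: "t ^ 2 = 1 - t" by (simp add: algebra_simps)
    have "t ^ 4 - 3 * t ^ 2 + 1 = (t ^ 2) ^ 2 - 3 * t ^ 2 + 1" by simp
    also have "\<dots> = (1 - t) ^ 2 - 3 * (1 - t) + 1" unfolding t2 ..
    also have "\<dots> = t ^ 2 - (1 - t)" by (simp add: algebra_simps power2_eq_square)
    finally have A: "t ^ 4 - 3 * t ^ 2 + 1 = 0" unfolding t2 by simp
    have "2 * t - t ^ 3 = 2 * t - t ^ 2 * t" by (simp add: power3_eq_cube power2_eq_square)
    also have "\<dots> = 2 * t - (1 - t) * t" by (simp only: t2)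
    also have "\<dots> = t + t ^ 2" by (simp add: algebra_simps power2_eq_square)
    also have "\<dots> = 1" by (simp add: t2)
    finally show False using 5 unfolding pow(4) A by simp
  qed
  ultimately have "t - 2 = 0" by simp
  then show ?thesis by (simp add: t_def)
qed

text \<open>
  The exclusion of order 3 and 5 is harmless for \<open>1 + n\<close>, whose powers are \<open>1 + k n\<close>. The case of a conjugation
  up to sign reduces to the previous lemma by passing from \<open>u\<close> to \<open>- u\<close>.
\<close>

lemma unip_iff_other_char:
  fixes u :: "'a::field zorn"
  assumes 2: "(2 :: 'a) \<noteq> 0" and 3: "(3 :: 'a) \<noteq> 0" and 5: "(5 :: 'a) \<noteq> 0" and u: "zorn_norm u = 1"
  shows "unip u \<longleftrightarrow> (\<exists>x. zorn_norm x = 1 \<and> x * u \<doteq> ((u * u) * (u * u)) * x) \<and>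
    \<not> (u * u) * u \<doteq> 1 \<and> \<not> ((u * u) * (u * u)) * u \<doteq> 1"
proof
  assume unip: "unip u"
  then obtain n where n: "nilp n" "u \<doteq> 1 + n" by (auto simp: unip_def)
  have nn: "n * n = 0" using n by (simp add: nilp_def)
  note power = one_plus_scale_mult[OF nn]
  have u2: "u * u \<doteq> 1 + zorn_scale 2 n"
    using eq_sign_mult[OF n(2) n(2)] power[of 1 1] by simp
  have u3: "(u * u) * u \<doteq> 1 + zorn_scale 3 n"
    using eq_sign_mult[OF u2 n(2)] power[of 2 1] by simp
  have "(u * u) * (u * u) \<doteq> 1 + zorn_scale 4 n"
    using eq_sign_mult[OF u2 u2] power[of 2 2] by simp
  from eq_sign_mult[OF this n(2)] have u5: "((u * u) * (u * u)) * u \<doteq> 1 + zorn_scale 5 n"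
    using power[of 4 1] by simp
  have ne: "\<not> 1 + zorn_scale c n \<doteq> 1" if "c \<noteq> 0" for c
    using one_plus_eq_sign[of "zorn_scale c n" 0] nn n(1) zorn_scale_eq_0_iff[of c n] that by (auto simp: nilp_def)
  have "\<not> (u * u) * u \<doteq> 1" using u3 ne[OF 3] eq_sign_sym eq_sign_trans by blast
  moreover have "\<not> ((u * u) * (u * u)) * u \<doteq> 1" using u5 ne[OF 5] eq_sign_sym eq_sign_trans by blast
  ultimately show "(\<exists>x. zorn_norm x = 1 \<and> x * u \<doteq> ((u * u) * (u * u)) * x) \<and>
    \<not> (u * u) * u \<doteq> 1 \<and> \<not> ((u * u) * (u * u)) * u \<doteq> 1"
    using unip_conj_power4[OF unip 2] by blast
next
  assume "(\<exists>x. zorn_norm x = 1 \<and> x * u \<doteq> ((u * u) * (u * u)) * x) \<and>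
    \<not> (u * u) * u \<doteq> 1 \<and> \<not> ((u * u) * (u * u)) * u \<doteq> 1"
  then obtain x where x: "zorn_norm x = 1" "x * u \<doteq> ((u * u) * (u * u)) * x"
    and no: "\<not> (u * u) * u \<doteq> 1" "\<not> ((u * u) * (u * u)) * u \<doteq> 1" by blast
  have "zorn_trace u = 2 \<or> zorn_trace u = - 2"
  proof (cases "x * u = ((u * u) * (u * u)) * x")
    case True
    then show ?thesis using conj_power4_trace[OF x(1) u _ no] by blast
  next
    case False
    then have "x * (- u) = ((- u * - u) * (- u * - u)) * x" using x(2) by (auto simp: eq_sign_def)
    then have "zorn_trace (- u) = 2" using conj_power4_trace[of x "- u"] x(1) u no by simp
    then show ?thesis by (metis minus_minus zorn_trace_simps(2))
  qed
  moreover have "\<not> u \<doteq> 1" using no(1) eq_sign_mult[of u 1 u 1] eq_sign_mult[of "u * u" 1 u 1] by auto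
  ultimately show "unip u" using unip_iff[OF u] by blast
qed

section \<open>Loop automorphisms\<close>

text \<open>
  An automorphism of the quotient loop, represented by a choice of preimages in \<open>M\<close>. Everything is
  therefore stated up to sign.
\<close>

locale loop_automorphism =
  fixes g :: "'a::field zorn \<Rightarrow> 'a zorn"
  assumes norm_g: "zorn_norm u = 1 \<Longrightarrow> zorn_norm (g u) = 1"
    and mult_g: "zorn_norm u = 1 \<Longrightarrow> zorn_norm v = 1 \<Longrightarrow> g (u * v) \<doteq> g u * g v"
    and eq_g_iff: "zorn_norm u = 1 \<Longrightarrow> zorn_norm v = 1 \<Longrightarrow> g u \<doteq> g v \<longleftrightarrow> u \<doteq> v"
    and surj_g: "zorn_norm w = 1 \<Longrightarrow> \<exists>u. zorn_norm u = 1 \<and> g u \<doteq> w"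
begin

lemma g_one: "g 1 \<doteq> 1"
proof -
  have "g 1 * 1 \<doteq> g 1 * g 1" using mult_g[of 1 1] by simp
  then show ?thesis using eq_sign_cancel(1)[of "g 1" 1 "g 1"] norm_g[of 1] eq_sign_sym by auto
qed

lemma g_image_iff:
  assumes "zorn_norm u = 1" "zorn_norm v = 1" "g u \<doteq> u'" "g v \<doteq> v'"
  shows "u \<doteq> v \<longleftrightarrow> u' \<doteq> v'"
  using eq_g_iff[OF assms(1,2)] assms(3,4) by (meson eq_sign_sym eq_sign_trans)

lemma g_image_mult:
  assumes "zorn_norm u = 1" "zorn_norm v = 1" "g u \<doteq> u'" "g v \<doteq> v'"
  shows "g (u * v) \<doteq> u' * v'"
  using mult_g[OF assms(1,2)] eq_sign_mult[OF assms(3,4)] by (rule eq_sign_trans)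

text \<open>
  Each criterion for being unipotent uses only products, the identity and equality up to sign,
  all of which \<open>g\<close> respects in both directions.
\<close>

lemma unip_g:
  assumes u: "zorn_norm u = 1"
  shows "unip (g u) \<longleftrightarrow> unip u"
proof -
  note gu = norm_g[OF u]
  have N: "zorn_norm (u * u) = 1" "zorn_norm ((u * u) * u) = 1" "zorn_norm ((u * u) * (u * u)) = 1"
    "zorn_norm (((u * u) * (u * u)) * u) = 1"
    using u by (simp_all add: zorn_norm_mult)
  have g2: "g (u * u) \<doteq> g u * g u"
    by (intro g_image_mult u eq_sign_refl)
  have g3: "g ((u * u) * u) \<doteq> (g u * g u) * g u"
    by (intro g_image_mult u N g2 eq_sign_refl)
  have g4: "g ((u * u) * (u * u)) \<doteq> (g u * g u) * (g u * g u)"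
    by (intro g_image_mult u N g2)
  have g5: "g (((u * u) * (u * u)) * u) \<doteq> ((g u * g u) * (g u * g u)) * g u"
    by (intro g_image_mult u N g4 eq_sign_refl)
  note one = g_image_iff[OF _ _ _ g_one, of _ _, simplified]
  have i1: "g u \<doteq> 1 \<longleftrightarrow> u \<doteq> 1" using one[OF u eq_sign_refl] by simp
  have i2: "g u * g u \<doteq> 1 \<longleftrightarrow> u * u \<doteq> 1" using one[OF N(1) g2] by simp
  have i3: "(g u * g u) * g u \<doteq> 1 \<longleftrightarrow> (u * u) * u \<doteq> 1" using one[OF N(2) g3] by simp
  have i5: "((g u * g u) * (g u * g u)) * g u \<doteq> 1 \<longleftrightarrow> ((u * u) * (u * u)) * u \<doteq> 1"
    using one[OF N(4) g5] by simp
  have conj: "(\<exists>y. zorn_norm y = 1 \<and> y * g u \<doteq> ((g u * g u) * (g u * g u)) * y) \<longleftrightarrow>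
      (\<exists>x. zorn_norm x = 1 \<and> x * u \<doteq> ((u * u) * (u * u)) * x)" (is "?L \<longleftrightarrow> ?R")
  proof -
    have *: "x * u \<doteq> ((u * u) * (u * u)) * x \<longleftrightarrow> y * g u \<doteq> ((g u * g u) * (g u * g u)) * y"
      if "zorn_norm x = 1" "g x \<doteq> y" for x y
      using that by (intro g_image_iff g_image_mult u N g4 eq_sign_refl) (simp_all add: zorn_norm_mult u)
    show ?thesis
    proof
      assume ?L
      then obtain y where y: "zorn_norm y = 1" "y * g u \<doteq> ((g u * g u) * (g u * g u)) * y" by blast
      then obtain x where "zorn_norm x = 1" "g x \<doteq> y" using surj_g by blast
      then show ?R using * y by blast
    qed (use * norm_g eq_sign_refl in blast)
  qed
  consider "(2 :: 'a) = 0" | "(3 :: 'a) = 0" | "(5 :: 'a) = 0" | "(2 :: 'a) \<noteq> 0" "(3 :: 'a) \<noteq> 0" "(5 :: 'a) \<noteq> 0"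
    by blast
  then show ?thesis
  proof cases
    case 1
    then show ?thesis using unip_iff_char_2[OF 1] u gu i1 i2 by simp
  next
    case 2
    then show ?thesis using unip_iff_char_3[OF 2] u gu i1 i3 by simp
  next
    case 3
    then show ?thesis using unip_iff_char_5[OF 3] u gu i1 i5 by simp
  next
    case 4
    then show ?thesis using unip_iff_other_char[OF 4] u gu i3 i5 conj by simp
  qed
qed

text \<open>
  The map on elements of square zero with \<open>g (1 + n) = 1 + \<nu> n\<close> up to sign.
\<close>

definition \<nu> :: "'a zorn \<Rightarrow> 'a zorn" where
  "\<nu> n = (THE m. m * m = 0 \<and> g (1 + n) \<doteq> 1 + m)"

lemma \<nu>_eqI:
  assumes "m * m = 0" "g (1 + n) \<doteq> 1 + m"
  shows "\<nu> n = m"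
  unfolding \<nu>_def
proof (rule the_equality)
  fix m' assume "m' * m' = 0 \<and> g (1 + n) \<doteq> 1 + m'"
  then show "m' = m" using one_plus_eq_sign assms eq_sign_sym eq_sign_trans by metis
qed (use assms in blast)

lemma \<nu>:
  assumes "n * n = 0"
  shows "\<nu> n * \<nu> n = 0" "g (1 + n) \<doteq> 1 + \<nu> n"
proof -
  have "\<exists>m. m * m = 0 \<and> g (1 + n) \<doteq> 1 + m"
  proof (cases "n = 0")
    case True
    then show ?thesis using g_one by (intro exI[of _ 0]) simp
  next
    case False
    then have "unip (1 + n)" using assms unfolding unip_def by (intro exI[of _ n]) (simp add: nilp_def)
    then have "unip (g (1 + n))" using unip_g assms by simp
    then show ?thesis by (auto simp: unip_def nilp_def)
  qed
  then have "\<nu> n * \<nu> n = 0 \<and> g (1 + n) \<doteq> 1 + \<nu> n" using \<nu>_eqI by metis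
  then show "\<nu> n * \<nu> n = 0" "g (1 + n) \<doteq> 1 + \<nu> n" by auto
qed

lemma \<nu>_zero [simp]: "\<nu> 0 = 0"
  using g_one by (intro \<nu>_eqI) simp_all

lemma \<nu>_inject:
  assumes "n * n = 0" "m * m = 0"
  shows "\<nu> n = \<nu> m \<longleftrightarrow> n = m"
proof
  assume "\<nu> n = \<nu> m"
  then have "g (1 + n) \<doteq> g (1 + m)" using \<nu>[OF assms(1)] \<nu>[OF assms(2)] eq_sign_sym eq_sign_trans by metis
  then show "n = m" using eq_g_iff[of "1 + n" "1 + m"] one_plus_eq_sign assms by simp
qed simp

lemma \<nu>_eq_0_iff: "n * n = 0 \<Longrightarrow> \<nu> n = 0 \<longleftrightarrow> n = 0"
  using \<nu>_inject[of n 0] by simp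

lemma nilp_\<nu>: "nilp n \<Longrightarrow> nilp (\<nu> n)"
  using \<nu> \<nu>_eq_0_iff by (auto simp: nilp_def)

lemma \<nu>_surj:
  assumes "nilp m"
  obtains n where "nilp n" "\<nu> n = m"
proof -
  have m: "m * m = 0" using assms by (simp add: nilp_def)
  then obtain u where u: "zorn_norm u = 1" "g u \<doteq> 1 + m" using surj_g[of "1 + m"] by auto
  then have "unip (g u)" using assms unfolding unip_def by blast
  then obtain n where n: "nilp n" "u \<doteq> 1 + n" using unip_g[OF u(1)] by (auto simp: unip_def)
  then have "g (1 + n) \<doteq> 1 + m"
    using eq_g_iff[of u "1 + n"] u eq_sign_sym eq_sign_trans by (metis nilp_def zorn_norm_one_plus)
  then have "\<nu> n = m" by (rule \<nu>_eqI[OF m])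
  with n show ?thesis using that by blast
qed

text \<open>
  Additive information about \<open>\<nu>\<close> comes from products of unipotent elements that are again unipotent.
\<close>

lemma \<nu>_mult:
  assumes "n * n = 0" "m * m = 0" "(1 + n) * (1 + m) = 1 + p"
    and "(1 + \<nu> n) * (1 + \<nu> m) = 1 + q" "q * q = 0"
  shows "\<nu> p = q"
  using assms(5) g_image_mult[of "1 + n" "1 + m", OF _ _ \<nu>(2)[OF assms(1)] \<nu>(2)[OF assms(2)]] assms
  by (intro \<nu>_eqI) simp_all

lemma \<nu>_opposite:
  assumes n: "n * n = 0" and m: "m * m = 0"
  shows "zorn_trace (n * m) = - 1 \<longleftrightarrow> zorn_trace (\<nu> n * \<nu> m) = - 1"
proof -
  note gn = \<nu>(2)[OF n] and gm = \<nu>(2)[OF m]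
  have "((1 + n) * (1 + m)) * (1 + n) \<doteq> ((1 + m) * (1 + n)) * (1 + m) \<longleftrightarrow>
     ((1 + \<nu> n) * (1 + \<nu> m)) * (1 + \<nu> n) \<doteq> ((1 + \<nu> m) * (1 + \<nu> n)) * (1 + \<nu> m)"
    by (intro g_image_iff g_image_mult gn gm) (simp_all add: zorn_norm_mult n m)
  then show ?thesis
    unfolding braid_iff[OF n m] braid_iff[OF \<nu>(1)[OF n] \<nu>(1)[OF m]] \<nu>_inject[OF n m] by simp
qed

end

text \<open>
  If \<open>k = c n\<close> and both traces are -1, then \<open>c = 1\<close>. Conversely, move \<open>n\<close> to \<open>e\<^sub>1\<close>; if \<open>k\<close> has a nonzero
  coordinate other than the one of \<open>e\<^sub>1\<close>, then an element \<open>m\<close> with both traces -1 can be written down, its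
  coordinates at \<open>f\<^sub>1\<close> and at the vector dual to that coordinate being prescribed.
\<close>

lemma proportional_iff:
  fixes n k :: "'a::field zorn"
  assumes n: "nilp n" and k: "nilp k"
  shows "(\<exists>c. k = zorn_scale c n) \<longleftrightarrow>
    k = n \<or> \<not> (\<exists>m. nilp m \<and> zorn_trace (n * m) = - 1 \<and> zorn_trace (k * m) = - 1)"
proof
  assume "\<exists>c. k = zorn_scale c n"
  then obtain c where "k = zorn_scale c n" by blast
  then show "k = n \<or> \<not> (\<exists>m. nilp m \<and> zorn_trace (n * m) = - 1 \<and> zorn_trace (k * m) = - 1)"
    by (cases "c = 1") auto
next
  assume R: "k = n \<or> \<not> (\<exists>m. nilp m \<and> zorn_trace (n * m) = - 1 \<and> zorn_trace (k * m) = - 1)"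
  show "\<exists>c. k = zorn_scale c n"
  proof (cases "k = n")
    case True
    then show ?thesis by (intro exI[of _ 1]) simp
  next
    case False
    with R have R: "\<not> (\<exists>m. nilp m \<and> zorn_trace (n * m) = - 1 \<and> zorn_trace (k * m) = - 1)" by blast
    obtain h where h: "h \<in> root_group" "h n = e1" using moved_e1[OF n] by (auto simp: moved_def)
    note lin = linear_automorphism_root_group[OF h(1)]
    have no: "\<not> (zorn_trace (e1 * m) = - 1 \<and> zorn_trace (h k * m) = - 1)" if "nilp m" for m
    proof -
      obtain m' where m': "m = h m'" using lin by (metis linear_automorphism_def bij_pointE)
      then have "nilp m'" using that nilp_image[OF lin] by simp
      then show ?thesis using R trace_mult_image[OF lin] n k h(2) m' by metis
    qed
    obtain a x1 x2 x3 y1 y2 y3 b where hk: "h k = oct a x1 x2 x3 y1 y2 y3 b" by (cases "h k")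
    have nil: "b = - a" "a * a + x1 * y1 + x2 * y2 + x3 * y3 = 0"
      using nilp_image[OF lin, of k] k hk by (simp_all add: nilp_oct)
    have "x2 = 0"
    proof (rule ccontr)
      assume "x2 \<noteq> 0"
      then show False using no[of "oct 0 0 0 0 (- 1) ((x1 - 1) / x2) 0 0"] by (simp add: nilp_oct hk)
    qed
    moreover have "x3 = 0"
    proof (rule ccontr)
      assume "x3 \<noteq> 0"
      then show False using no[of "oct 0 0 0 0 (- 1) 0 ((x1 - 1) / x3) 0"] by (simp add: nilp_oct hk)
    qed
    moreover have "y2 = 0"
    proof (rule ccontr)
      assume "y2 \<noteq> 0"
      then show False using no[of "oct 0 0 ((x1 - 1) / y2) 0 (- 1) 0 0 0"] by (simp add: nilp_oct hk)
    qed
    moreover have "y3 = 0"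
    proof (rule ccontr)
      assume "y3 \<noteq> 0"
      then show False using no[of "oct 0 0 0 ((x1 - 1) / y3) (- 1) 0 0 0"] by (simp add: nilp_oct hk)
    qed
    moreover have "y1 = 0"
    proof (rule ccontr)
      assume "y1 \<noteq> 0"
      define v where "v = (x1 - 1) / y1"
      then have "y1 * v = x1 - 1" using \<open>y1 \<noteq> 0\<close> by simp
      then show False using no[of "oct 0 v v 0 (- 1) 1 0 0"] calculation by (simp add: nilp_oct hk)
    qed
    ultimately have "h k = zorn_scale x1 (h n)" using nil by (simp add: hk h(2))
    also have "\<dots> = h (zorn_scale x1 n)" using lin by (simp add: linear_automorphism_def)
    finally have "k = zorn_scale x1 n" using lin by (metis linear_automorphism_def bij_is_inj injD)
    then show ?thesis by blast
  qed
qed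

context loop_automorphism
begin

lemma \<nu>_proportional:
  assumes n: "nilp n" and k: "nilp k"
  shows "(\<exists>c. \<nu> k = zorn_scale c (\<nu> n)) \<longleftrightarrow> (\<exists>c. k = zorn_scale c n)"
proof -
  have nn: "n * n = 0" and kk: "k * k = 0" using n k by (auto simp: nilp_def)
  have "(\<exists>m. nilp m \<and> zorn_trace (\<nu> n * m) = - 1 \<and> zorn_trace (\<nu> k * m) = - 1) \<longleftrightarrow>
    (\<exists>m. nilp m \<and> zorn_trace (n * m) = - 1 \<and> zorn_trace (k * m) = - 1)"
    using \<nu>_surj \<nu>_opposite[OF nn] \<nu>_opposite[OF kk] nilp_\<nu> nilp_def by metis
  then show ?thesis
    unfolding proportional_iff[OF n k] proportional_iff[OF nilp_\<nu>[OF n] nilp_\<nu>[OF k]]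
    using \<nu>_inject[OF kk nn] by simp
qed

text \<open>
  Two elements are not orthogonal if and only if some multiple of the first has trace form -1 with the second.
\<close>

lemma \<nu>_orthogonal:
  assumes n: "nilp n" and m: "nilp m"
  shows "zorn_trace (\<nu> n * \<nu> m) = 0 \<longleftrightarrow> zorn_trace (n * m) = 0"
proof -
  have *: "zorn_trace (n * m) \<noteq> 0 \<longleftrightarrow> (\<exists>k. nilp k \<and> (\<exists>c. k = zorn_scale c n) \<and> zorn_trace (k * m) = - 1)"
    if "nilp n" for n m :: "'a zorn"
  proof
    assume t: "zorn_trace (n * m) \<noteq> 0"
    have "nilp (zorn_scale (- 1 / zorn_trace (n * m)) n)"
      using that t by (simp add: nilp_def zorn_scale_eq_0_iff)
    then show "\<exists>k. nilp k \<and> (\<exists>c. k = zorn_scale c n) \<and> zorn_trace (k * m) = - 1"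
      using t by (intro exI[of _ "zorn_scale (- 1 / zorn_trace (n * m)) n"] conjI exI[of _ "- 1 / zorn_trace (n * m)"] refl) auto
  qed auto
  have "(\<exists>k. nilp k \<and> (\<exists>c. k = zorn_scale c (\<nu> n)) \<and> zorn_trace (k * \<nu> m) = - 1) \<longleftrightarrow>
     (\<exists>k. nilp k \<and> (\<exists>c. k = zorn_scale c n) \<and> zorn_trace (k * m) = - 1)"
    using \<nu>_surj \<nu>_proportional[OF n] \<nu>_opposite m nilp_\<nu> nilp_def by metis
  then show ?thesis using *[OF n, of m] *[OF nilp_\<nu>[OF n], of "\<nu> m"] by blast
qed

text \<open>
  On a line, \<open>\<nu>\<close> is an additive bijection of the scalars, as \<open>t \<mapsto> 1 + t n\<close> turns addition into
  multiplication.
\<close>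

lemma \<nu>_scale:
  assumes n: "nilp n"
  obtains \<sigma> where "\<And>t. \<nu> (zorn_scale t n) = zorn_scale (\<sigma> t) (\<nu> n)" "bij \<sigma>"
    "\<And>s t. \<sigma> (s + t) = \<sigma> s + \<sigma> t" "\<sigma> 1 = 1" "\<sigma> 0 = 0" "\<And>t. \<sigma> (- t) = - \<sigma> t"
proof -
  have nn: "n * n = 0" using n by (simp add: nilp_def)
  have n0: "\<nu> n \<noteq> 0" "\<nu> n * \<nu> n = 0" using nilp_\<nu>[OF n] by (auto simp: nilp_def)
  have "\<exists>c. \<nu> (zorn_scale t n) = zorn_scale c (\<nu> n)" for t
  proof (cases "t = 0")
    case True
    then show ?thesis by (intro exI[of _ 0]) simp
  next
    case False
    then have "nilp (zorn_scale t n)" using n by (simp add: nilp_def zorn_scale_eq_0_iff)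
    then show ?thesis using \<nu>_proportional[OF n] by blast
  qed
  then obtain \<sigma> where \<sigma>: "\<And>t. \<nu> (zorn_scale t n) = zorn_scale (\<sigma> t) (\<nu> n)" by metis
  have scale_inj: "c = d" if "zorn_scale c (\<nu> n) = zorn_scale d (\<nu> n)" for c d
    using that n0 by (simp add: zorn_scale_inject)
  have add: "\<sigma> (s + t) = \<sigma> s + \<sigma> t" for s t
  proof (rule scale_inj)
    have "\<nu> (zorn_scale (s + t) n) = zorn_scale (\<sigma> s + \<sigma> t) (\<nu> n)"
      by (rule \<nu>_mult[of "zorn_scale s n" "zorn_scale t n"])
        (simp_all add: nn n0 \<sigma> one_plus_scale_mult)
    then show "zorn_scale (\<sigma> (s + t)) (\<nu> n) = zorn_scale (\<sigma> s + \<sigma> t) (\<nu> n)" by (simp add: \<sigma>)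
  qed
  have 1: "\<sigma> 1 = 1" using \<sigma>[of 1] by (intro scale_inj) simp
  have 0: "\<sigma> 0 = 0" using add[of 0 0] by (metis add.right_neutral add_left_cancel)
  have neg: "\<sigma> (- t) = - \<sigma> t" for t using add[of "- t" t] 0 by (simp add: eq_neg_iff_add_eq_0)
  have inj: "s = t" if "\<sigma> s = \<sigma> t" for s t
  proof -
    have "\<nu> (zorn_scale s n) = \<nu> (zorn_scale t n)" using that \<sigma> by simp
    then have "zorn_scale s n = zorn_scale t n" using \<nu>_inject nn by simp
    then show ?thesis using n by (simp add: zorn_scale_inject nilp_def)
  qed
  have surj: "\<exists>t. \<sigma> t = c" for c
  proof (cases "c = 0")
    case False
    then have "nilp (zorn_scale c (\<nu> n))" using n0 by (simp add: nilp_def zorn_scale_eq_0_iff)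
    then obtain k where k: "nilp k" "\<nu> k = zorn_scale c (\<nu> n)" using \<nu>_surj by blast
    then obtain t where "k = zorn_scale t n" using \<nu>_proportional[OF n k(1)] by blast
    then show ?thesis using k \<sigma> scale_inj by metis
  qed (use 0 in blast)
  have "bij \<sigma>" by (rule bijI) (use inj surj in \<open>auto simp: inj_def surj_def, metis\<close>)
  then show ?thesis using that \<sigma> add 1 0 neg by blast
qed

end

section \<open>Generation of the loop\<close>

text \<open>
  Write \<open>X \<alpha>\<close> and \<open>Y \<beta>\<close> for the elements with diagonal 1, 1 and only the upper vector \<open>\<alpha>\<close> or the lower
  vector \<open>\<beta>\<close>. The product of \<open>X \<alpha>\<close> and \<open>X \<gamma>\<close> has upper vector \<open>\<alpha> + \<gamma>\<close> and lower vector \<open>\<alpha> \<times> \<gamma>\<close>;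
  multiplication by \<open>Y (- (\<alpha> \<times> \<gamma>))\<close> removes the latter and disturbs nothing else, the cross
  product of parallel vectors being zero. For vectors along the axes that correction is along an axis,
  and for a third summand it has only two nonzero coordinates, so all \<open>X \<alpha>\<close> and \<open>Y \<beta>\<close> are
  reached. Their products \<open>Y \<beta> * X \<alpha>\<close> are the elements with first diagonal entry 1, and any
  element of norm 1 becomes such by one or two multiplications with generators.
\<close>

lemma norm_one_generated:
  fixes u :: "'a::field zorn"
  assumes u: "zorn_norm u = 1"
    and mult: "\<And>u v. P u \<Longrightarrow> P v \<Longrightarrow> P (u * v)"
    and e: "\<And>t. P (oct 1 t 0 0 0 0 0 1)" "\<And>t. P (oct 1 0 t 0 0 0 0 1)" "\<And>t. P (oct 1 0 0 t 0 0 0 1)"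
    and f: "\<And>t. P (oct 1 0 0 0 t 0 0 1)" "\<And>t. P (oct 1 0 0 0 0 t 0 1)" "\<And>t. P (oct 1 0 0 0 0 0 t 1)"
  shows "P u"
proof -
  have X12: "P (oct 1 a b 0 0 0 0 1)" for a b
    using mult[OF f(3)[of "- (a * b)"] mult[OF e(1)[of a] e(2)[of b]]] by simp
  have Y12: "P (oct 1 0 0 0 a b 0 1)" for a b
    using mult[OF e(3)[of "a * b"] mult[OF f(1)[of a] f(2)[of b]]] by simp
  have X: "P (oct 1 a b c 0 0 0 1)" for a b c
    using mult[OF Y12[of "- (b * c)" "a * c"] mult[OF X12[of a b] e(3)[of c]]] by (simp add: algebra_simps)
  have Y: "P (oct 1 0 0 0 a b c 1)" for a b c
    using mult[OF X12[of "b * c" "- (a * c)"] mult[OF Y12[of a b] f(3)[of c]]] by (simp add: algebra_simps)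
  have one: "P (oct 1 x1 x2 x3 y1 y2 y3 b)" if "zorn_norm (oct 1 x1 x2 x3 y1 y2 y3 b) = 1" for x1 x2 x3 y1 y2 y3 b
  proof -
    have "b = y1 * x1 + y2 * x2 + y3 * x3 + 1" using that by (simp add: algebra_simps)
    then show ?thesis using mult[OF Y[of y1 y2 y3] X[of x1 x2 x3]] by simp
  qed
  have lower: "P u" if u: "u = oct a x1 x2 x3 y1 y2 y3 b" "zorn_norm u = 1" and y: "y1 \<noteq> 0 \<or> y2 \<noteq> 0 \<or> y3 \<noteq> 0"
    for u a x1 x2 x3 y1 y2 y3 b
  proof -
    have *: "P u" if v: "v * (w * u) = u" "P v" "zorn_norm w = 1" and w: "w * u = oct 1 x1' x2' x3' y1' y2' y3' b'"
      for v w x1' x2' x3' y1' y2' y3' b'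
    proof -
      have "zorn_norm (w * u) = 1" using v(3) u(2) by (simp add: zorn_norm_mult)
      then have "P (w * u)" unfolding w by (rule one)
      then show ?thesis using mult[OF v(2), of "w * u"] v(1) by simp
    qed
    from y show ?thesis
    proof (elim disjE)
      assume y: "y1 \<noteq> 0"
      define s where "s = (1 - a) / y1"
      with y have s: "a + s * y1 = 1" by simp
      have "oct 1 s 0 0 0 0 0 1 * u = oct (a + s * y1) (x1 + b * s) x2 x3 y1 (y2 - s * x3) (y3 + s * x2) b"
        by (simp add: u(1) algebra_simps)
      moreover have "oct 1 (- s) 0 0 0 0 0 1 * (oct 1 s 0 0 0 0 0 1 * u) = u"
        by (simp add: u(1) algebra_simps)
      ultimately show ?thesis using e(1)[of "- s"] unfolding s by (intro *) auto
    next
      assume y: "y2 \<noteq> 0"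
      define s where "s = (1 - a) / y2"
      with y have s: "a + s * y2 = 1" by simp
      have "oct 1 0 s 0 0 0 0 1 * u = oct (a + s * y2) x1 (x2 + b * s) x3 (y1 + s * x3) y2 (y3 - s * x1) b"
        by (simp add: u(1) algebra_simps)
      moreover have "oct 1 0 (- s) 0 0 0 0 1 * (oct 1 0 s 0 0 0 0 1 * u) = u"
        by (simp add: u(1) algebra_simps)
      ultimately show ?thesis using e(2)[of "- s"] unfolding s by (intro *) auto
    next
      assume y: "y3 \<noteq> 0"
      define s where "s = (1 - a) / y3"
      with y have s: "a + s * y3 = 1" by simp
      have "oct 1 0 0 s 0 0 0 1 * u = oct (a + s * y3) x1 x2 (x3 + b * s) (y1 - s * x2) (y2 + s * x1) y3 b"
        by (simp add: u(1) algebra_simps)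
      moreover have "oct 1 0 0 (- s) 0 0 0 1 * (oct 1 0 0 s 0 0 0 1 * u) = u"
        by (simp add: u(1) algebra_simps)
      ultimately show ?thesis using e(3)[of "- s"] unfolding s by (intro *) auto
    qed
  qed
  obtain a x1 x2 x3 y1 y2 y3 b where oct: "u = oct a x1 x2 x3 y1 y2 y3 b" by (cases u)
  show ?thesis
  proof (cases "y1 \<noteq> 0 \<or> y2 \<noteq> 0 \<or> y3 \<noteq> 0")
    case True
    then show ?thesis using lower oct u by blast
  next
    case False
    then have y: "y1 = 0" "y2 = 0" "y3 = 0" by auto
    let ?w = "oct 1 0 0 0 1 0 0 (1 :: 'a)"
    have a: "a \<noteq> 0" using u oct y by auto
    have "zorn_norm (?w * u) = 1" using u by (simp add: zorn_norm_mult)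
    moreover have "?w * u = oct a x1 (x2 + y3) (x3 - y2) (a + y1) y2 y3 (x1 + b)" using oct by simp
    ultimately have "P (?w * u)" using lower a y by force
    from mult[OF f(1)[of "- 1"] this] show ?thesis using oct by simp
  qed
qed

section \<open>Rigidity of loop automorphisms\<close>

lemma loop_automorphism_comp:
  assumes "loop_automorphism f" "loop_automorphism g"
  shows "loop_automorphism (f \<circ> g)"
proof -
  interpret f: loop_automorphism f by fact
  interpret g: loop_automorphism g by fact
  show ?thesis
  proof
    fix u v :: "'a zorn"
    assume u: "zorn_norm u = 1" and v: "zorn_norm v = 1"
    show "zorn_norm ((f \<circ> g) u) = 1" using u by (simp add: f.norm_g g.norm_g)
    have "f (g (u * v)) \<doteq> f (g u * g v)"
      using u v g.mult_g by (subst f.eq_g_iff) (simp_all add: g.norm_g zorn_norm_mult)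
    also have "\<dots> \<doteq> f (g u) * f (g v)" using u v by (intro f.mult_g g.norm_g)
    finally show "(f \<circ> g) (u * v) \<doteq> (f \<circ> g) u * (f \<circ> g) v" by simp
    show "(f \<circ> g) u \<doteq> (f \<circ> g) v \<longleftrightarrow> u \<doteq> v" using u v by (simp add: f.eq_g_iff g.eq_g_iff g.norm_g)
  next
    fix w :: "'a zorn" assume "zorn_norm w = 1"
    then obtain v where v: "zorn_norm v = 1" "f v \<doteq> w" using f.surj_g by blast
    obtain u where u: "zorn_norm u = 1" "g u \<doteq> v" using g.surj_g[OF v(1)] by blast
    have "f (g u) \<doteq> f v" using f.eq_g_iff[OF g.norm_g[OF u(1)] v(1)] u(2) by simp
    then show "\<exists>u. zorn_norm u = 1 \<and> (f \<circ> g) u \<doteq> w" using u(1) v(2) eq_sign_trans by auto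
  qed
qed

lemma loop_automorphismI:
  assumes "bij f" and mult: "\<And>u v. f (u * v) = f u * f v" and minus: "\<And>u. f (- u) = - f u"
    and norm: "\<And>u. zorn_norm (f u) = 1 \<longleftrightarrow> zorn_norm u = 1"
  shows "loop_automorphism f"
proof
  have inj: "f u = f v \<longleftrightarrow> u = v" for u v using \<open>bij f\<close> by (simp add: bij_is_inj inj_eq)
  show "f u \<doteq> f v \<longleftrightarrow> u \<doteq> v" for u v
    unfolding eq_sign_def minus[symmetric] inj ..
  show "\<exists>u. zorn_norm u = 1 \<and> f u \<doteq> w" if "zorn_norm w = 1" for w
  proof -
    obtain u where "f u = w" using \<open>bij f\<close> by (metis bij_pointE)
    then show ?thesis using that norm by auto
  qed
qed (simp_all add: mult norm)

lemma root_group_norm: "h \<in> root_group \<Longrightarrow> zorn_norm (h u) = zorn_norm u"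
proof (induction arbitrary: u rule: root_group.induct)
  case (root h r t)
  have "zorn_norm (root_aut r t u) = zorn_norm u"
    by (cases u; cases r) (simp_all add: algebra_simps power2_eq_square)
  with root show ?case by simp
qed simp

lemma loop_automorphism_root_group:
  assumes "h \<in> root_group"
  shows "loop_automorphism h"
proof -
  have h: "linear_automorphism h" using assms by (rule linear_automorphism_root_group)
  have "h (- u) = - h u" for u
    using h zorn_scale_simps(4,7) by (metis linear_automorphism_def)
  with h show ?thesis
    by (intro loop_automorphismI) (simp_all add: linear_automorphism_def root_group_norm[OF assms])
qed

lemma bij_zorn_map: "field_automorphism \<sigma> \<Longrightarrow> bij (zorn_map \<sigma>)"
  by (rule o_bij[of "zorn_map (inv_into UNIV \<sigma>)"]; simp add: fun_eq_iff zorn_map_inv)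

lemma loop_automorphism_zorn_map:
  assumes \<sigma>: "field_automorphism \<sigma>"
  shows "loop_automorphism (zorn_map \<sigma>)"
  using field_automorphism_simps(8)[OF \<sigma>, of _ 1]
  by (intro loop_automorphismI bij_zorn_map \<sigma>)
    (simp_all add: zorn_map_simps[OF \<sigma>] field_automorphism_simps(4)[OF \<sigma>])

context loop_automorphism
begin

lemma \<nu>_orthogonal_product:
  assumes n: "n * n = 0" and m: "m * m = 0" and t: "zorn_trace (n * m) = 0"
  shows "zorn_trace (\<nu> n * \<nu> m) = 0" "\<nu> (n + m + n * m) = \<nu> n + \<nu> m + \<nu> n * \<nu> m"
proof -
  show 0: "zorn_trace (\<nu> n * \<nu> m) = 0"
    using n m t \<nu>_orthogonal[of n m] by (cases "n = 0 \<or> m = 0") (auto simp: nilp_def)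
  show "\<nu> (n + m + n * m) = \<nu> n + \<nu> m + \<nu> n * \<nu> m"
    using square_zero_product[OF n m t] square_zero_product[OF \<nu>(1)[OF n] \<nu>(1)[OF m] 0]
    by (intro \<nu>_mult[OF n m])
qed

text \<open>
  For mutually orthogonal elements, the trace of \<open>\<nu> (n + m + n * m)\<close> with \<open>\<nu> k\<close> is that of the triple product, and
  it equals -1 on both sides simultaneously.
\<close>

lemma \<nu>_triple:
  assumes n: "n * n = 0" and m: "m * m = 0" and k: "k * k = 0"
    and t: "zorn_trace (n * m) = 0" "zorn_trace (n * k) = 0" "zorn_trace (m * k) = 0"
  shows "zorn_trace ((\<nu> n * \<nu> m) * \<nu> k) = - 1 \<longleftrightarrow> zorn_trace ((n * m) * k) = - 1"
proof -
  have "zorn_trace ((n + m + n * m) * k) = zorn_trace ((n * m) * k)"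
    using t by (simp add: zorn_distrib)
  moreover have "zorn_trace (\<nu> (n + m + n * m) * \<nu> k) = zorn_trace ((\<nu> n * \<nu> m) * \<nu> k)"
    using \<nu>_orthogonal_product[OF n m t(1)] \<nu>_orthogonal_product(1)[OF n k t(2)]
      \<nu>_orthogonal_product(1)[OF m k t(3)] by (simp add: zorn_distrib)
  ultimately show ?thesis
    using \<nu>_opposite[OF square_zero_product(1)[OF n m t(1)] k] by simp
qed

lemma \<nu>_minus: "nilp n \<Longrightarrow> \<nu> (- n) = - \<nu> n"
  using \<nu>_scale[of n] by (metis zorn_scale_simps(4,7))

text \<open>
  The relation in \<open>\<nu>_triple\<close> concerns the value -1, so it is applied with \<open>- z\<close>.
\<close>

lemma frame_\<nu>:
  assumes "frame x y z"
  shows "frame (\<nu> x) (\<nu> y) (\<nu> z)"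
proof -
  have nilp: "nilp x" "nilp y" "nilp z" using assms by (auto simp: frame_def)
  then have "zorn_trace ((\<nu> x * \<nu> y) * \<nu> (- z)) = - 1"
    using assms by (subst \<nu>_triple) (auto simp: frame_def nilp_def)
  then have "zorn_trace ((\<nu> x * \<nu> y) * \<nu> z) = 1"
    using nilp by (simp add: \<nu>_minus)
  then show ?thesis
    using assms nilp nilp_\<nu> \<nu>_orthogonal by (simp add: frame_def)
qed

text \<open>
  If \<open>p, q, r\<close> are the scalings along \<open>e\<^sub>1, e\<^sub>2, e\<^sub>3\<close>, then \<open>p a * q b * r c = -1\<close> whenever \<open>a * b * c = -1\<close>.
  Setting one argument to 1 gives \<open>p = q = r\<close>, and comparing \<open>(a, b)\<close> with \<open>(a * b, 1)\<close> gives
  multiplicativity.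
\<close>

lemma fixed_frame_field_automorphism:
  assumes "\<nu> e1 = e1" "\<nu> e2 = e2" "\<nu> e3 = e3"
  obtains \<sigma> where "field_automorphism \<sigma>" "\<And>t. \<nu> (zorn_scale t e1) = zorn_scale (\<sigma> t) e1"
    "\<And>t. \<nu> (zorn_scale t e2) = zorn_scale (\<sigma> t) e2" "\<And>t. \<nu> (zorn_scale t e3) = zorn_scale (\<sigma> t) e3"
proof -
  have nilp: "nilp (e1 :: 'a zorn)" "nilp (e2 :: 'a zorn)" "nilp (e3 :: 'a zorn)" by (simp_all add: nilp_oct)
  obtain p where p': "\<And>t. \<nu> (zorn_scale t e1) = zorn_scale (p t) (\<nu> e1)" "bij p"
    "\<And>s t. p (s + t) = p s + p t" "p 1 = 1" "p 0 = 0" "\<And>t. p (- t) = - p t"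
    by (rule \<nu>_scale[OF nilp(1)]) blast
  note p = p'[unfolded assms]
  obtain q where q': "\<And>t. \<nu> (zorn_scale t e2) = zorn_scale (q t) (\<nu> e2)" "bij q"
    "\<And>s t. q (s + t) = q s + q t" "q 1 = 1" "q 0 = 0" "\<And>t. q (- t) = - q t"
    by (rule \<nu>_scale[OF nilp(2)]) blast
  note q = q'[unfolded assms]
  obtain r where r': "\<And>t. \<nu> (zorn_scale t e3) = zorn_scale (r t) (\<nu> e3)" "bij r"
    "\<And>s t. r (s + t) = r s + r t" "r 1 = 1" "r 0 = 0" "\<And>t. r (- t) = - r t"
    by (rule \<nu>_scale[OF nilp(3)]) blast
  note r = r'[unfolded assms]
  have triple: "p a * q b * r c = - 1 \<longleftrightarrow> a * b * c = - 1" for a b c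
  proof -
    have "zorn_trace ((\<nu> (zorn_scale a e1) * \<nu> (zorn_scale b e2)) * \<nu> (zorn_scale c e3)) = - 1 \<longleftrightarrow>
      zorn_trace ((zorn_scale a e1 * zorn_scale b e2) * zorn_scale c e3) = - 1"
      by (rule \<nu>_triple) (simp_all add: zero_one_oct)
    then show ?thesis unfolding p(1) q(1) r(1) by simp
  qed
  have cancel: "x = y" if "x * z = - 1" "y * z = - 1" for x y z :: 'a
  proof -
    have "z \<noteq> 0" "x * z = y * z" using that by auto
    then show ?thesis by simp
  qed
  have pq: "p a = q a" for a
  proof (cases "a = 0")
    case False
    then have "p a * q 1 * r (- 1 / a) = - 1" "p 1 * q a * r (- 1 / a) = - 1"
      by (simp_all add: triple)
    then show ?thesis using p(4) q(4) cancel[of "p a" "r (- 1 / a)" "q a"] by simp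
  qed (simp add: p q)
  have qr: "r a = q a" for a
  proof (cases "a = 0")
    case False
    then have "p (- 1 / a) * q 1 * r a = - 1" "p (- 1 / a) * q a * r 1 = - 1"
      by (simp_all add: triple)
    then show ?thesis
      using r(4) q(4) cancel[of "r a" "p (- 1 / a)" "q a"] by (simp add: mult.commute)
  qed (simp add: r q)
  have mult: "q (a * b) = q a * q b" for a b
  proof (cases "a = 0 \<or> b = 0")
    case False
    then have "q a * q b * q (- 1 / (a * b)) = - 1" "q (a * b) * q 1 * q (- 1 / (a * b)) = - 1"
      using triple[of a b "- 1 / (a * b)"] triple[of "a * b" 1 "- 1 / (a * b)"] by (simp_all add: pq qr)
    then show ?thesis using q(4) cancel[of "q (a * b)" "q (- 1 / (a * b))" "q a * q b"] by simp
  qed (auto simp: q)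
  have "field_automorphism q" using q mult by (simp add: field_automorphism_def)
  then show ?thesis using that p q r pq qr by simp
qed

text \<open>
  Besides multiples of the \<open>e\<^sub>i\<close>, also \<open>a e\<^sub>i + b e\<^sub>j + a b f\<^sub>k\<close> is fixed for cyclic \<open>i, j, k\<close>, because \<open>1\<close> plus it is
  the product of \<open>1 + a e\<^sub>i\<close> and \<open>1 + b e\<^sub>j\<close>. The trace form with these fixed elements determines all coordinates of
  the image of \<open>t f\<^sub>k\<close> but the diagonal one, and that is zero since the image has norm 0. So \<open>g\<close> fixes a
  generating set up to sign.
\<close>

lemma fixed_generators:
  assumes e: "\<And>t. \<nu> (zorn_scale t e1) = zorn_scale t e1" "\<And>t. \<nu> (zorn_scale t e2) = zorn_scale t e2"
    "\<And>t. \<nu> (zorn_scale t e3) = zorn_scale t e3"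
    and u: "zorn_norm u = 1"
  shows "g u \<doteq> u"
proof -
  have fixp: "\<nu> (n + m + n * m) = n + m + n * m"
    if "n * n = 0" "m * m = 0" "zorn_trace (n * m) = 0" "\<nu> n = n" "\<nu> m = m" for n m
    using \<nu>_orthogonal_product[OF that(1-3)] that by simp
  have p12: "\<nu> (oct 0 a b 0 0 0 (a * b) 0) = oct 0 a b 0 0 0 (a * b) 0" for a b
    using fixp[of "zorn_scale a e1" "zorn_scale b e2"] e[of a] e[of b] by (simp add: zero_one_oct)
  have p23: "\<nu> (oct 0 0 a b (a * b) 0 0 0) = oct 0 0 a b (a * b) 0 0 0" for a b
    using fixp[of "zorn_scale a e2" "zorn_scale b e3"] e[of a] e[of b] by (simp add: zero_one_oct)
  have p31: "\<nu> (oct 0 b 0 a 0 (a * b) 0 0) = oct 0 b 0 a 0 (a * b) 0 0" for a b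
    using fixp[of "zorn_scale a e3" "zorn_scale b e1"] e[of a] e[of b] by (simp add: zero_one_oct)
  have e': "\<nu> (oct 0 t 0 0 0 0 0 0) = oct 0 t 0 0 0 0 0 0" "\<nu> (oct 0 0 t 0 0 0 0 0) = oct 0 0 t 0 0 0 0 0"
    "\<nu> (oct 0 0 0 t 0 0 0 0) = oct 0 0 0 t 0 0 0 0" for t
    using e[of t] by simp_all
  have sq: "n * n = 0" if "nilp n" for n :: "'a zorn" using that by (simp add: nilp_def)
  have orth: "zorn_trace (n * \<nu> m) = 0 \<longleftrightarrow> zorn_trace (n * m) = 0" if "\<nu> n = n" "nilp n" "nilp m" for n m
    using \<nu>_orthogonal[of n m] that by simp
  have opp: "zorn_trace (n * \<nu> m) = - 1 \<longleftrightarrow> zorn_trace (n * m) = - 1" if "\<nu> n = n" "nilp n" "nilp m" for n m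
    using \<nu>_opposite[OF sq sq, of n m] that by simp
  note dest = orth[OF e'(1)] orth[OF e'(2)] orth[OF e'(3)] opp[OF e'(1)] opp[OF e'(2)] opp[OF e'(3)]
    orth[OF p12] orth[OF p23] orth[OF p31] opp[OF p12] opp[OF p23] opp[OF p31]
  have f1: "\<nu> (oct 0 0 0 0 t 0 0 0) = oct 0 0 0 0 t 0 0 0" if "t \<noteq> 0" for t
  proof -
    let ?f = "oct 0 0 0 0 t 0 0 0"
    have nf: "nilp ?f" using that by (simp add: nilp_oct)
    obtain a x1 x2 x3 y1 y2 y3 b where v: "\<nu> ?f = oct a x1 x2 x3 y1 y2 y3 b" by (cases "\<nu> ?f")
    have n: "nilp (\<nu> ?f)" by (rule nilp_\<nu>[OF nf])
    have "y2 = 0" using orth[OF e'(2)[of 1] _ nf] by (simp add: nilp_oct v)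
    moreover have "y3 = 0" using orth[OF e'(3)[of 1] _ nf] by (simp add: nilp_oct v)
    moreover have y1: "y1 = t" using opp[OF e'(1)[of "- 1 / t"] _ nf] that by (simp add: nilp_oct v field_simps)
    moreover have "x1 = 0" using orth[OF p23[where a = 1 and b = 1] _ nf] calculation by (simp add: nilp_oct v)
    moreover have "x3 = 0" using opp[OF p12[where a = "- 1 / t" and b = 1] _ nf] calculation that by (simp add: nilp_oct v)
    moreover have "x2 = 0" using opp[OF p31[where a = 1 and b = "- 1 / t"] _ nf] calculation that by (simp add: nilp_oct v)
    ultimately show ?thesis using n v by (simp add: nilp_oct)
  qed
  have f2: "\<nu> (oct 0 0 0 0 0 t 0 0) = oct 0 0 0 0 0 t 0 0" if "t \<noteq> 0" for t
  proof -
    let ?f = "oct 0 0 0 0 0 t 0 0"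
    have nf: "nilp ?f" using that by (simp add: nilp_oct)
    obtain a x1 x2 x3 y1 y2 y3 b where v: "\<nu> ?f = oct a x1 x2 x3 y1 y2 y3 b" by (cases "\<nu> ?f")
    have n: "nilp (\<nu> ?f)" by (rule nilp_\<nu>[OF nf])
    have "y1 = 0" using orth[OF e'(1)[of 1] _ nf] by (simp add: nilp_oct v)
    moreover have "y3 = 0" using orth[OF e'(3)[of 1] _ nf] by (simp add: nilp_oct v)
    moreover have y2: "y2 = t" using opp[OF e'(2)[of "- 1 / t"] _ nf] that by (simp add: nilp_oct v field_simps)
    moreover have "x2 = 0" using orth[OF p31[where a = 1 and b = 1] _ nf] calculation by (simp add: nilp_oct v)
    moreover have "x1 = 0" using opp[OF p23[where a = "- 1 / t" and b = 1] _ nf] calculation that by (simp add: nilp_oct v)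
    moreover have "x3 = 0" using opp[OF p12[where a = 1 and b = "- 1 / t"] _ nf] calculation that by (simp add: nilp_oct v)
    ultimately show ?thesis using n v by (simp add: nilp_oct)
  qed
  have f3: "\<nu> (oct 0 0 0 0 0 0 t 0) = oct 0 0 0 0 0 0 t 0" if "t \<noteq> 0" for t
  proof -
    let ?f = "oct 0 0 0 0 0 0 t 0"
    have nf: "nilp ?f" using that by (simp add: nilp_oct)
    obtain a x1 x2 x3 y1 y2 y3 b where v: "\<nu> ?f = oct a x1 x2 x3 y1 y2 y3 b" by (cases "\<nu> ?f")
    have n: "nilp (\<nu> ?f)" by (rule nilp_\<nu>[OF nf])
    have "y1 = 0" using orth[OF e'(1)[of 1] _ nf] by (simp add: nilp_oct v)
    moreover have "y2 = 0" using orth[OF e'(2)[of 1] _ nf] by (simp add: nilp_oct v)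
    moreover have y3: "y3 = t" using opp[OF e'(3)[of "- 1 / t"] _ nf] that by (simp add: nilp_oct v field_simps)
    moreover have "x3 = 0" using orth[OF p12[where a = 1 and b = 1] _ nf] calculation by (simp add: nilp_oct v)
    moreover have "x2 = 0" using opp[OF p31[where a = "- 1 / t" and b = 1] _ nf] calculation that by (simp add: nilp_oct v)
    moreover have "x1 = 0" using opp[OF p23[where a = 1 and b = "- 1 / t"] _ nf] calculation that by (simp add: nilp_oct v)
    ultimately show ?thesis using n v by (simp add: nilp_oct)
  qed
  have one_plus: "zorn_norm (1 + n) = 1 \<and> g (1 + n) \<doteq> 1 + n" if "\<nu> n = n" "n * n = 0" for n
    using \<nu>(2)[OF that(2)] that by simp
  have f': "\<nu> (oct 0 0 0 0 t 0 0 0) = oct 0 0 0 0 t 0 0 0" "\<nu> (oct 0 0 0 0 0 t 0 0) = oct 0 0 0 0 0 t 0 0"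
    "\<nu> (oct 0 0 0 0 0 0 t 0) = oct 0 0 0 0 0 0 t 0" for t
    using f1[of t] f2[of t] f3[of t] \<nu>_zero by (cases "t = 0"; simp add: zero_one_oct)+
  have "zorn_norm u = 1 \<and> g u \<doteq> u"
    using u
  proof (rule norm_one_generated)
    fix u v assume "zorn_norm u = 1 \<and> g u \<doteq> u" "zorn_norm v = 1 \<and> g v \<doteq> v"
    then show "zorn_norm (u * v) = 1 \<and> g (u * v) \<doteq> u * v"
      using g_image_mult by (simp add: zorn_norm_mult)
  next
    fix t
    show "zorn_norm (oct 1 t 0 0 0 0 0 1) = 1 \<and> g (oct 1 t 0 0 0 0 0 1) \<doteq> oct 1 t 0 0 0 0 0 1"
      using one_plus[OF e'(1)[of t]] by (simp add: zero_one_oct)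
    show "zorn_norm (oct 1 0 t 0 0 0 0 1) = 1 \<and> g (oct 1 0 t 0 0 0 0 1) \<doteq> oct 1 0 t 0 0 0 0 1"
      using one_plus[OF e'(2)[of t]] by (simp add: zero_one_oct)
    show "zorn_norm (oct 1 0 0 t 0 0 0 1) = 1 \<and> g (oct 1 0 0 t 0 0 0 1) \<doteq> oct 1 0 0 t 0 0 0 1"
      using one_plus[OF e'(3)[of t]] by (simp add: zero_one_oct)
    show "zorn_norm (oct 1 0 0 0 t 0 0 1) = 1 \<and> g (oct 1 0 0 0 t 0 0 1) \<doteq> oct 1 0 0 0 t 0 0 1"
      using one_plus[OF f'(1)[of t]] by (simp add: zero_one_oct)
    show "zorn_norm (oct 1 0 0 0 0 t 0 1) = 1 \<and> g (oct 1 0 0 0 0 t 0 1) \<doteq> oct 1 0 0 0 0 t 0 1"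
      using one_plus[OF f'(2)[of t]] by (simp add: zero_one_oct)
    show "zorn_norm (oct 1 0 0 0 0 0 t 1) = 1 \<and> g (oct 1 0 0 0 0 0 t 1) \<doteq> oct 1 0 0 0 0 0 t 1"
      using one_plus[OF f'(3)[of t]] by (simp add: zero_one_oct)
  qed
  then show ?thesis by blast
qed

end

theorem loop_automorphism_semilinear:
  assumes "loop_automorphism g"
  obtains h \<sigma> where "linear_automorphism h" "field_automorphism \<sigma>"
    "\<And>u. zorn_norm u = 1 \<Longrightarrow> g u \<doteq> h (zorn_map \<sigma> u)"
proof -
  interpret g: loop_automorphism g by fact
  obtain h where h: "h \<in> root_group" "h (g.\<nu> e1) = e1" "h (g.\<nu> e2) = e2" "h (g.\<nu> e3) = e3"
    using frame_moved_to_standard[OF g.frame_\<nu>[OF frame_standard]] by blast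
  note lin = linear_automorphism_root_group[OF h(1)]
  interpret h: loop_automorphism h using h(1) by (rule loop_automorphism_root_group)
  \<comment> \<open>\<open>k\<close> fixes the standard frame; \<open>l\<close> below also has trivial scalings.\<close>
  interpret k: loop_automorphism "h \<circ> g" by (intro loop_automorphism_comp) unfold_locales
  have hadd: "h (1 + n) = 1 + h n" for n
    using lin linear_automorphism_one[OF lin] by (simp add: linear_automorphism_def)
  have hsq: "h n * h n = 0" if "n * n = 0" for n
    using lin that linear_automorphism_zero[OF lin] by (metis linear_automorphism_def)
  have k\<nu>: "k.\<nu> n = h (g.\<nu> n)" if "n * n = 0" for n
  proof (rule k.\<nu>_eqI)
    have "h (g (1 + n)) \<doteq> h (1 + g.\<nu> n)"
      using g.\<nu>[OF that] by (subst h.eq_g_iff) (simp_all add: g.norm_g that)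
    then show "(h \<circ> g) (1 + n) \<doteq> 1 + h (g.\<nu> n)" by (simp add: hadd)
  qed (use hsq g.\<nu>(1) that in blast)
  have "k.\<nu> e1 = e1" "k.\<nu> e2 = e2" "k.\<nu> e3 = e3"
    using h by (simp_all add: k\<nu> zero_one_oct)
  then obtain \<sigma> where \<sigma>: "field_automorphism \<sigma>" "\<And>t. k.\<nu> (zorn_scale t e1) = zorn_scale (\<sigma> t) e1"
    "\<And>t. k.\<nu> (zorn_scale t e2) = zorn_scale (\<sigma> t) e2" "\<And>t. k.\<nu> (zorn_scale t e3) = zorn_scale (\<sigma> t) e3"
    using k.fixed_frame_field_automorphism by blast
  let ?\<tau> = "inv_into UNIV \<sigma>"
  have \<tau>: "field_automorphism ?\<tau>" using \<sigma>(1) by (rule field_automorphism_inv)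
  have \<tau>\<sigma>: "?\<tau> (\<sigma> t) = t" for t using \<sigma>(1) by (simp add: field_automorphism_def bij_is_inj inv_f_f)
  interpret s: loop_automorphism "zorn_map ?\<tau>" using \<tau> by (rule loop_automorphism_zorn_map)
  interpret l: loop_automorphism "zorn_map ?\<tau> \<circ> (h \<circ> g)" by (intro loop_automorphism_comp) unfold_locales
  have l\<nu>: "l.\<nu> n = zorn_map ?\<tau> (k.\<nu> n)" if "n * n = 0" for n
  proof (rule l.\<nu>_eqI)
    have "zorn_map ?\<tau> ((h \<circ> g) (1 + n)) \<doteq> zorn_map ?\<tau> (1 + k.\<nu> n)"
      using k.\<nu>[OF that] by (subst s.eq_g_iff) (simp_all add: k.norm_g[unfolded comp_def] that)
    then show "(zorn_map ?\<tau> \<circ> (h \<circ> g)) (1 + n) \<doteq> 1 + zorn_map ?\<tau> (k.\<nu> n)"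
      by (simp add: zorn_map_simps[OF \<tau>])
    have "zorn_map ?\<tau> 0 = 0" by (simp add: zero_one_oct field_automorphism_simps[OF \<tau>])
    then show "zorn_map ?\<tau> (k.\<nu> n) * zorn_map ?\<tau> (k.\<nu> n) = 0"
      using k.\<nu>(1)[OF that] by (simp flip: zorn_map_simps(2)[OF \<tau>])
  qed
  have fixed: "(zorn_map ?\<tau> \<circ> (h \<circ> g)) u \<doteq> u" if "zorn_norm u = 1" for u
    by (rule l.fixed_generators[OF _ _ _ that])
      (subst l\<nu>, simp add: zero_one_oct, simp add: \<sigma>(2-4)[simplified] \<sigma>(2-4) zorn_map_simps[OF \<tau>] field_automorphism_simps[OF \<tau>] \<tau>\<sigma>)+
  show ?thesis
  proof (rule that)
    let ?h' = "inv_into UNIV h"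
    show "linear_automorphism ?h'" using lin by (rule linear_automorphism_inv)
    show "field_automorphism \<sigma>" by fact
    fix u :: "'a zorn" assume u: "zorn_norm u = 1"
    interpret s': loop_automorphism "zorn_map \<sigma>" using \<sigma>(1) by (rule loop_automorphism_zorn_map)
    have "zorn_map ?\<tau> (h (g u)) \<doteq> zorn_map ?\<tau> (zorn_map \<sigma> u)"
      using fixed[OF u] by (simp add: zorn_map_inv[OF \<sigma>(1)])
    then have "h (g u) \<doteq> zorn_map \<sigma> u"
      using u by (subst (asm) s.eq_g_iff) (simp_all add: g.norm_g h.norm_g s'.norm_g)
    moreover have "zorn_map \<sigma> u = h (?h' (zorn_map \<sigma> u))"
      using lin by (simp add: linear_automorphism_def bij_is_surj surj_f_inv_f)
    ultimately have "h (g u) \<doteq> h (?h' (zorn_map \<sigma> u))" by simp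
    moreover have "zorn_norm (?h' (zorn_map \<sigma> u)) = 1"
      using root_group_norm[OF h(1), of "?h' (zorn_map \<sigma> u)"] s'.norm_g[OF u] \<open>zorn_map \<sigma> u = _\<close> by simp
    ultimately show "g u \<doteq> ?h' (zorn_map \<sigma> u)"
      using u by (subst (asm) h.eq_g_iff) (simp_all add: g.norm_g)
  qed
qed

section \<open>The loop of classes up to sign\<close>

definition sign_class :: "'a::field zorn \<Rightarrow> 'a zorn set" where
  "sign_class u = {u, - u}"

lemma sign_class_eq_iff: "sign_class u = sign_class v \<longleftrightarrow> u \<doteq> v"
  by (auto simp: sign_class_def eq_sign_def doubleton_eq_iff)

lemma r_coset_center:
  "loop_center moufang_M #>\<^bsub>moufang_M\<^esub> u = sign_class u"
  unfolding loop_center_moufang_M by (auto simp: r_coset_def moufang_M_def sign_class_def)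

lemma carrier_Mstar: "carrier moufang_Mstar = sign_class ` {u. zorn_norm u = 1}"
  unfolding moufang_Mstar_def FactGroup_def RCOSETS_def r_coset_center
  by (auto simp: moufang_M_def)

lemma mult_Mstar:
  "sign_class u \<otimes>\<^bsub>moufang_Mstar\<^esub> sign_class v = sign_class (u * v)"
  by (auto simp: moufang_Mstar_def FactGroup_def set_mult_def moufang_M_def sign_class_def)

text \<open>
  Restricted to the carrier because automorphisms of a structure are extensional functions.
\<close>

definition class_map :: "('a::field zorn \<Rightarrow> 'a zorn) \<Rightarrow> 'a zorn set \<Rightarrow> 'a zorn set" where
  "class_map f = (\<lambda>C\<in>carrier moufang_Mstar. f ` C)"

lemma semilinear_automorphism_comp_zorn_map:
  assumes h: "linear_automorphism h" and \<sigma>: "field_automorphism \<sigma>"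
  shows "semilinear_automorphism (h \<circ> zorn_map \<sigma>)"
proof -
  have "bij (h \<circ> zorn_map \<sigma>)"
    using h bij_zorn_map[OF \<sigma>] by (simp add: linear_automorphism_def bij_comp)
  then show ?thesis
    using assms by (auto simp: semilinear_automorphism_def linear_automorphism_def zorn_map_simps)
qed

text \<open>
  The semilinear automorphisms in the form in which the semidirect product parametrises them.
\<close>

locale octonion_map =
  fixes h :: "'a::field zorn \<Rightarrow> 'a zorn" and \<sigma> :: "'a \<Rightarrow> 'a"
  assumes h: "linear_automorphism h" and \<sigma>: "field_automorphism \<sigma>"
begin

abbreviation "f \<equiv> h \<circ> zorn_map \<sigma>"

lemma f_simps: "f (u + v) = f u + f v" "f (u * v) = f u * f v" "f (- u) = - f u" "f 1 = 1"
  "f (zorn_scale c u) = zorn_scale (\<sigma> c) (f u)"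
proof -
  have "h (- u) = - h u" for u
    using h zorn_scale_simps(4,7) by (metis linear_automorphism_def)
  then show "f (u + v) = f u + f v" "f (u * v) = f u * f v" "f (- u) = - f u" "f 1 = 1"
    "f (zorn_scale c u) = zorn_scale (\<sigma> c) (f u)"
    using h linear_automorphism_one[OF h] by (simp_all add: zorn_map_simps[OF \<sigma>] linear_automorphism_def)
qed

sublocale loop_automorphism f
  using h by (intro loop_automorphism_comp loop_automorphism_root_group loop_automorphism_zorn_map \<sigma>)
    (simp add: root_group_eq)

lemma class_map_sign_class:
  assumes "zorn_norm u = 1"
  shows "class_map f (sign_class u) = sign_class (f u)"
proof -
  have "f ` sign_class u = sign_class (f u)" using f_simps(3)[of u] by (simp add: sign_class_def)
  then show ?thesis using assms by (simp add: class_map_def carrier_Mstar)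
qed

lemma induces: "induces_on_Mstar f (class_map f)"
  unfolding induces_on_Mstar_def r_coset_center
  using class_map_sign_class norm_g by (simp add: moufang_M_def)

lemma class_map_in_auto: "class_map f \<in> auto moufang_Mstar"
proof -
  have "class_map f \<in> hom moufang_Mstar moufang_Mstar"
  proof (rule homI)
    show "class_map f C \<in> carrier moufang_Mstar" if "C \<in> carrier moufang_Mstar" for C
      using that norm_g by (auto simp: carrier_Mstar class_map_sign_class simp del: comp_apply)
    show "class_map f (C \<otimes>\<^bsub>moufang_Mstar\<^esub> D) = class_map f C \<otimes>\<^bsub>moufang_Mstar\<^esub> class_map f D"
      if "C \<in> carrier moufang_Mstar" "D \<in> carrier moufang_Mstar" for C D
      using that by (auto simp: carrier_Mstar mult_Mstar class_map_sign_class zorn_norm_mult f_simps simp del: comp_apply)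
  qed
  moreover have "bij_betw (class_map f) (carrier moufang_Mstar) (carrier moufang_Mstar)"
    unfolding bij_betw_def
  proof
    show "inj_on (class_map f) (carrier moufang_Mstar)"
      by (auto simp: inj_on_def carrier_Mstar class_map_sign_class sign_class_eq_iff eq_g_iff simp del: comp_apply)
    show "class_map f ` carrier moufang_Mstar = carrier moufang_Mstar"
    proof (intro equalityI subsetI)
      fix C assume "C \<in> carrier (moufang_Mstar :: 'a zorn set monoid)"
      then obtain w where w: "C = sign_class w" "zorn_norm w = 1" by (auto simp: carrier_Mstar)
      then obtain u where "zorn_norm u = 1" "f u \<doteq> w" using surj_g by blast
      then have "C = class_map f (sign_class u)" "sign_class u \<in> carrier moufang_Mstar"
        using w by (auto simp: class_map_sign_class sign_class_eq_iff carrier_Mstar eq_sign_sym simp del: comp_apply)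
      then show "C \<in> class_map f ` carrier moufang_Mstar" by blast
    qed (use calculation in \<open>auto simp: hom_def\<close>)
  qed
  ultimately show ?thesis
    by (simp add: auto_def Bij_def class_map_def)
qed

end

lemma class_map_comp:
  assumes "octonion_map h \<sigma>" "octonion_map k \<tau>"
  shows "compose (carrier moufang_Mstar) (class_map (h \<circ> zorn_map \<sigma>)) (class_map (k \<circ> zorn_map \<tau>))
    = class_map ((h \<circ> zorn_map \<sigma>) \<circ> (k \<circ> zorn_map \<tau>))"
proof -
  interpret k: octonion_map k \<tau> by fact
  have "class_map k.f C \<in> carrier moufang_Mstar" if "C \<in> carrier moufang_Mstar" for C
    using k.class_map_in_auto that by (auto simp: auto_def hom_def)
  then show ?thesis
    by (auto simp: compose_def class_map_def image_image fun_eq_iff)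
qed

text \<open>
  Any choice of preimages of the values of \<open>\<phi>\<close> is a loop automorphism up to sign.
\<close>

lemma auto_Mstar_lift:
  fixes \<phi> :: "'a::field zorn set \<Rightarrow> 'a zorn set"
  assumes \<phi>: "\<phi> \<in> auto moufang_Mstar"
  obtains h \<sigma> where "octonion_map h \<sigma>" "\<phi> = class_map (h \<circ> zorn_map \<sigma>)"
proof -
  from \<phi> have hom: "\<phi> \<in> hom moufang_Mstar moufang_Mstar"
    and bij: "bij_betw \<phi> (carrier moufang_Mstar) (carrier moufang_Mstar)"
    and ext: "\<phi> \<in> extensional (carrier moufang_Mstar)"
    by (auto simp: auto_def Bij_def)
  have "\<exists>v. zorn_norm v = 1 \<and> \<phi> (sign_class u) = sign_class v" if "zorn_norm u = 1" for u
    using hom that by (force simp: hom_def carrier_Mstar)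
  then obtain g where g: "\<And>u. zorn_norm u = 1 \<Longrightarrow> zorn_norm (g u) = 1"
    "\<And>u. zorn_norm u = 1 \<Longrightarrow> \<phi> (sign_class u) = sign_class (g u)" by metis
  have carrier: "sign_class u \<in> carrier moufang_Mstar" if "zorn_norm u = 1" for u :: "'a zorn"
    using that by (simp add: carrier_Mstar)
  have "loop_automorphism g"
  proof
    fix u v :: "'a zorn" assume u: "zorn_norm u = 1" and v: "zorn_norm v = 1"
    have "sign_class (g (u * v)) = sign_class (g u * g v)"
      using hom_mult[OF hom carrier[OF u] carrier[OF v]] u v by (simp add: mult_Mstar g zorn_norm_mult)
    then show "g (u * v) \<doteq> g u * g v" by (simp add: sign_class_eq_iff)
    show "g u \<doteq> g v \<longleftrightarrow> u \<doteq> v"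
      using inj_on_eq_iff[OF bij_betw_imp_inj_on[OF bij] carrier[OF u] carrier[OF v]] u v
      by (simp add: g sign_class_eq_iff)
  next
    fix w :: "'a zorn" assume "zorn_norm w = 1"
    then have "sign_class w \<in> \<phi> ` carrier moufang_Mstar"
      using carrier bij by (simp add: bij_betw_def)
    then obtain u where "zorn_norm u = 1" "sign_class w = \<phi> (sign_class u)" by (auto simp: carrier_Mstar)
    then show "\<exists>u. zorn_norm u = 1 \<and> g u \<doteq> w" using g(2) sign_class_eq_iff by metis
  qed (fact g(1))
  then obtain h \<sigma> where h: "linear_automorphism h" "field_automorphism \<sigma>"
    and eq: "\<And>u. zorn_norm u = 1 \<Longrightarrow> g u \<doteq> h (zorn_map \<sigma> u)"
    using loop_automorphism_semilinear by blast
  interpret octonion_map h \<sigma> by unfold_locales (fact h)+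
  have "\<phi> = class_map f"
  proof (rule extensionalityI[OF ext])
    show "class_map f \<in> extensional (carrier moufang_Mstar)" by (simp add: class_map_def)
    fix C assume "C \<in> carrier (moufang_Mstar :: 'a zorn set monoid)"
    then obtain u where u: "C = sign_class u" "zorn_norm u = 1" by (auto simp: carrier_Mstar)
    then show "\<phi> C = class_map f C"
      using eq[OF u(2)] class_map_sign_class[OF u(2)] by (simp add: g sign_class_eq_iff)
  qed
  then show ?thesis using that octonion_map_axioms by blast
qed

text \<open>
  On \<open>1 + t e\<^sub>i\<close> the two maps agree up to sign, hence exactly. For \<open>t = 1\<close> this makes the linear parts agree on
  the standard frame, and then varying \<open>t\<close> identifies the field automorphisms.
\<close>

lemma class_map_inject:
  assumes "octonion_map h \<sigma>" "octonion_map k \<tau>"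
    and eq: "class_map (h \<circ> zorn_map \<sigma>) = class_map (k \<circ> zorn_map \<tau>)"
  shows "h = k \<and> \<sigma> = \<tau>"
proof -
  interpret h: octonion_map h \<sigma> by fact
  interpret k: octonion_map k \<tau> by fact
  have scale: "zorn_scale (\<sigma> t) (h.f n) = zorn_scale (\<tau> t) (k.f n)" if "n * n = 0" for n t
  proof -
    let ?n = "zorn_scale t n"
    have sq: "?n * ?n = 0" using that by simp
    have f0: "h.f 0 = 0" "k.f 0 = 0" using h.f_simps(5)[of 0 0] k.f_simps(5)[of 0 0]
      by (simp_all add: field_automorphism_simps[OF h.\<sigma>] field_automorphism_simps[OF k.\<sigma>])
    have "sign_class (h.f (1 + ?n)) = sign_class (k.f (1 + ?n))"
      using h.class_map_sign_class[of "1 + ?n"] k.class_map_sign_class[of "1 + ?n"] sq eq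
      by (simp del: comp_apply)
    then have "h.f (1 + ?n) \<doteq> k.f (1 + ?n)" by (simp only: sign_class_eq_iff)
    then have "1 + h.f ?n \<doteq> 1 + k.f ?n" by (simp only: h.f_simps k.f_simps)
    then have "h.f ?n = k.f ?n"
      using one_plus_eq_sign[of "h.f ?n" "k.f ?n"] sq f0 by (metis h.f_simps(2) k.f_simps(2))
    then show ?thesis by (simp only: h.f_simps k.f_simps)
  qed
  have frame: "h n = k n" if "n * n = 0" "zorn_map \<sigma> n = n" "zorn_map \<tau> n = n" for n
    using scale[OF that(1), of 1] that by (simp add: field_automorphism_simps[OF h.\<sigma>] field_automorphism_simps[OF k.\<sigma>])
  have he: "h e1 = k e1" "h e2 = k e2" "h e3 = k e3"
    by (intro frame;
      simp add: zero_one_oct field_automorphism_simps[OF h.\<sigma>] field_automorphism_simps[OF k.\<sigma>])+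
  have inv: "inv_into UNIV k (k u) = u" "k (inv_into UNIV k u) = u" for u
    using k.h by (simp_all add: linear_automorphism_def bij_is_inj bij_is_surj inv_f_f surj_f_inv_f)
  have "inv_into UNIV k \<circ> h = id"
    by (rule linear_automorphism_eq_id)
      (simp_all add: linear_automorphism_comp linear_automorphism_inv h.h k.h he inv)
  then have hk: "h = k" using inv(2) by (metis comp_apply id_apply ext)
  have "\<sigma> t = \<tau> t" for t
  proof -
    have "h.f e1 \<noteq> 0" "h.f e1 = k.f e1"
      using linear_automorphism_eq_zero_iff[OF h.h, of e1] he
      by (simp_all add: field_automorphism_simps[OF h.\<sigma>] field_automorphism_simps[OF k.\<sigma>] zero_one_oct)
    then show ?thesis using scale[of e1 t] by (simp add: zorn_scale_inject zero_one_oct)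
  qed
  with hk show ?thesis by blast
qed

section \<open>The isomorphism\<close>

definition octonion_action :: "'a::field ^ g2_index ^ g2_index \<Rightarrow> 'a zorn \<Rightarrow> 'a zorn" where
  "octonion_action A = (THE h. linear_automorphism h \<and> acts_on_g2 h A)"

lemma octonion_action_eqI:
  assumes "linear_automorphism h" "acts_on_g2 h A"
  shows "octonion_action A = h"
  unfolding octonion_action_def
  using assms acts_on_g2_faithful by blast

lemma octonion_action:
  assumes "A \<in> carrier G2"
  shows "linear_automorphism (octonion_action A)" "acts_on_g2 (octonion_action A) A"
  using assms octonion_action_eqI unfolding carrier_G2 by blast+

definition semidirect_to_auto :: "('a::field ^ g2_index ^ g2_index) \<times> ('a \<Rightarrow> 'a) \<Rightarrow> 'a zorn set \<Rightarrow> 'a zorn set" where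
  "semidirect_to_auto = (\<lambda>(A, \<sigma>). class_map (octonion_action A \<circ> zorn_map \<sigma>))"

lemma semidirect_carrier:
  "(A, \<sigma>) \<in> carrier G2_semidirect_Aut \<longleftrightarrow> A \<in> carrier G2 \<and> field_automorphism \<sigma>"
  by (simp add: G2_semidirect_Aut_def semidirect_product_def field_Aut_def)

lemma semidirect_mult:
  "(A, \<sigma>) \<otimes>\<^bsub>G2_semidirect_Aut\<^esub> (B, \<tau>) = (A ** map_matrix \<sigma> B, \<sigma> \<circ> \<tau>)"
  by (simp add: G2_semidirect_Aut_def semidirect_product_def field_Aut_def G2_def GL_def)

lemma octonion_map_action:
  "(A, \<sigma>) \<in> carrier G2_semidirect_Aut \<Longrightarrow> octonion_map (octonion_action A) \<sigma>"
  by (simp add: semidirect_carrier octonion_map_def octonion_action)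

text \<open>
  In \<open>h \<circ> \<sigma> \<circ> k \<circ> \<tau> = (h \<circ> (\<sigma> \<circ> k \<circ> \<sigma>\<^sup>-\<^sup>1)) \<circ> (\<sigma> \<circ> \<tau>)\<close>, the conjugate of \<open>k\<close> belongs to the matrix with \<open>\<sigma>\<close>
  applied to its entries.
\<close>

lemma semidirect_mult_action:
  assumes x: "(A, \<sigma>) \<in> carrier G2_semidirect_Aut" and y: "(B, \<tau>) \<in> carrier G2_semidirect_Aut"
  shows "(A, \<sigma>) \<otimes>\<^bsub>G2_semidirect_Aut\<^esub> (B, \<tau>) \<in> carrier G2_semidirect_Aut"
    and "semidirect_to_auto ((A, \<sigma>) \<otimes>\<^bsub>G2_semidirect_Aut\<^esub> (B, \<tau>)) =
      class_map ((octonion_action A \<circ> zorn_map \<sigma>) \<circ> (octonion_action B \<circ> zorn_map \<tau>))"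
proof -
  have A: "A \<in> carrier G2" and \<sigma>: "field_automorphism \<sigma>" and B: "B \<in> carrier G2" and \<tau>: "field_automorphism \<tau>"
    using x y by (auto simp: semidirect_carrier)
  let ?k = "zorn_map \<sigma> \<circ> octonion_action B \<circ> zorn_map (inv_into UNIV \<sigma>)"
  have lin: "linear_automorphism (octonion_action A \<circ> ?k)"
    by (intro linear_automorphism_comp[of "octonion_action A"] linear_automorphism_zorn_map octonion_action A B \<sigma>)
  have acts: "acts_on_g2 (octonion_action A \<circ> ?k) (A ** map_matrix \<sigma> B)"
    by (intro acts_on_g2_comp[of "octonion_action A"] acts_on_g2_zorn_map octonion_action A B \<sigma>)
  show "(A, \<sigma>) \<otimes>\<^bsub>G2_semidirect_Aut\<^esub> (B, \<tau>) \<in> carrier G2_semidirect_Aut"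
    using lin acts field_automorphism_comp[OF \<sigma> \<tau>]
    unfolding semidirect_mult semidirect_carrier carrier_G2 by blast
  have eq: "(octonion_action A \<circ> ?k) \<circ> zorn_map (\<sigma> \<circ> \<tau>)
      = (octonion_action A \<circ> zorn_map \<sigma>) \<circ> (octonion_action B \<circ> zorn_map \<tau>)"
    by (simp add: fun_eq_iff zorn_map_inv[OF \<sigma>] flip: zorn_map_comp)
  then show "semidirect_to_auto ((A, \<sigma>) \<otimes>\<^bsub>G2_semidirect_Aut\<^esub> (B, \<tau>)) =
      class_map ((octonion_action A \<circ> zorn_map \<sigma>) \<circ> (octonion_action B \<circ> zorn_map \<tau>))"
    by (simp only: semidirect_mult semidirect_to_auto_def prod.case octonion_action_eqI[OF lin acts] eq)
qed

lemma AutoGroup_mult: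
  assumes "\<phi> \<in> auto L" "\<psi> \<in> auto L"
  shows "\<phi> \<otimes>\<^bsub>AutoGroup L\<^esub> \<psi> = compose (carrier L) \<phi> \<psi>"
  using assms by (simp add: AutoGroup_def BijGroup_def auto_def)

lemma bij_semidirect_to_auto:
  "bij_betw semidirect_to_auto (carrier G2_semidirect_Aut) (auto (moufang_Mstar :: 'a::field zorn set monoid))"
  unfolding bij_betw_def
proof
  show "inj_on semidirect_to_auto (carrier (G2_semidirect_Aut :: (('a ^ g2_index ^ g2_index) \<times> ('a \<Rightarrow> 'a)) monoid))"
  proof (rule inj_onI)
    fix x y :: "('a ^ g2_index ^ g2_index) \<times> ('a \<Rightarrow> 'a)"
    assume x: "x \<in> carrier G2_semidirect_Aut" and y: "y \<in> carrier G2_semidirect_Aut"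
      and eq: "semidirect_to_auto x = semidirect_to_auto y"
    obtain A \<sigma> B \<tau> where xy: "x = (A, \<sigma>)" "y = (B, \<tau>)" by (metis surj_pair)
    have *: "octonion_action A = octonion_action B" "\<sigma> = \<tau>"
      using class_map_inject[of "octonion_action A" \<sigma> "octonion_action B" \<tau>] octonion_map_action x y eq
      by (auto simp: xy semidirect_to_auto_def)
    have "A \<in> carrier G2" "B \<in> carrier G2" using x y by (auto simp: xy semidirect_carrier)
    then have "A = B" using octonion_action[of A] octonion_action[of B] *(1) acts_on_g2_unique by metis
    with * show "x = y" by (simp add: xy)
  qed
  show "semidirect_to_auto ` carrier G2_semidirect_Aut = auto (moufang_Mstar :: 'a zorn set monoid)"
  proof (intro equalityI subsetI)
    fix \<phi> assume "\<phi> \<in> auto (moufang_Mstar :: 'a zorn set monoid)"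
    then obtain h \<sigma> where h: "octonion_map h \<sigma>" "\<phi> = class_map (h \<circ> zorn_map \<sigma>)" by (rule auto_Mstar_lift)
    then have lin: "linear_automorphism h" and \<sigma>: "field_automorphism \<sigma>" by (auto simp: octonion_map_def)
    then obtain A where A: "A \<in> carrier G2" "acts_on_g2 h A" using acts_on_g2_exists by blast
    then have "\<phi> = semidirect_to_auto (A, \<sigma>)" "(A, \<sigma>) \<in> carrier G2_semidirect_Aut"
      using h octonion_action_eqI[OF lin A(2)] \<sigma> by (simp_all add: semidirect_to_auto_def semidirect_carrier)
    then show "\<phi> \<in> semidirect_to_auto ` carrier G2_semidirect_Aut" by blast
  next
    fix \<phi> assume "\<phi> \<in> semidirect_to_auto ` carrier (G2_semidirect_Aut :: (('a ^ g2_index ^ g2_index) \<times> ('a \<Rightarrow> 'a)) monoid)"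
    then obtain A \<sigma> where "\<phi> = semidirect_to_auto (A, \<sigma>)" "(A, \<sigma>) \<in> carrier (G2_semidirect_Aut :: (('a ^ g2_index ^ g2_index) \<times> ('a \<Rightarrow> 'a)) monoid)"
      by (metis imageE surj_pair)
    then show "\<phi> \<in> auto (moufang_Mstar :: 'a zorn set monoid)"
      using octonion_map.class_map_in_auto[OF octonion_map_action] by (simp add: semidirect_to_auto_def)
  qed
qed

theorem theorem7p4:
  assumes "perfect_field TYPE('a::field)"
  shows "AutoGroup (moufang_Mstar :: 'a zorn set monoid) \<cong>
           (G2_semidirect_Aut :: (('a ^ g2_index ^ g2_index) \<times> ('a \<Rightarrow> 'a)) monoid)
       \<and> (\<forall>\<phi> \<in> auto (moufang_Mstar :: 'a zorn set monoid).
            \<exists>f. semilinear_automorphism f \<and> induces_on_Mstar f \<phi>)"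
proof
  let ?G = "G2_semidirect_Aut :: (('a ^ g2_index ^ g2_index) \<times> ('a \<Rightarrow> 'a)) monoid"
  let ?L = "moufang_Mstar :: 'a zorn set monoid"
  let ?inv = "inv_into (carrier ?G) semidirect_to_auto"
  note bij = bij_semidirect_to_auto[where 'a = 'a]
  have bij_inv: "bij_betw ?inv (auto ?L) (carrier ?G)" using bij by (rule bij_betw_inv_into)
  have "?inv (\<phi> \<otimes>\<^bsub>AutoGroup ?L\<^esub> \<psi>) = ?inv \<phi> \<otimes>\<^bsub>?G\<^esub> ?inv \<psi>"
    if \<phi>: "\<phi> \<in> auto ?L" and \<psi>: "\<psi> \<in> auto ?L" for \<phi> \<psi>
  proof -
    obtain A \<sigma> B \<tau> where x: "?inv \<phi> = (A, \<sigma>)" and y: "?inv \<psi> = (B, \<tau>)" by (metis surj_pair)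
    have xc: "(A, \<sigma>) \<in> carrier ?G" and yc: "(B, \<tau>) \<in> carrier ?G"
      using bij_inv \<phi> \<psi> unfolding x[symmetric] y[symmetric] by (auto simp: bij_betw_def)
    have "\<phi> = semidirect_to_auto (A, \<sigma>)" "\<psi> = semidirect_to_auto (B, \<tau>)"
      using bij_betw_inv_into_right[OF bij] \<phi> \<psi> x y by metis+
    then have "\<phi> \<otimes>\<^bsub>AutoGroup ?L\<^esub> \<psi> = semidirect_to_auto ((A, \<sigma>) \<otimes>\<^bsub>?G\<^esub> (B, \<tau>))"
      using class_map_comp[OF octonion_map_action[OF xc] octonion_map_action[OF yc]]
        semidirect_mult_action(2)[OF xc yc] AutoGroup_mult[OF \<phi> \<psi>]
      by (simp add: semidirect_to_auto_def)
    then show ?thesis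
      using bij_betw_inv_into_left[OF bij semidirect_mult_action(1)[OF xc yc]] x y by simp
  qed
  then have "?inv \<in> iso (AutoGroup ?L) ?G"
    using bij_inv by (auto simp: iso_def hom_def AutoGroup_def bij_betw_def)
  then show "AutoGroup ?L \<cong> ?G" by (auto simp: is_iso_def)
  show "\<forall>\<phi>\<in>auto ?L. \<exists>f. semilinear_automorphism f \<and> induces_on_Mstar f \<phi>"
    using auto_Mstar_lift semilinear_automorphism_comp_zorn_map octonion_map.induces
      octonion_map_def by metis
qed

end
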